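(* Let $n>5$, let $A_n$ be the alternating group of degree $n$, let $\theta\in\mathrm{Aut}(A_n)$, let $t\geq 1$ be an integer, and let $Q=(A_n,t,\theta)$. The following are equivalent: (i) $Q$ is superfaithful. (ii) $\theta=1$ and $t$ is coprime with $n!$.
   Context: A quandle is a set $Q$ with two binary operations $*,\backslash$ such that $x*(x\backslash y)=y=x\backslash(x*y)$, $x*x=x$ and $x*(y*z)=(x*y)*(x*z)$ for all $x,y,z$; each $L_x:y\mapsto x*y$ is a permutation of $Q$. A subalgebra is a nonempty subset closed under $*$ and $\backslash$. $Q$ is faithful if $L_x=L_y$ implies $x=y$, and superfaithful if every subalgebra of $Q$ is faithful (as a quandle in its own right). For a group $G$, $\theta\in\mathrm{Aut}(G)$ and $H\leq \mathrm{Fix}(\theta)=\{x\in G:\theta(x)=x\}$, the coset quandle $\mathcal{Q}(G,H,\theta)$ is the set $G/H$ of left cosets with $xH*yH=x\theta(x^{-1}y)H$. For $t\geq 1$ let $\theta_t\in\mathrm{Aut}(G^t)$, $\theta_t(x_1,\ldots,x_t)=(\theta(x_t),x_1,\ldots,x_{t-1})$; its fixed points are $H_t=\{(x,\ldots,x):x\in \mathrm{Fix}(\theta)\}$. Then $(G,t,\theta)$ denotes the quandle $\mathcal{Q}(G^t,H_t,\theta_t)$. *)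

theory Defs
  imports "HOL-Algebra.Algebra"
begin

record 'a quandle_ops = "'a partial_object" +
  qmult :: "'a \<Rightarrow> 'a \<Rightarrow> 'a" (infixl \<open>\<star>\<index>\<close> 70)
  qldiv :: "'a \<Rightarrow> 'a \<Rightarrow> 'a" (infixl \<open>\<setminus>\<index>\<close> 70)

locale quandle =
  fixes Q (structure)
  assumes qmult_closed: "\<lbrakk>x \<in> carrier Q; y \<in> carrier Q\<rbrakk> \<Longrightarrow> x \<star> y \<in> carrier Q"
    and qldiv_closed: "\<lbrakk>x \<in> carrier Q; y \<in> carrier Q\<rbrakk> \<Longrightarrow> x \<setminus> y \<in> carrier Q"
    and qmult_qldiv: "\<lbrakk>x \<in> carrier Q; y \<in> carrier Q\<rbrakk> \<Longrightarrow> x \<star> (x \<setminus> y) = y"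
    and qldiv_qmult: "\<lbrakk>x \<in> carrier Q; y \<in> carrier Q\<rbrakk> \<Longrightarrow> x \<setminus> (x \<star> y) = y"
    and qmult_idem: "x \<in> carrier Q \<Longrightarrow> x \<star> x = x"
    and qmult_distrib: "\<lbrakk>x \<in> carrier Q; y \<in> carrier Q; z \<in> carrier Q\<rbrakk>
          \<Longrightarrow> x \<star> (y \<star> z) = (x \<star> y) \<star> (x \<star> z)"

definition ltrans :: "('a, 'b) quandle_ops_scheme \<Rightarrow> 'a \<Rightarrow> 'a \<Rightarrow> 'a"
  where "ltrans Q x = (\<lambda>y\<in>carrier Q. x \<star>\<^bsub>Q\<^esub> y)"

definition faithful :: "('a, 'b) quandle_ops_scheme \<Rightarrow> bool"
  where "faithful Q \<longleftrightarrow> (\<forall>x\<in>carrier Q. \<forall>y\<in>carrier Q. ltrans Q x = ltrans Q y \<longrightarrow> x = y)"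

definition subquandle :: "'a set \<Rightarrow> ('a, 'b) quandle_ops_scheme \<Rightarrow> bool"
  where "subquandle S Q \<longleftrightarrow> S \<noteq> {} \<and> S \<subseteq> carrier Q \<and>
     (\<forall>x\<in>S. \<forall>y\<in>S. x \<star>\<^bsub>Q\<^esub> y \<in> S \<and> x \<setminus>\<^bsub>Q\<^esub> y \<in> S)"

definition superfaithful :: "('a, 'b) quandle_ops_scheme \<Rightarrow> bool"
  where "superfaithful Q \<longleftrightarrow> (\<forall>S. subquandle S Q \<longrightarrow> faithful (Q\<lparr>carrier := S\<rparr>))"

definition Fix :: "('a, 'b) monoid_scheme \<Rightarrow> ('a \<Rightarrow> 'a) \<Rightarrow> 'a set"
  where "Fix G \<theta> = {x \<in> carrier G. \<theta> x = x}"

text \<open>The operations on cosets are unions over all representatives; if \<open>H\<close> is a subgroup contained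
  in \<open>Fix G \<theta>\<close>, every representative contributes the same coset (\<open>coset_quandle_qmult\<close> and
  \<open>coset_quandle_qldiv\<close> below). Left division is the left multiplication
  formula with \<open>\<theta>\<close> replaced by its inverse.\<close>
definition coset_quandle ::
    "('a, 'b) monoid_scheme \<Rightarrow> 'a set \<Rightarrow> ('a \<Rightarrow> 'a) \<Rightarrow> 'a set quandle_ops"
  where "coset_quandle G H \<theta> =
    \<lparr>carrier = lcosets\<^bsub>G\<^esub> H,
     qmult = (\<lambda>A B. \<Union>x\<in>A. \<Union>y\<in>B. (x \<otimes>\<^bsub>G\<^esub> \<theta> (inv\<^bsub>G\<^esub> x \<otimes>\<^bsub>G\<^esub> y)) <#\<^bsub>G\<^esub> H),
     qldiv = (\<lambda>A B. \<Union>x\<in>A. \<Union>y\<in>B.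
                (x \<otimes>\<^bsub>G\<^esub> inv_into (carrier G) \<theta> (inv\<^bsub>G\<^esub> x \<otimes>\<^bsub>G\<^esub> y)) <#\<^bsub>G\<^esub> H)\<rparr>"

abbreviation power_group :: "('a, 'b) monoid_scheme \<Rightarrow> nat \<Rightarrow> (nat \<Rightarrow> 'a) monoid"
  where "power_group G t \<equiv> product_group {1..t} (\<lambda>_. G)"

definition shift_aut ::
    "('a, 'b) monoid_scheme \<Rightarrow> nat \<Rightarrow> ('a \<Rightarrow> 'a) \<Rightarrow> (nat \<Rightarrow> 'a) \<Rightarrow> nat \<Rightarrow> 'a"
  where "shift_aut G t \<theta> = (\<lambda>x\<in>carrier (power_group G t).
           (\<lambda>i\<in>{1..t}. if i = 1 then \<theta> (x t) else x (i - 1)))"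

definition diag_Fix :: "('a, 'b) monoid_scheme \<Rightarrow> nat \<Rightarrow> ('a \<Rightarrow> 'a) \<Rightarrow> (nat \<Rightarrow> 'a) set"
  where "diag_Fix G t \<theta> = (\<lambda>x. (\<lambda>i\<in>{1..t}. x)) ` Fix G \<theta>"

definition power_quandle ::
    "('a, 'b) monoid_scheme \<Rightarrow> nat \<Rightarrow> ('a \<Rightarrow> 'a) \<Rightarrow> (nat \<Rightarrow> 'a) set quandle_ops"
  where "power_quandle G t \<theta> =
    coset_quandle (power_group G t) (diag_Fix G t \<theta>) (shift_aut G t \<theta>)"


subsection \<open>The coset operations are well defined\<close>

lemma (in group) coset_op_indep:
  assumes H: "subgroup H G" and \<phi>: "\<phi> \<in> hom G G" and fixh: "\<And>h. h \<in> H \<Longrightarrow> \<phi> h = h"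
    and x: "x \<in> carrier G" and y: "y \<in> carrier G" and x': "x' \<in> x <# H" and y': "y' \<in> y <# H"
  shows "(x' \<otimes> \<phi> (inv x' \<otimes> y')) <# H = (x \<otimes> \<phi> (inv x \<otimes> y)) <# H"
proof -
  interpret \<phi>: group_hom G G \<phi>
    using \<phi> by unfold_locales
  obtain h k where h: "h \<in> H" "x' = x \<otimes> h" and k: "k \<in> H" "y' = y \<otimes> k"
    using x' y' by (auto simp: l_coset_def)
  have hk: "h \<in> carrier G" "k \<in> carrier G"
    using H h k subgroup.mem_carrier by metis+
  have "inv x' \<otimes> y' = inv h \<otimes> ((inv x \<otimes> y) \<otimes> k)"
    using x y hk h k by (simp add: inv_mult_group m_assoc)
  then have "\<phi> (inv x' \<otimes> y') = inv h \<otimes> (\<phi> (inv x \<otimes> y) \<otimes> k)"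
    using x y hk fixh h k H by (simp add: subgroup.m_inv_closed)
  then have "x' \<otimes> \<phi> (inv x' \<otimes> y') = x \<otimes> (h \<otimes> (inv h \<otimes> (\<phi> (inv x \<otimes> y) \<otimes> k)))"
    using x y hk h by (simp add: m_assoc)
  also have "\<dots> = (x \<otimes> \<phi> (inv x \<otimes> y)) \<otimes> k"
    using x y hk by (simp add: m_assoc[symmetric])
  finally have "x' \<otimes> \<phi> (inv x' \<otimes> y') \<in> (x \<otimes> \<phi> (inv x \<otimes> y)) <# H"
    using k by (auto simp: l_coset_def)
  then show ?thesis
    using l_repr_independence[OF _ _ H] x y by (metis \<phi>.hom_closed inv_closed m_closed)
qed

lemma (in group) coset_op_UN:
  assumes H: "subgroup H G" and \<phi>: "\<phi> \<in> hom G G" and fixh: "\<And>h. h \<in> H \<Longrightarrow> \<phi> h = h"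
    and x: "x \<in> carrier G" and y: "y \<in> carrier G"
  shows "(\<Union>x'\<in>x <# H. \<Union>y'\<in>y <# H. (x' \<otimes> \<phi> (inv x' \<otimes> y')) <# H)
           = (x \<otimes> \<phi> (inv x \<otimes> y)) <# H"
proof -
  have "x \<in> x <# H" "y \<in> y <# H"
    using lcos_self H x y by auto
  then show ?thesis
    using coset_op_indep[OF H \<phi> fixh x y] by blast
qed

lemma (in group) auto_inv_into:
  assumes "\<theta> \<in> auto G"
  shows "inv_into (carrier G) \<theta> \<in> hom G G"
    and "x \<in> carrier G \<Longrightarrow> \<theta> (inv_into (carrier G) \<theta> x) = x"
    and "x \<in> carrier G \<Longrightarrow> inv_into (carrier G) \<theta> (\<theta> x) = x"
proof -
  have b: "bij_betw \<theta> (carrier G) (carrier G)" and h: "\<theta> \<in> hom G G"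
    using assms by (auto simp: auto_def Bij_def)
  show "inv_into (carrier G) \<theta> \<in> hom G G"
    using group.iso_set_sym[OF is_group, of \<theta> G] b h by (auto simp: iso_def)
  show "x \<in> carrier G \<Longrightarrow> \<theta> (inv_into (carrier G) \<theta> x) = x"
    using b by (rule bij_betw_inv_into_right)
  show "x \<in> carrier G \<Longrightarrow> inv_into (carrier G) \<theta> (\<theta> x) = x"
    using b by (rule bij_betw_inv_into_left)
qed

context group
begin

context
  fixes H \<theta>
  assumes H: "subgroup H G" and \<theta>: "\<theta> \<in> auto G" and HF: "H \<subseteq> Fix G \<theta>"
begin

lemma coset_quandle_qmult:
  assumes "x \<in> carrier G" "y \<in> carrier G"
  shows "(x <# H) \<star>\<^bsub>coset_quandle G H \<theta>\<^esub> (y <# H) = (x \<otimes> \<theta> (inv x \<otimes> y)) <# H"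
proof -
  have "\<theta> \<in> hom G G" using \<theta> by (simp add: auto_def)
  moreover have "\<And>h. h \<in> H \<Longrightarrow> \<theta> h = h" using HF by (auto simp: Fix_def)
  ultimately show ?thesis
    using coset_op_UN[OF H _ _ assms, of \<theta>] by (simp add: coset_quandle_def)
qed

lemma coset_quandle_qldiv:
  assumes "x \<in> carrier G" "y \<in> carrier G"
  shows "(x <# H) \<setminus>\<^bsub>coset_quandle G H \<theta>\<^esub> (y <# H)
           = (x \<otimes> inv_into (carrier G) \<theta> (inv x \<otimes> y)) <# H"
proof -
  have "inv_into (carrier G) \<theta> h = h" if "h \<in> H" for h
  proof -
    have "\<theta> h = h" "h \<in> carrier G" using HF that by (auto simp: Fix_def)
    then show ?thesis using auto_inv_into(3)[OF \<theta>, of h] by simp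
  qed
  then show ?thesis
    using coset_op_UN[OF H auto_inv_into(1)[OF \<theta>] _ assms] by (simp add: coset_quandle_def)
qed

lemma quandle_coset_quandle: "quandle (coset_quandle G H \<theta>)"
proof -
  let ?Q = "coset_quandle G H \<theta>"
  let ?\<psi> = "inv_into (carrier G) \<theta>"
  interpret \<theta>: group_hom G G \<theta>
    using \<theta> by unfold_locales (simp add: auto_def)
  interpret \<psi>: group_hom G G ?\<psi>
    using auto_inv_into(1)[OF \<theta>] by unfold_locales
  have cE: "\<exists>x\<in>carrier G. A = x <# H" if "A \<in> carrier ?Q" for A
    using that by (auto simp: coset_quandle_def LCOSETS_def)
  have cI: "x <# H \<in> carrier ?Q" if "x \<in> carrier G" for x
    using that by (auto simp: coset_quandle_def LCOSETS_def)
  have cancel: "inv x \<otimes> (x \<otimes> y) = y" "x \<otimes> (inv x \<otimes> y) = y"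
    if "x \<in> carrier G" "y \<in> carrier G" for x y
    using that by (simp_all add: m_assoc[symmetric])
  show ?thesis
  proof
    fix A B assume "A \<in> carrier ?Q" "B \<in> carrier ?Q"
    then obtain x y where x: "x \<in> carrier G" "A = x <# H" and y: "y \<in> carrier G" "B = y <# H"
      using cE by metis
    show "A \<star>\<^bsub>?Q\<^esub> B \<in> carrier ?Q"
      using x y by (simp add: coset_quandle_qmult cI)
    show "A \<setminus>\<^bsub>?Q\<^esub> B \<in> carrier ?Q"
      using x y by (simp add: coset_quandle_qldiv cI)
    show "A \<star>\<^bsub>?Q\<^esub> (A \<setminus>\<^bsub>?Q\<^esub> B) = B"
      using x y by (simp add: coset_quandle_qmult coset_quandle_qldiv cancel auto_inv_into(2)[OF \<theta>]
          del: \<theta>.hom_mult \<psi>.hom_mult)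
    show "A \<setminus>\<^bsub>?Q\<^esub> (A \<star>\<^bsub>?Q\<^esub> B) = B"
      using x y by (simp add: coset_quandle_qmult coset_quandle_qldiv cancel auto_inv_into(3)[OF \<theta>]
          del: \<theta>.hom_mult \<psi>.hom_mult)
  next
    fix A assume "A \<in> carrier ?Q"
    then obtain x where x: "x \<in> carrier G" "A = x <# H"
      using cE by metis
    then show "A \<star>\<^bsub>?Q\<^esub> A = A"
      by (simp add: coset_quandle_qmult del: \<theta>.hom_mult)
  next
    fix A B C assume "A \<in> carrier ?Q" "B \<in> carrier ?Q" "C \<in> carrier ?Q"
    then obtain x y z where x: "x \<in> carrier G" "A = x <# H" and y: "y \<in> carrier G" "B = y <# H"
      and z: "z \<in> carrier G" "C = z <# H"
      using cE by metis
    have "x \<otimes> \<theta> (inv x \<otimes> (y \<otimes> \<theta> (inv y \<otimes> z)))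
        = (x \<otimes> \<theta> (inv x \<otimes> y)) \<otimes> \<theta> (inv (x \<otimes> \<theta> (inv x \<otimes> y)) \<otimes> (x \<otimes> \<theta> (inv x \<otimes> z)))"
      using x(1) y(1) z(1) by (simp add: inv_mult_group m_assoc cancel)
    then show "A \<star>\<^bsub>?Q\<^esub> (B \<star>\<^bsub>?Q\<^esub> C) = (A \<star>\<^bsub>?Q\<^esub> B) \<star>\<^bsub>?Q\<^esub> (A \<star>\<^bsub>?Q\<^esub> C)"
      using x y z by (simp add: coset_quandle_qmult del: \<theta>.hom_mult)
  qed
qed

end

end


subsection \<open>The data of the power quandle\<close>

lemma shift_aut_auto:
  assumes "group G" and \<theta>: "\<theta> \<in> auto G" and t: "t \<ge> 1"
  shows "shift_aut G t \<theta> \<in> auto (power_group G t)"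
proof -
  interpret group G by fact
  let ?P = "power_group G t"
  let ?\<psi> = "inv_into (carrier G) \<theta>"
  let ?g = "\<lambda>y. (\<lambda>i\<in>{1..t}. if i = t then ?\<psi> (y 1) else y (i + 1))"
  interpret \<theta>: group_hom G G \<theta>
    using \<theta> by unfold_locales (simp add: auto_def)
  interpret \<psi>: group_hom G G ?\<psi>
    using auto_inv_into(1)[OF \<theta>] by unfold_locales
  have cl: "shift_aut G t \<theta> x \<in> carrier ?P" if "x \<in> carrier ?P" for x
  proof -
    have "x i \<in> carrier G" if "1 \<le> i" "i \<le> t" for i using that \<open>x \<in> carrier ?P\<close> by auto
    then show ?thesis using that t by (auto simp: shift_aut_def)
  qed
  have "shift_aut G t \<theta> \<in> hom ?P ?P"
  proof (rule homI)
    fix x y assume x: "x \<in> carrier ?P" and y: "y \<in> carrier ?P"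
    have xy: "x \<otimes>\<^bsub>?P\<^esub> y \<in> carrier ?P"
      using x y by (auto simp: PiE_iff)
    show "shift_aut G t \<theta> (x \<otimes>\<^bsub>?P\<^esub> y) = shift_aut G t \<theta> x \<otimes>\<^bsub>?P\<^esub> shift_aut G t \<theta> y"
    proof
      fix i
      have "x t \<in> carrier G" "y t \<in> carrier G" using x y t by (auto simp: PiE_iff)
      then show "shift_aut G t \<theta> (x \<otimes>\<^bsub>?P\<^esub> y) i = (shift_aut G t \<theta> x \<otimes>\<^bsub>?P\<^esub> shift_aut G t \<theta> y) i"
        using x y xy t unfolding shift_aut_def by auto
    qed
  qed (rule cl)
  moreover have "bij_betw (shift_aut G t \<theta>) (carrier ?P) (carrier ?P)"
  proof (rule bij_betw_byWitness[where f' = ?g])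
    show "\<forall>x\<in>carrier ?P. ?g (shift_aut G t \<theta> x) = x"
    proof
      fix x assume x: "x \<in> carrier ?P"
      have xt: "x t \<in> carrier G" using x t by (auto simp: PiE_iff)
      show "?g (shift_aut G t \<theta> x) = x"
      proof
        fix i
        show "?g (shift_aut G t \<theta> x) i = x i"
        proof (cases "i \<in> {1..t}")
          case True
          then show ?thesis
            using x t auto_inv_into(3)[OF \<theta> xt] by (auto simp: shift_aut_def)
        next
          case False
          then show ?thesis using x by (auto simp: PiE_iff extensional_def)
        qed
      qed
    qed
    have gcl: "?g y \<in> carrier ?P" if "y \<in> carrier ?P" for y
      using that t by (auto simp: PiE_iff)
    then show "?g ` carrier ?P \<subseteq> carrier ?P" by blast
    show "\<forall>y\<in>carrier ?P. shift_aut G t \<theta> (?g y) = y"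
    proof
      fix y assume y: "y \<in> carrier ?P"
      have y1: "y 1 \<in> carrier G" using y t by (auto simp: PiE_iff)
      have sh: "shift_aut G t \<theta> (?g y)
          = (\<lambda>i\<in>{1..t}. if i = 1 then \<theta> (?g y t) else ?g y (i - 1))"
        using gcl[OF y] unfolding shift_aut_def by (simp only: restrict_apply if_True)
      show "shift_aut G t \<theta> (?g y) = y"
      proof
        fix i
        show "shift_aut G t \<theta> (?g y) i = y i"
        proof (cases "i \<in> {1..t}")
          case True
          have "i - 1 \<noteq> t" "i - 1 + 1 = i" using True by auto
          then show ?thesis
            unfolding sh using True t auto_inv_into(2)[OF \<theta> y1] by auto
        next
          case False
          then show ?thesis unfolding sh using y by (auto simp: PiE_iff extensional_def)
        qed
      qed
    qed
    show "shift_aut G t \<theta> ` carrier ?P \<subseteq> carrier ?P" using cl by blast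
  qed
  moreover have "shift_aut G t \<theta> \<in> extensional (carrier ?P)"
    by (simp add: shift_aut_def)
  ultimately show ?thesis by (simp add: auto_def Bij_def)
qed

lemma Fix_shift_aut:
  assumes t: "t \<ge> 1"
  shows "Fix (power_group G t) (shift_aut G t \<theta>) = diag_Fix G t \<theta>"
proof (intro Set.set_eqI iffI)
  fix x assume "x \<in> Fix (power_group G t) (shift_aut G t \<theta>)"
  then have x: "x \<in> carrier (power_group G t)" and "shift_aut G t \<theta> x = x"
    by (auto simp: Fix_def)
  then have eq: "(\<lambda>i\<in>{1..t}. if i = 1 then \<theta> (x t) else x (i - 1)) = x"
    by (simp add: shift_aut_def)
  have step: "x i = x 1" if "i \<in> {1..t}" for i
    using that
  proof (induction i)
    case (Suc i)
    show ?case
    proof (cases "i = 0")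
      case False
      have "x (Suc i) = x i" using fun_cong[OF eq, of "Suc i"] Suc.prems False by auto
      then show ?thesis using Suc False by auto
    qed simp
  qed simp
  have "\<theta> (x t) = x 1" using fun_cong[OF eq, of 1] t by auto
  then have "x 1 \<in> Fix G \<theta>"
    using step[of t] t x by (auto simp: Fix_def PiE_iff)
  moreover have "x = (\<lambda>i\<in>{1..t}. x 1)"
  proof
    fix i show "x i = (\<lambda>i\<in>{1..t}. x 1) i"
      using x step[of i] by (cases "i \<in> {1..t}") (auto simp: PiE_iff extensional_def)
  qed
  ultimately show "x \<in> diag_Fix G t \<theta>" unfolding diag_Fix_def by blast
next
  fix x assume "x \<in> diag_Fix G t \<theta>"
  then obtain a where a: "a \<in> carrier G" "\<theta> a = a" and x: "x = (\<lambda>i\<in>{1..t}. a)"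
    by (auto simp: diag_Fix_def Fix_def)
  have xc: "x \<in> carrier (power_group G t)" using a x by auto
  moreover have "shift_aut G t \<theta> x = x"
  proof
    fix i show "shift_aut G t \<theta> x i = x i"
      using xc a t by (auto simp: shift_aut_def x)
  qed
  ultimately show "x \<in> Fix (power_group G t) (shift_aut G t \<theta>)" by (simp add: Fix_def)
qed

lemma (in group) subgroup_Fix:
  assumes "\<theta> \<in> auto G"
  shows "subgroup (Fix G \<theta>) G"
proof -
  interpret \<theta>: group_hom G G \<theta>
    using assms by unfold_locales (simp add: auto_def)
  show ?thesis
    by (rule subgroupI) (auto simp: Fix_def intro: one_closed)
qed

lemma quandle_power_quandle:
  assumes "group G" and "\<theta> \<in> auto G" and "t \<ge> 1"
  shows "quandle (power_quandle G t \<theta>)"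
proof -
  interpret P: group "power_group G t"
    using assms(1) by simp
  have "shift_aut G t \<theta> \<in> auto (power_group G t)"
    using shift_aut_auto assms by blast
  then show ?thesis
    unfolding power_quandle_def Fix_shift_aut[OF assms(3), symmetric]
    using P.quandle_coset_quandle P.subgroup_Fix by blast
qed

end

theory Submission
  imports Defs "HOL-Number_Theory.Cong"
begin

text \<open>The map sending the coset of \<open>g\<close> to \<open>g \<theta> g\<^sup>-\<^sup>1\<close> identifies the coset quandle of \<open>G\<close>, \<open>Fix \<theta>\<close>
  and \<open>\<theta>\<close> with the \<open>G\<close>-conjugates of \<open>\<theta>\<close> in the holomorph of \<open>G\<close>, under conjugation. In such
  a quandle two elements that act in the same way on a subquandle containing both of them commute,
  and two distinct commuting elements form a subquandle in which both act trivially. So the quandle is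
  superfaithful if and only if \<open>\<theta>\<close> commutes with none of its \<open>G\<close>-conjugates except itself. Such a
  \<open>\<theta>\<close> is called isolated below.

  For the quandle \<open>(G, t, \<theta>)\<close> the coordinates of an element of \<open>G\<^sup>t\<close> can be eliminated one after
  another, and isolation of the twisted shift becomes a statement about \<open>G\<close> alone: \<open>\<theta> y = y h\<^sup>t\<close>
  with \<open>h\<close> fixed by \<open>\<theta>\<close> forces \<open>h = 1\<close>. For finite \<open>G\<close> this splits into two conditions: \<open>\<theta>\<close> is
  isolated, and \<open>Fix \<theta>\<close> has no nontrivial element of order dividing \<open>t\<close>
  (\<open>power_condition_iff_isolated\<close>). For \<open>\<theta> = 1\<close> and \<open>G = A\<^sub>n\<close> the second one says that \<open>t\<close> is
  coprime to \<open>n!\<close>, by the theorem of Cauchy. What remains is that for \<open>n > 5\<close> no nontrivial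
  automorphism of \<open>A\<^sub>n\<close> is isolated (\<open>isolated_alt_group_eq_identity\<close>).

  If an automorphism maps three-cycles to three-cycles, then it is conjugation by a permutation \<open>\<sigma>\<close>
  (\<open>auto_preserving_three_cycles_is_conj\<close>), and a permutation \<open>\<sigma> \<noteq> 1\<close> of at least six points
  commutes with some \<open>y \<sigma> y\<^sup>-\<^sup>1 \<noteq> \<sigma>\<close> with \<open>y\<close> even (\<open>exists_moves_to_commuting\<close>): on a long orbit
  one replaces \<open>\<sigma>\<close> by a power of itself, and if all orbits have at most three points an explicit \<open>y\<close>
  works. For \<open>n \<ge> 7\<close> every automorphism preserves three-cycles, since among the elements of order
  three these are the ones whose products with their conjugates all satisfy \<open>w\<^sup>3\<^sup>0 = 1\<close>
  (\<open>auto_alt_group_three_cycles\<close>).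

  For \<open>n = 6\<close> there are automorphisms \<open>\<theta>\<close> that interchange the three-cycles with the products of two
  disjoint three-cycles, so that \<open>\<theta>\<close> fixes no element of order three. Then \<open>\<theta>\<^sup>2\<close> is conjugation by
  a permutation \<open>\<tau>\<close>, and \<open>\<rho> = \<tau>\<^sup>2\<close> is an element of \<open>A\<^sub>6\<close> that is fixed by \<open>\<theta>\<close> and for which \<open>\<theta>\<^sup>4\<close>
  is conjugation by \<open>\<rho>\<close>. The order of \<open>\<rho>\<close> is not divisible by three, so it is divisible by five or a
  power of two. Assume that \<open>\<theta>\<close> is isolated. Then fixed points spread: once the centralizer of a fixed
  element is fixed, so is every \<open>g\<close> that conjugates this element to a fixed one
  (\<open>isolated_fixes_of_conj_fixed\<close>). In the first case this makes \<open>\<rho>\<close> trivial, and in the second case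
  it produces a fixed three-cycle; both are impossible.\<close>

section \<open>Superfaithful coset quandles\<close>

text \<open>In the holomorph of \<open>G\<close>, the element \<open>y\<^sup>-\<^sup>1 \<theta> y\<close> equals \<open>y\<^sup>-\<^sup>1 \<theta>(y) \<theta>\<close>; it commutes with \<open>\<theta>\<close> if and
  only if \<open>y\<^sup>-\<^sup>1 \<theta>(y)\<close> is fixed by \<open>\<theta>\<close>, and it is \<open>\<theta>\<close> itself if and only if \<open>\<theta>(y) = y\<close>. So \<open>\<theta>\<close> is isolated
  when it commutes with no other \<open>G\<close>-conjugate of itself.\<close>
definition isolated :: "('a, 'b) monoid_scheme \<Rightarrow> ('a \<Rightarrow> 'a) \<Rightarrow> bool"
  where "isolated G \<theta> \<longleftrightarrow>
    (\<forall>y\<in>carrier G. inv\<^bsub>G\<^esub> y \<otimes>\<^bsub>G\<^esub> \<theta> y \<in> Fix G \<theta> \<longrightarrow> \<theta> y = y)"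

lemma auto_closed: "\<theta> \<in> auto G \<Longrightarrow> x \<in> carrier G \<Longrightarrow> \<theta> x \<in> carrier G"
  by (auto simp: auto_def hom_def)

text \<open>If \<open>A\<close> and \<open>B\<close> have the same left translation on a subquandle containing both, then \<open>A \<star> B = B \<star> B = B\<close>;
  written in representatives, this is the premise of isolation. Conversely \<open>y\<close> violating isolation gives
  the trivial subquandle consisting of the cosets of \<open>1\<close> and \<open>y\<close>.\<close>
lemma (in group) superfaithful_coset_quandle_iff:
  assumes \<theta>: "\<theta> \<in> auto G"
  shows "superfaithful (coset_quandle G (Fix G \<theta>) \<theta>) \<longleftrightarrow> isolated G \<theta>"
proof -
  let ?H = "Fix G \<theta>"
  let ?Q = "coset_quandle G ?H \<theta>"
  have H: "subgroup ?H G" using subgroup_Fix[OF \<theta>] .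
  interpret \<theta>: group_hom G G \<theta>
    using \<theta> by unfold_locales (simp add: auto_def)
  note mul = coset_quandle_qmult[OF H \<theta> order_refl]
  have coset_eq: "x <# ?H = y <# ?H \<longleftrightarrow> inv x \<otimes> y \<in> ?H" if "x \<in> carrier G" "y \<in> carrier G" for x y
  proof
    assume "x <# ?H = y <# ?H"
    then have "y \<in> x <# ?H" using lcos_self[OF _ H] that by simp
    then obtain h where "h \<in> ?H" "y = x \<otimes> h" by (auto simp: l_coset_def)
    moreover have "h \<in> carrier G" using \<open>h \<in> ?H\<close> by (simp add: Fix_def)
    ultimately show "inv x \<otimes> y \<in> ?H" using that by (simp add: m_assoc[symmetric])
  next
    assume h: "inv x \<otimes> y \<in> ?H"
    have "y = x \<otimes> (inv x \<otimes> y)" using that by (simp add: m_assoc[symmetric])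
    then have "y \<in> x <# ?H" using h unfolding l_coset_def by blast
    then show "x <# ?H = y <# ?H" using l_repr_independence[OF _ _ H] that by blast
  qed
  show ?thesis
  proof
    assume iso: "isolated G \<theta>"
    show "superfaithful ?Q"
      unfolding superfaithful_def faithful_def
    proof (intro allI impI ballI)
      fix S A B
      assume S: "subquandle S ?Q" and "A \<in> carrier (?Q\<lparr>carrier := S\<rparr>)" "B \<in> carrier (?Q\<lparr>carrier := S\<rparr>)"
        and eq: "ltrans (?Q\<lparr>carrier := S\<rparr>) A = ltrans (?Q\<lparr>carrier := S\<rparr>) B"
      then have AB: "A \<in> S" "B \<in> S" by auto
      then have "A \<in> carrier ?Q" "B \<in> carrier ?Q" using S by (auto simp: subquandle_def)
      then obtain x y where x: "x \<in> carrier G" "A = x <# ?H" and y: "y \<in> carrier G" "B = y <# ?H"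
        by (auto simp: coset_quandle_def LCOSETS_def)
      have "A \<star>\<^bsub>?Q\<^esub> B = B \<star>\<^bsub>?Q\<^esub> B"
        using fun_cong[OF eq, of B] AB by (simp add: ltrans_def)
      then have "(x \<otimes> \<theta> (inv x \<otimes> y)) <# ?H = y <# ?H"
        using x y mul by (simp del: \<theta>.hom_mult)
      then have "inv (x \<otimes> \<theta> (inv x \<otimes> y)) \<otimes> y \<in> ?H"
        using x y coset_eq by simp
      then have "inv (inv (x \<otimes> \<theta> (inv x \<otimes> y)) \<otimes> y) \<in> ?H"
        using subgroup.m_inv_closed[OF H] by blast
      moreover have "inv (inv (x \<otimes> \<theta> (inv x \<otimes> y)) \<otimes> y) = inv (inv x \<otimes> y) \<otimes> \<theta> (inv x \<otimes> y)"
        using x y by (simp add: inv_mult_group m_assoc)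
      ultimately have "\<theta> (inv x \<otimes> y) = inv x \<otimes> y"
        using iso[unfolded isolated_def, rule_format, of "inv x \<otimes> y"] x y
        by (simp del: \<theta>.hom_mult)
      then show "A = B" using coset_eq x y by (simp add: Fix_def)
    qed
  next
    assume sf: "superfaithful ?Q"
    show "isolated G \<theta>"
      unfolding isolated_def
    proof (intro ballI impI)
      fix y assume y: "y \<in> carrier G" and h: "inv y \<otimes> \<theta> y \<in> ?H"
      let ?h = "inv y \<otimes> \<theta> y"
      let ?A = "\<one> <# ?H" and ?B = "y <# ?H"
      interpret Q: quandle ?Q by (rule quandle_coset_quandle[OF H \<theta> order_refl])
      have AB: "?A \<in> carrier ?Q" "?B \<in> carrier ?Q"
        using y by (auto simp: coset_quandle_def LCOSETS_def)
      have 1: "?A \<star>\<^bsub>?Q\<^esub> ?B = ?B"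
        using mul[of \<one> y] y h coset_eq[of y "\<theta> y"] by simp
      define h where "h = inv y \<otimes> \<theta> y"
      have hc: "h \<in> carrier G" and h\<theta>: "\<theta> h = h" and \<theta>y: "\<theta> y = y \<otimes> h"
        using h y by (auto simp: Fix_def h_def m_assoc[symmetric])
      have "\<theta> (inv y) = inv h \<otimes> inv y" using y hc \<theta>y by (simp add: inv_mult_group)
      then have "\<theta> (\<theta> (inv y)) = \<theta> (inv h) \<otimes> \<theta> (inv y)"
        using y hc \<theta>.hom_mult[of "inv h" "inv y"] by (simp only: inv_closed)
      also have "\<theta> (inv h) = inv h" using \<theta>.hom_inv[OF hc] h\<theta> by (simp only:)
      finally have "\<theta> (\<theta> (inv y)) = inv h \<otimes> \<theta> (inv y)" .
      then have "\<theta> (y \<otimes> \<theta> (inv y)) = (y \<otimes> h) \<otimes> (inv h \<otimes> \<theta> (inv y))"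
        using \<theta>y \<theta>.hom_mult[OF y \<theta>.hom_closed[OF inv_closed[OF y]]] by (simp only:)
      also have "\<dots> = y \<otimes> \<theta> (inv y)"
      proof -
        have b: "\<theta> (inv y) \<in> carrier G" using y by simp
        have "h \<otimes> (inv h \<otimes> \<theta> (inv y)) = \<theta> (inv y)"
          using hc b by (simp add: m_assoc[symmetric] del: \<theta>.hom_inv)
        then show ?thesis using y hc b by (simp add: m_assoc del: \<theta>.hom_inv)
      qed
      finally have "y \<otimes> \<theta> (inv y) \<in> ?H" using y by (simp add: Fix_def)
      then have 2: "?B \<star>\<^bsub>?Q\<^esub> ?A = ?A"
        using mul[of y \<one>] y coset_eq[of \<one> "y \<otimes> \<theta> (inv y)"] by (simp del: \<theta>.hom_inv)
      have idm: "?A \<star>\<^bsub>?Q\<^esub> ?A = ?A" "?B \<star>\<^bsub>?Q\<^esub> ?B = ?B"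
        using Q.qmult_idem AB by auto
      have dv: "?A \<setminus>\<^bsub>?Q\<^esub> ?A = ?A" "?B \<setminus>\<^bsub>?Q\<^esub> ?B = ?B" "?A \<setminus>\<^bsub>?Q\<^esub> ?B = ?B" "?B \<setminus>\<^bsub>?Q\<^esub> ?A = ?A"
        using Q.qldiv_qmult[OF AB(1) AB(1)] Q.qldiv_qmult[OF AB(2) AB(2)]
          Q.qldiv_qmult[OF AB(1) AB(2)] Q.qldiv_qmult[OF AB(2) AB(1)] idm 1 2 by simp_all
      have "subquandle {?A, ?B} ?Q"
        unfolding subquandle_def using AB 1 2 idm dv by auto
      then have "faithful (?Q\<lparr>carrier := {?A, ?B}\<rparr>)" using sf unfolding superfaithful_def by blast
      moreover have "ltrans (?Q\<lparr>carrier := {?A, ?B}\<rparr>) ?A = ltrans (?Q\<lparr>carrier := {?A, ?B}\<rparr>) ?B"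
        unfolding ltrans_def
      proof (rule restrict_ext)
        fix C assume "C \<in> carrier (?Q\<lparr>carrier := {?A, ?B}\<rparr>)"
        then have "C = ?A \<or> C = ?B" by simp
        then show "?A \<star>\<^bsub>?Q\<lparr>carrier := {?A, ?B}\<rparr>\<^esub> C = ?B \<star>\<^bsub>?Q\<lparr>carrier := {?A, ?B}\<rparr>\<^esub> C"
          using 1 2 idm by (elim disjE) simp_all
      qed
      moreover have "?A \<in> carrier (?Q\<lparr>carrier := {?A, ?B}\<rparr>)" "?B \<in> carrier (?Q\<lparr>carrier := {?A, ?B}\<rparr>)"
        by simp_all
      ultimately have "?A = ?B" unfolding faithful_def by blast
      then have "y \<in> ?H" using coset_eq[of \<one> y] y by simp
      then show "\<theta> y = y" by (simp add: Fix_def)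
    qed
  qed
qed

text \<open>The condition that \<open>Y\<^sup>-\<^sup>1 \<theta>\<^sub>t(Y)\<close> is the constant tuple \<open>h\<close> reads \<open>Y\<^sub>i\<^sub>-\<^sub>1 = Y\<^sub>i h\<close> for \<open>i > 1\<close> and
  \<open>\<theta>(Y\<^sub>t) = Y\<^sub>1 h\<close>. Its solutions are \<open>Y\<^sub>i = y h\<^sup>t\<^sup>-\<^sup>i\<close> with \<open>\<theta>(y) = y h\<^sup>t\<close>, and \<open>Y\<close> is fixed if and only if \<open>h = 1\<close>.\<close>
lemma isolated_shift_aut_iff:
  fixes G (structure)
  assumes "group G" and \<theta>: "\<theta> \<in> auto G" and t: "t \<ge> 1"
  shows "isolated (power_group G t) (shift_aut G t \<theta>) \<longleftrightarrow>
    (\<forall>y\<in>carrier G. \<forall>h\<in>Fix G \<theta>. \<theta> y = y \<otimes>\<^bsub>G\<^esub> h [^]\<^bsub>G\<^esub> t \<longrightarrow> h = \<one>\<^bsub>G\<^esub>)"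
proof -
  interpret group G by fact
  let ?P = "power_group G t" and ?s = "shift_aut G t \<theta>"
  interpret P: group ?P by simp
  have sc: "?s Y \<in> carrier ?P" if "Y \<in> carrier ?P" for Y
    using auto_closed[OF shift_aut_auto[OF assms]] that .
  have s_nth: "?s Y i = (if i = 1 then \<theta> (Y t) else Y (i - 1))"
    if "Y \<in> carrier ?P" "i \<in> {1..t}" for Y i
    using that by (simp add: shift_aut_def)
  have Yc: "Y i \<in> carrier G" if "Y \<in> carrier ?P" "i \<in> {1..t}" for Y i
    using that by (auto simp: PiE_iff)
  have diff_nth: "(inv\<^bsub>?P\<^esub> Y \<otimes>\<^bsub>?P\<^esub> ?s Y) i = inv (Y i) \<otimes> ?s Y i"
    if "Y \<in> carrier ?P" "i \<in> {1..t}" for Y i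
    using that inv_product_group[of Y "{1..t}" "\<lambda>_. G"] by (simp add: is_group)
  show ?thesis
  proof
    assume iso: "isolated ?P ?s"
    show "\<forall>y\<in>carrier G. \<forall>h\<in>Fix G \<theta>. \<theta> y = y \<otimes> h [^] t \<longrightarrow> h = \<one>"
    proof (intro ballI impI)
      fix y h assume y: "y \<in> carrier G" and h: "h \<in> Fix G \<theta>" and eq: "\<theta> y = y \<otimes> h [^] t"
      have hc: "h \<in> carrier G" using h by (simp add: Fix_def)
      define Y where "Y = (\<lambda>i\<in>{1..t}. y \<otimes> h [^] (t - i))"
      have Y: "Y \<in> carrier ?P" using y hc by (auto simp: Y_def)
      have sY: "?s Y i = Y i \<otimes> h" if i: "i \<in> {1..t}" for i
      proof (cases "i = 1")
        case True
        have "h [^] t = h [^] (t - 1) \<otimes> h" using t hc by (metis Suc_diff_1 less_eq_Suc_le One_nat_def nat_pow_Suc)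
        then show ?thesis using True Y t y hc eq s_nth[OF Y i] by (simp add: Y_def m_assoc)
      next
        case False
        then have "h [^] (t - (i - 1)) = h [^] (t - i) \<otimes> h"
          using i hc by (metis Suc_diff_le atLeastAtMost_iff diff_Suc_Suc Suc_diff_1 less_eq_Suc_le One_nat_def nat_pow_Suc)
        moreover have "i - 1 \<in> {1..t}" using i False by auto
        ultimately show ?thesis using False i s_nth[OF Y i] y hc by (simp add: Y_def m_assoc)
      qed
      have "inv\<^bsub>?P\<^esub> Y \<otimes>\<^bsub>?P\<^esub> ?s Y = (\<lambda>i\<in>{1..t}. h)"
      proof (rule extensionalityI[of _ "{1..t}"])
        fix i assume i: "i \<in> {1..t}"
        show "(inv\<^bsub>?P\<^esub> Y \<otimes>\<^bsub>?P\<^esub> ?s Y) i = (\<lambda>i\<in>{1..t}. h) i"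
          using diff_nth[OF Y i] sY[OF i] Yc[OF Y i] i hc by (simp add: m_assoc[symmetric])
      qed auto
      then have "inv\<^bsub>?P\<^esub> Y \<otimes>\<^bsub>?P\<^esub> ?s Y \<in> Fix ?P ?s"
        unfolding Fix_shift_aut[OF t] diag_Fix_def using h by auto
      then have "?s Y = Y" using iso Y unfolding isolated_def by blast
      moreover have "t \<in> {1..t}" using t by simp
      ultimately have "Y t = Y t \<otimes> h" "Y t \<in> carrier G" using sY Yc[OF Y] by auto
      then show "h = \<one>" using hc by simp
    qed
  next
    assume R: "\<forall>y\<in>carrier G. \<forall>h\<in>Fix G \<theta>. \<theta> y = y \<otimes> h [^] t \<longrightarrow> h = \<one>"
    show "isolated ?P ?s"
      unfolding isolated_def
    proof (intro ballI impI)
      fix Y assume Y: "Y \<in> carrier ?P" and "inv\<^bsub>?P\<^esub> Y \<otimes>\<^bsub>?P\<^esub> ?s Y \<in> Fix ?P ?s"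
      then obtain h where h: "h \<in> Fix G \<theta>" and d: "inv\<^bsub>?P\<^esub> Y \<otimes>\<^bsub>?P\<^esub> ?s Y = (\<lambda>i\<in>{1..t}. h)"
        unfolding Fix_shift_aut[OF t] diag_Fix_def by blast
      have hc: "h \<in> carrier G" using h by (simp add: Fix_def)
      have sY: "?s Y i = Y i \<otimes> h" if i: "i \<in> {1..t}" for i
      proof -
        have "inv (Y i) \<otimes> ?s Y i = h"
          using diff_nth[OF Y i] fun_cong[OF d, of i] i by (simp only: restrict_apply if_True)
        moreover have "?s Y i \<in> carrier G" using Yc[OF sc[OF Y] i] .
        ultimately show ?thesis using inv_solve_left[of h "Y i" "?s Y i"] Yc[OF Y i] hc by blast
      qed
      have tt: "t \<in> {1..t}" "1 \<in> {1..t}" using t by auto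
      have down: "Y (t - k) = Y t \<otimes> h [^] k" if "k < t" for k
        using that
      proof (induction k)
        case 0 then show ?case using Yc[OF Y tt(1)] by simp
      next
        case (Suc k)
        have i: "t - k \<in> {1..t}" and "t - k \<noteq> 1" using Suc.prems by auto
        then have "Y (t - Suc k) = Y (t - k) \<otimes> h" using sY[OF i] s_nth[OF Y i] by simp
        then show ?case using Suc Yc[OF Y tt(1)] hc by (simp add: m_assoc)
      qed
      have "\<theta> (Y t) = Y 1 \<otimes> h" using sY[OF tt(2)] s_nth[OF Y tt(2)] by simp
      also have "Y 1 = Y t \<otimes> h [^] (t - 1)" using down[of "t - 1"] t by simp
      also have "Y t \<otimes> h [^] (t - 1) \<otimes> h = Y t \<otimes> h [^] t"
        using Yc[OF Y tt(1)] hc t by (metis Suc_diff_1 less_eq_Suc_le One_nat_def nat_pow_Suc nat_pow_closed m_assoc)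
      finally have "h = \<one>" using R h Yc[OF Y tt(1)] by blast
      then have "?s Y i = Y i" if "i \<in> {1..t}" for i
        using sY[OF that] Yc[OF Y that] by simp
      moreover have "?s Y \<in> extensional {1..t}" "Y \<in> extensional {1..t}"
        using sc[OF Y] Y by (simp_all add: PiE_iff del: restrict_apply)
      ultimately show "?s Y = Y" by (meson extensionalityI)
    qed
  qed
qed

lemma superfaithful_power_quandle_iff:
  assumes "group G" and \<theta>: "\<theta> \<in> auto G" and t: "t \<ge> 1"
  shows "superfaithful (power_quandle G t \<theta>) \<longleftrightarrow>
    (\<forall>y\<in>carrier G. \<forall>h\<in>Fix G \<theta>. \<theta> y = y \<otimes>\<^bsub>G\<^esub> h [^]\<^bsub>G\<^esub> t \<longrightarrow> h = \<one>\<^bsub>G\<^esub>)"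
proof -
  interpret P: group "power_group G t" using assms(1) by simp
  show ?thesis
    unfolding power_quandle_def Fix_shift_aut[OF t, symmetric]
    using P.superfaithful_coset_quandle_iff[OF shift_aut_auto[OF assms]]
      isolated_shift_aut_iff[OF assms] by simp
qed

section \<open>Isolated automorphisms of finite groups\<close>

lemma (in group) subgroup_nat_pow_closed:
  "subgroup H G \<Longrightarrow> h \<in> H \<Longrightarrow> h [^] (m::nat) \<in> H"
  by (induction m) (auto simp: subgroup.one_closed subgroup.m_closed)

lemma (in group) pow_eq_iff_cong:
  assumes "x \<in> carrier G"
  shows "x [^] (m::nat) = x [^] n \<longleftrightarrow> [m = n] (mod ord x)"
proof -
  have "x [^] (m::nat) = x [^] n \<longleftrightarrow> [m = n] (mod ord x)" if "m \<le> n" for m n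
  proof -
    have "x [^] n = x [^] m \<otimes> x [^] (n - m)" using that assms by (simp add: nat_pow_mult)
    then have "x [^] m = x [^] n \<longleftrightarrow> x [^] (n - m) = \<one>"
      using assms by (metis l_cancel_one' nat_pow_closed)
    then show ?thesis using that assms cong_altdef_nat[of m n "ord x"] by (simp add: pow_eq_id cong_sym_eq)
  qed
  then show ?thesis by (metis cong_sym_eq nat_le_linear)
qed

text \<open>If no nontrivial fixed element has order dividing \<open>t\<close>, then \<open>t\<close> is coprime to the order of every fixed
  element \<open>k\<close>, so that \<open>k\<close> is itself a \<open>t\<close>-th power of a fixed element.\<close>
lemma (in group) power_condition_iff_isolated:
  assumes fin: "finite (carrier G)" and \<theta>: "\<theta> \<in> auto G"
  shows "(\<forall>y\<in>carrier G. \<forall>h\<in>Fix G \<theta>. \<theta> y = y \<otimes> h [^] (t::nat) \<longrightarrow> h = \<one>) \<longleftrightarrow>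
    isolated G \<theta> \<and> (\<forall>h\<in>Fix G \<theta>. h [^] t = \<one> \<longrightarrow> h = \<one>)" (is "?C \<longleftrightarrow> _ \<and> ?T")
proof (intro iffI conjI)
  assume C: ?C
  show T: ?T
  proof (intro ballI impI)
    fix h assume "h \<in> Fix G \<theta>" "h [^] t = \<one>"
    moreover have "\<theta> \<one> = \<one>"
      using hom_one[OF _ is_group is_group, of \<theta>] \<theta> by (simp add: auto_def)
    ultimately show "h = \<one>" using C[rule_format, of \<one> h] by simp
  qed
  show "isolated G \<theta>"
    unfolding isolated_def
  proof (intro ballI impI)
    fix y assume y: "y \<in> carrier G" and "inv y \<otimes> \<theta> y \<in> Fix G \<theta>"
    moreover define k where "k = inv y \<otimes> \<theta> y"
    ultimately have k: "k \<in> Fix G \<theta>" and kc: "k \<in> carrier G" by (auto simp: Fix_def)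
    have \<theta>y: "\<theta> y = y \<otimes> k" using y auto_closed[OF \<theta> y] by (simp add: k_def m_assoc[symmetric])
    have pow: "k [^] m \<in> Fix G \<theta>" for m :: nat
      using subgroup_nat_pow_closed[OF subgroup_Fix[OF \<theta>] k] by simp
    have o0: "ord k > 0" using ord_ge_1[OF fin kc] by simp
    have "coprime (ord k) t"
    proof -
      define g where "g = gcd (ord k) t"
      have g: "g dvd ord k" "g dvd t" by (auto simp: g_def)
      have "ord k dvd (ord k div g) * t"
        using g by (metis dvd_def dvd_div_mult_self mult.assoc)
      then have "(k [^] (ord k div g)) [^] t = \<one>"
        using kc by (simp add: nat_pow_pow pow_eq_id)
      then have "k [^] (ord k div g) = \<one>" using T pow by blast
      then have "ord k dvd ord k div g" using kc by (simp add: pow_eq_id)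
      then have "ord k \<le> ord k div g"
        using g(1) o0 by (metis dvd_div_eq_0_iff dvd_imp_le neq0_conv)
      then have "g = 1" using o0 g(1)
        by (metis dvd_pos_nat div_less_dividend leD less_one nat_neq_iff)
      then show ?thesis by (simp add: g_def coprime_iff_gcd_eq_1)
    qed
    then obtain m where m: "[t * m = 1] (mod ord k)"
      using cong_solve_coprime_nat[of t "ord k"] by (auto simp: coprime_commute)
    have "(k [^] m) [^] t = k"
      using m kc pow_eq_iff_cong[OF kc, of "m * t" 1] by (simp add: nat_pow_pow mult.commute)
    then have "\<theta> y = y \<otimes> (k [^] m) [^] t" using \<theta>y kc by simp
    then have "k [^] m = \<one>" using C y pow by blast
    then have "k = \<one>" using \<open>(k [^] m) [^] t = _\<close> kc by simp
    then show "\<theta> y = y" using \<theta>y y by simp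
  qed
next
  assume *: "isolated G \<theta> \<and> ?T"
  show ?C
  proof (intro ballI impI)
    fix y h assume y: "y \<in> carrier G" and h: "h \<in> Fix G \<theta>" and eq: "\<theta> y = y \<otimes> h [^] t"
    have hc: "h \<in> carrier G" using h by (simp add: Fix_def)
    have "inv y \<otimes> \<theta> y = h [^] t" using eq y hc by (simp add: m_assoc[symmetric])
    moreover have "h [^] t \<in> Fix G \<theta>"
      using subgroup_nat_pow_closed[OF subgroup_Fix[OF \<theta>] h] by simp
    ultimately have "\<theta> y = y" using * y unfolding isolated_def by metis
    then have "h [^] t = \<one>" using eq y hc by simp
    then show "h = \<one>" using * h by blast
  qed
qed

text \<open>Cauchy's theorem: a nontrivial element of a Sylow subgroup has order \<open>p\<^sup>j\<close> with \<open>j > 0\<close>, and its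
  \<open>p\<^sup>j\<^sup>-\<^sup>1\<close>-th power has order \<open>p\<close>.\<close>
lemma (in group) cauchy_prime_order:
  assumes fin: "finite (carrier G)" and p: "Factorial_Ring.prime (p::nat)" and dvd: "p dvd order G"
  obtains x where "x \<in> carrier G" "x \<noteq> \<one>" "x [^] p = \<one>"
proof -
  have o: "order G \<noteq> 0" using fin by (simp add: order_gt_0_iff_finite)
  define a where "a = multiplicity p (order G)"
  have a: "a \<ge> 1" using dvd o prime_multiplicity_gt_zero_iff[of p "order G"] p
    by (simp add: a_def Suc_le_eq)
  obtain m where "order G = p ^ a * m" using multiplicity_dvd[of p "order G"] by (auto simp: a_def)
  then obtain H where H: "subgroup H G" "card H = p ^ a"
    using sylow_thm[OF p is_group _ fin] by blast
  have "1 < card H" using H(2) a prime_gt_1_nat[OF p] one_less_power[of p a] by simp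
  then have "\<not> H \<subseteq> {\<one>}" using card_mono[of "{\<one>}" H] by auto
  then obtain x where x: "x \<in> H" "x \<noteq> \<one>" by blast
  interpret H: group "G\<lparr>carrier := H\<rparr>" by (rule subgroup_imp_group[OF H(1)])
  have xc: "x \<in> carrier G" using subgroup.mem_carrier[OF H(1) x(1)] .
  have "x [^]\<^bsub>G\<lparr>carrier := H\<rparr>\<^esub> order (G\<lparr>carrier := H\<rparr>) = \<one>"
    using H.pow_order_eq_1[of x] x by simp
  then have "x [^] (p ^ a) = \<one>" using H(2) by (simp add: order_def nat_pow_consistent[symmetric])
  then have "ord x dvd p ^ a" using xc by (simp add: pow_eq_id)
  then obtain j where j: "ord x = p ^ j" using divides_primepow_nat[OF p] by blast
  have "j \<noteq> 0" using j x xc ord_eq_1[OF xc] by auto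
  then have e: "ord x = p ^ (j - 1) * p" using j by (cases j) auto
  have "x [^] (p ^ (j - 1)) \<noteq> \<one>"
  proof
    assume "x [^] (p ^ (j - 1)) = \<one>"
    then have "p ^ j dvd p ^ (j - 1)" using xc j by (simp add: pow_eq_id)
    then show False using \<open>j \<noteq> 0\<close> prime_gt_1_nat[OF p] power_dvd_imp_le by fastforce
  qed
  moreover have "(x [^] (p ^ (j - 1))) [^] p = \<one>"
    using xc e by (simp add: nat_pow_pow pow_eq_id)
  ultimately show thesis using that xc by blast
qed

lemma card_involution_cong_fixpoints:
  assumes "finite S" and "\<And>x. x \<in> S \<Longrightarrow> g x \<in> S" and "\<And>x. x \<in> S \<Longrightarrow> g (g x) = x"
  shows "even (card S) \<longleftrightarrow> even (card {x \<in> S. g x = x})"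
  using assms
proof (induction "card S" arbitrary: S rule: less_induct)
  case less
  show ?case
  proof (cases "\<exists>x\<in>S. g x \<noteq> x")
    case False
    then have "{x \<in> S. g x = x} = S" by auto
    then show ?thesis by simp
  next
    case True
    then obtain x where x: "x \<in> S" "g x \<noteq> x" by blast
    let ?Y = "S - {x, g x}"
    have "card S = card ?Y + 2"
      using x less.prems(2)[of x] card_Un_disjoint[of ?Y "{x, g x}"] less.prems(1)
      by (simp add: Un_absorb2 insert_absorb Un_commute)
    moreover have "g y \<in> ?Y" if "y \<in> ?Y" for y
      using less.prems(2,3) x that by (metis Diff_iff insert_iff empty_iff)
    moreover have "{y \<in> ?Y. g y = y} = {y \<in> S. g y = y}" using x less.prems by auto
    ultimately show ?thesis
      using less.hyps[of ?Y] less.prems by simp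
  qed
qed

text \<open>The map \<open>f^(2^j)\<close> is an involution on the fixed points of \<open>f^(2^(j+1))\<close>, so passing from \<open>j + 1\<close> to \<open>j\<close>
  does not change the parity of the number of fixed points.\<close>
lemma card_cong_fixpoints_of_2_power_order:
  assumes "finite S" and "\<And>x. x \<in> S \<Longrightarrow> f x \<in> S"
    and "\<And>x. x \<in> S \<Longrightarrow> (f ^^ (2 ^ k)) x = x"
  shows "even (card S) \<longleftrightarrow> even (card {x \<in> S. f x = x})"
  using assms
proof (induction k arbitrary: S)
  case 0
  then have "{x \<in> S. f x = x} = S" by auto
  then show ?case by simp
next
  case (Suc k)
  let ?g = "f ^^ (2 ^ k)"
  have cl: "(f ^^ n) x \<in> S" if "x \<in> S" for x n
    using that Suc.prems(2) by (induction n) auto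
  have fixed: "(f ^^ n) x = x" if "f x = x" for x n
    using that by (induction n) auto
  have "?g (?g x) = x" if "x \<in> S" for x
    using Suc.prems(3)[OF that] by (simp add: funpow_add mult_2)
  then have "even (card S) \<longleftrightarrow> even (card {x \<in> S. ?g x = x})"
    using card_involution_cong_fixpoints[OF Suc.prems(1), of ?g] cl by blast
  also have "\<dots> \<longleftrightarrow> even (card {x \<in> {x \<in> S. ?g x = x}. f x = x})"
    using Suc.prems(1,2) by (intro Suc.IH) (auto simp: funpow_swap1[symmetric])
  also have "{x \<in> {x \<in> S. ?g x = x}. f x = x} = {x \<in> S. f x = x}"
    using fixed by auto
  finally show ?case .
qed

text \<open>The elements \<open>y\<^sup>-\<^sup>1 \<theta>(y)\<close> correspond to the cosets of \<open>Fix \<theta>\<close>, and \<open>\<theta>\<close> permutes them. Isolation says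
  that \<open>1\<close> is the only fixed point of this action; since \<open>\<theta>\<close> acts as an element of \<open>2\<close>-power order, the
  number of cosets is odd.\<close>
lemma (in group) isolated_2_power_index_odd:
  assumes fin: "finite (carrier G)" and \<theta>: "\<theta> \<in> hom G G" and iso: "isolated G \<theta>"
    and ord: "\<And>x. x \<in> carrier G \<Longrightarrow> (\<theta> ^^ (2 ^ k)) x = x"
  obtains m where "odd m" "order G = m * card (Fix G \<theta>)"
proof -
  interpret \<theta>: group_hom G G \<theta> using \<theta> by unfold_locales
  define d where "d y = inv y \<otimes> \<theta> y" for y
  let ?C = "d ` carrier G" and ?F = "Fix G \<theta>"
  have F: "?F \<subseteq> carrier G" by (auto simp: Fix_def)
  have \<theta>d: "\<theta> (d y) = d (\<theta> y)" if "y \<in> carrier G" for y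
    using that by (simp add: d_def)
  have "{c \<in> ?C. \<theta> c = c} = {\<one>}"
  proof -
    have "d y = \<one>" if "y \<in> carrier G" "\<theta> (d y) = d y" for y
    proof -
      have "d y \<in> ?F" using that by (simp add: Fix_def d_def del: \<theta>.hom_mult)
      then have "\<theta> y = y" using iso that(1) unfolding isolated_def d_def by blast
      then show ?thesis using that(1) by (simp add: d_def)
    qed
    moreover have "d \<one> = \<one>" by (simp add: d_def)
    ultimately show ?thesis by (force intro: rev_image_eqI[of \<one>])
  qed
  then have "odd (card {c \<in> ?C. \<theta> c = c})" by simp
  moreover have "even (card ?C) \<longleftrightarrow> even (card {c \<in> ?C. \<theta> c = c})"
  proof (rule card_cong_fixpoints_of_2_power_order)
    show "finite ?C" using fin by simp
    fix c assume "c \<in> ?C"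
    then obtain y where y: "y \<in> carrier G" "c = d y" by blast
    then show "\<theta> c \<in> ?C" using \<theta>d by auto
    show "(\<theta> ^^ 2 ^ k) c = c" using ord[of c] y by (simp add: d_def)
  qed
  ultimately have "odd (card ?C)" by simp
  moreover have "order G = card ?C * card ?F"
  proof -
    have fib: "card {x \<in> carrier G. d x = c} = card ?F" if "c \<in> ?C" for c
    proof -
      from that obtain y where y: "y \<in> carrier G" "c = d y" by blast
      have "d x = d y \<longleftrightarrow> \<theta> (x \<otimes> inv y) = x \<otimes> inv y" if x: "x \<in> carrier G" for x
      proof -
        have c: "\<theta> x \<in> carrier G" "\<theta> y \<in> carrier G" "d y \<in> carrier G"
          using x y by (simp_all add: d_def)
        have 1: "d y = d x \<longleftrightarrow> \<theta> x = x \<otimes> d y"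
          unfolding d_def[of x] by (rule inv_solve_left[OF c(3) x c(1)])
        have 2: "x \<otimes> d y = (x \<otimes> inv y) \<otimes> \<theta> y"
          using x y c by (simp add: d_def m_assoc)
        have 3: "x \<otimes> inv y = \<theta> x \<otimes> inv (\<theta> y) \<longleftrightarrow> \<theta> x = (x \<otimes> inv y) \<otimes> \<theta> y"
          by (rule inv_solve_right) (use x y c in auto)
        have 4: "\<theta> (x \<otimes> inv y) = \<theta> x \<otimes> inv (\<theta> y)" using x y by simp
        show ?thesis using 1 2 3 4 by metis
      qed
      then have *: "d x = c \<longleftrightarrow> x \<otimes> inv y \<in> ?F" if "x \<in> carrier G" for x
        using that y by (simp add: Fix_def)
      have "{x \<in> carrier G. d x = c} = (\<lambda>f. f \<otimes> y) ` ?F"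
      proof (intro equalityI subsetI)
        fix x assume x: "x \<in> {x \<in> carrier G. d x = c}"
        then have "x = (x \<otimes> inv y) \<otimes> y" using y by (simp add: m_assoc)
        then show "x \<in> (\<lambda>f. f \<otimes> y) ` ?F" using * x by blast
      next
        fix x assume "x \<in> (\<lambda>f. f \<otimes> y) ` ?F"
        then obtain f where f: "f \<in> ?F" "x = f \<otimes> y" by blast
        moreover from f F y have "x \<otimes> inv y = f" by (auto simp: m_assoc)
        ultimately show "x \<in> {x \<in> carrier G. d x = c}" using * F y by auto
      qed
      moreover have "inj_on (\<lambda>f. f \<otimes> y) ?F" using y F by (meson inj_onI r_cancel subsetD)
      ultimately show ?thesis by (simp add: card_image)
    qed
    have "order G = (\<Sum>x\<in>carrier G. 1)" by (simp add: order_def)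
    also have "\<dots> = (\<Sum>c\<in>?C. \<Sum>x | x \<in> carrier G \<and> d x = c. 1)"
      using fin by (rule sum.image_gen)
    also have "\<dots> = card ?C * card ?F" using fib by simp
    finally show ?thesis .
  qed
  ultimately show thesis using that by blast
qed

text \<open>Applying \<open>\<theta>\<close> to the fixed element \<open>g z g\<^sup>-\<^sup>1\<close> shows that \<open>g\<^sup>-\<^sup>1 \<theta>(g)\<close> centralizes \<open>z\<close>. It is therefore
  fixed, which is what isolation needs.\<close>
lemma (in group) isolated_fixes_of_conj_fixed:
  assumes \<theta>: "\<theta> \<in> auto G" and iso: "isolated G \<theta>" and z: "z \<in> Fix G \<theta>"
    and cent: "\<And>y. y \<in> carrier G \<Longrightarrow> y \<otimes> z = z \<otimes> y \<Longrightarrow> \<theta> y = y"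
    and g: "g \<in> carrier G" and conj: "g \<otimes> z \<otimes> inv g \<in> Fix G \<theta>"
  shows "\<theta> g = g"
proof -
  interpret \<theta>: group_hom G G \<theta> using \<theta> by unfold_locales (simp add: auto_def)
  have zc: "z \<in> carrier G" "\<theta> z = z" using z by (auto simp: Fix_def)
  define h where "h = \<theta> g"
  have h: "h \<in> carrier G" using g by (simp add: h_def)
  have "\<theta> (g \<otimes> z \<otimes> inv g) = h \<otimes> z \<otimes> inv h" using g zc by (simp add: h_def)
  then have eq: "h \<otimes> z \<otimes> inv h = g \<otimes> z \<otimes> inv g" using conj by (simp add: Fix_def)
  have "inv g \<otimes> h \<otimes> z = inv g \<otimes> (h \<otimes> z \<otimes> inv h) \<otimes> h"
    using g h zc by (simp add: m_assoc)
  also have "\<dots> = inv g \<otimes> (g \<otimes> z \<otimes> inv g) \<otimes> h" using eq by simp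
  also have "\<dots> = (inv g \<otimes> g) \<otimes> (z \<otimes> (inv g \<otimes> h))" using g h zc by (simp only: m_assoc inv_closed m_closed)
  also have "\<dots> = z \<otimes> (inv g \<otimes> h)" using g h zc by simp
  finally have "\<theta> (inv g \<otimes> h) = inv g \<otimes> h" using cent g h by simp
  then have "inv g \<otimes> \<theta> g \<in> Fix G \<theta>" using g h by (simp add: Fix_def h_def)
  then show ?thesis using iso g unfolding isolated_def by blast
qed

lemma (in group) subgroup_centralizer:
  assumes z: "z \<in> carrier G"
  shows "subgroup {y \<in> carrier G. y \<otimes> z = z \<otimes> y} G"
proof (rule subgroupI)
  fix y assume "y \<in> {y \<in> carrier G. y \<otimes> z = z \<otimes> y}"
  then have y: "y \<in> carrier G" "y \<otimes> z = z \<otimes> y" by auto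
  have "inv y \<otimes> z = inv y \<otimes> (z \<otimes> y) \<otimes> inv y" using y(1) z by (simp add: m_assoc)
  also have "\<dots> = inv y \<otimes> (y \<otimes> z) \<otimes> inv y" unfolding y(2) ..
  also have "\<dots> = (inv y \<otimes> y) \<otimes> (z \<otimes> inv y)" using y(1) z by (simp only: m_assoc inv_closed m_closed)
  also have "\<dots> = z \<otimes> inv y" using y(1) z by simp
  finally show "inv y \<in> {y \<in> carrier G. y \<otimes> z = z \<otimes> y}" using y by simp
next
  fix x y assume "x \<in> {y \<in> carrier G. y \<otimes> z = z \<otimes> y}" "y \<in> {y \<in> carrier G. y \<otimes> z = z \<otimes> y}"
  then have xy: "x \<in> carrier G" "y \<in> carrier G" "x \<otimes> z = z \<otimes> x" "y \<otimes> z = z \<otimes> y" by auto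
  have "x \<otimes> y \<otimes> z = x \<otimes> (y \<otimes> z)" using xy z by (simp add: m_assoc)
  also have "\<dots> = (x \<otimes> z) \<otimes> y" using xy(1,2) z unfolding xy(4) by (simp add: m_assoc)
  also have "\<dots> = z \<otimes> (x \<otimes> y)" using xy(1,2) z unfolding xy(3) by (simp add: m_assoc)
  finally show "x \<otimes> y \<in> {y \<in> carrier G. y \<otimes> z = z \<otimes> y}" using xy by simp
qed (use z in \<open>auto intro: exI[of _ z]\<close>)

lemma (in group) compose_auto:
  assumes "\<theta> \<in> auto G"
  shows "compose (carrier G) \<theta> \<theta> \<in> auto G"
proof -
  have "\<theta> \<in> Bij (carrier G)" using assms by (simp add: auto_def)
  then show ?thesis
    using subgroup.m_closed[OF subgroup_auto assms assms] by (simp add: BijGroup_def)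
qed

section \<open>Permutations that commute with an even conjugate\<close>

lemma evenperm_cycle_of_list:
  assumes "cycle cs" "cs \<noteq> []"
  shows "evenperm (cycle_of_list cs) \<longleftrightarrow> odd (length cs)"
proof -
  have "swapidseq (length cs - 1) (cycle_of_list cs)"
    using swapidseq_ext_imp_swapidseq swapidseq_ext_of_cycles assms(1) by blast
  then have "evenperm (cycle_of_list cs) \<longleftrightarrow> even (length cs - 1)"
    using evenperm_unique by blast
  then show ?thesis using assms(2) by (cases cs) auto
qed

text \<open>Here \<open>\<tau>\<close> is the conjugate \<open>y \<sigma> y\<^sup>-\<^sup>1\<close>; the equation \<open>y \<sigma> = \<tau> y\<close> avoids the inverse, which makes it
  easy to verify point by point.\<close>
definition moves_to_commuting :: "('a \<Rightarrow> 'a) \<Rightarrow> ('a \<Rightarrow> 'a) \<Rightarrow> bool"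
  where "moves_to_commuting y \<sigma> \<longleftrightarrow> (\<exists>\<tau>. y \<circ> \<sigma> = \<tau> \<circ> y \<and> \<tau> \<noteq> \<sigma> \<and> \<tau> \<circ> \<sigma> = \<sigma> \<circ> \<tau>)"

lemma funpow_eq_iff_cong:
  assumes "permutation \<sigma>"
  shows "(\<sigma> ^^ i) a = (\<sigma> ^^ j) a \<longleftrightarrow> [i = j] (mod least_power \<sigma> a)"
proof -
  have inj: "inj \<sigma>" using assms by (simp add: permutation bij_is_inj)
  have "(\<sigma> ^^ i) a = (\<sigma> ^^ j) a \<longleftrightarrow> [i = j] (mod least_power \<sigma> a)" if "i \<le> j" for i j
  proof -
    have "(\<sigma> ^^ j) a = (\<sigma> ^^ i) ((\<sigma> ^^ (j - i)) a)"
      using that by (metis funpow_add le_add_diff_inverse o_apply)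
    then have "(\<sigma> ^^ i) a = (\<sigma> ^^ j) a \<longleftrightarrow> (\<sigma> ^^ (j - i)) a = a"
      using inj_eq[OF inj_fn[OF inj]] by metis
    then show ?thesis
      using that least_power_dvd[OF assms] cong_altdef_nat[of i j] by (metis cong_sym_eq)
  qed
  then show ?thesis by (metis cong_sym_eq nat_le_linear)
qed

text \<open>Identify the orbit of \<open>a\<close> with the integers modulo its length through \<open>i \<mapsto> \<sigma>\<^sup>i(a)\<close>. Then \<open>f\<close> is
  multiplication by the unit \<open>r\<close>.\<close>
lemma orbit_power_map:
  fixes \<sigma> :: "'a \<Rightarrow> 'a"
  assumes perm: "permutation \<sigma>" and cop: "coprime r (least_power \<sigma> a)"
  obtains f where "f permutes set (support \<sigma> a)" "\<And>i. f ((\<sigma> ^^ i) a) = (\<sigma> ^^ (r * i)) a"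
proof -
  let ?m = "least_power \<sigma> a" and ?O = "set (support \<sigma> a)"
  have O: "?O = range (\<lambda>i. (\<sigma> ^^ i) a)" using support_set[OF perm] .
  define f where "f x = (if x \<in> ?O then (\<sigma> ^^ (r * (SOME i. (\<sigma> ^^ i) a = x))) a else x)" for x
  have f: "f ((\<sigma> ^^ i) a) = (\<sigma> ^^ (r * i)) a" for i
  proof -
    define j where "j = (SOME j. (\<sigma> ^^ j) a = (\<sigma> ^^ i) a)"
    have "(\<sigma> ^^ j) a = (\<sigma> ^^ i) a" unfolding j_def by (rule someI) (rule refl)
    then have "[j = i] (mod ?m)" using funpow_eq_iff_cong[OF perm] by blast
    then have "[r * j = r * i] (mod ?m)" by (rule cong_scalar_left)
    then have "(\<sigma> ^^ (r * j)) a = (\<sigma> ^^ (r * i)) a" using funpow_eq_iff_cong[OF perm] by blast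
    moreover have "(\<sigma> ^^ i) a \<in> ?O" unfolding O by blast
    ultimately show ?thesis unfolding f_def j_def by simp
  qed
  have "f permutes ?O"
  proof (rule inj_imp_permutes)
    show "inj_on f ?O"
    proof (rule inj_onI)
      fix x y assume "x \<in> ?O" "y \<in> ?O" and eq: "f x = f y"
      then obtain i j where ij: "x = (\<sigma> ^^ i) a" "y = (\<sigma> ^^ j) a" unfolding O by blast
      then have "[r * i = r * j] (mod ?m)" using eq f funpow_eq_iff_cong[OF perm] by metis
      then have "[i = j] (mod ?m)" using cong_mult_lcancel_nat[OF cop] by blast
      then show "x = y" using ij funpow_eq_iff_cong[OF perm] by blast
    qed
    show "finite ?O" by simp
    show "f x \<in> ?O" if "x \<in> ?O" for x using that f unfolding O by auto
  qed (auto simp: f_def)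
  then show thesis using that f by blast
qed

text \<open>An affine map \<open>i \<mapsto> r i + s\<close> on an orbit conjugates \<open>\<sigma>\<close> to \<open>\<sigma>\<^sup>r\<close> on this orbit and to \<open>\<sigma>\<close> outside of it.\<close>
lemma moves_to_commuting_orbit_map:
  assumes perm: "permutation \<sigma>" and y: "y permutes set (support \<sigma> a)"
    and act: "\<And>i. y ((\<sigma> ^^ i) a) = (\<sigma> ^^ (r * i + s)) a"
    and r: "\<not> [r = 1] (mod least_power \<sigma> a)"
  shows "moves_to_commuting y \<sigma>"
proof -
  let ?O = "set (support \<sigma> a)"
  have O: "?O = range (\<lambda>i. (\<sigma> ^^ i) a)" using support_set[OF perm] .
  have inj: "inj \<sigma>" using perm by (simp add: permutation bij_is_inj)
  define \<tau> where "\<tau> = y \<circ> \<sigma> \<circ> inv' y"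
  have \<tau>y: "\<tau> (y x) = y (\<sigma> x)" for x using permutes_inverses(2)[OF y] by (simp add: \<tau>_def)
  have \<sigma>O: "\<sigma> x \<in> ?O \<longleftrightarrow> x \<in> ?O" for x
  proof
    show *: "\<sigma> x \<in> ?O" if "x \<in> ?O" for x
    proof -
      from that obtain i where "x = (\<sigma> ^^ i) a" unfolding O by blast
      then have "\<sigma> x = (\<sigma> ^^ Suc i) a" by simp
      then show ?thesis unfolding O by blast
    qed
    have "\<sigma> ` ?O = ?O"
      by (rule endo_inj_surj[OF finite_set _ inj_on_subset[OF inj subset_UNIV]]) (use * in blast)
    moreover assume "\<sigma> x \<in> ?O"
    ultimately obtain z where "z \<in> ?O" "\<sigma> x = \<sigma> z" by blast
    then show "x \<in> ?O" using injD[OF inj] by metis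
  qed
  have out: "\<tau> x = \<sigma> x" if "x \<notin> ?O" for x
    using \<tau>y[of x] permutes_not_in[OF y, of x] permutes_not_in[OF y, of "\<sigma> x"] \<sigma>O that by simp
  have ins: "\<tau> x = (\<sigma> ^^ r) x" if "x \<in> ?O" for x
  proof -
    from that obtain z where z: "z \<in> ?O" "x = y z" using permutes_image[OF y] by blast
    then obtain i where i: "z = (\<sigma> ^^ i) a" unfolding O by blast
    have "\<tau> x = y ((\<sigma> ^^ Suc i) a)" using \<tau>y z i by simp
    also have "\<dots> = (\<sigma> ^^ (r + (r * i + s))) a" using act[of "Suc i"] by (simp add: add.assoc)
    also have "\<dots> = (\<sigma> ^^ r) x" using z i act by (simp add: funpow_add)
    finally show ?thesis .
  qed
  have "\<tau> (\<sigma> x) = \<sigma> (\<tau> x)" for x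
    using out[of x] out[of "\<sigma> x"] ins[of x] ins[of "\<sigma> x"] \<sigma>O[of x] by (cases "x \<in> ?O") (auto simp: funpow_swap1)
  moreover have "a \<in> ?O" unfolding O by (metis funpow_0 rangeI)
  then have "\<tau> a \<noteq> \<sigma> a"
    using ins r funpow_eq_iff_cong[OF perm, of r a 1] by simp
  moreover have "y \<circ> \<sigma> = \<tau> \<circ> y" using \<tau>y by auto
  ultimately show ?thesis unfolding moves_to_commuting_def by (metis (no_types) comp_apply ext)
qed

text \<open>On an orbit of odd length the map \<open>i \<mapsto> 4 i\<close> is the square of \<open>i \<mapsto> 2 i\<close> and hence even, and \<open>4\<close> is not
  congruent to \<open>1\<close> unless the length divides three. On an orbit of even length the two reflections
  \<open>i \<mapsto> -i\<close> and \<open>i \<mapsto> 1 - i\<close> differ by the odd cycle \<open>\<sigma>\<close>, so one of them is even.\<close>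
lemma moves_to_commuting_long_orbit:
  assumes perm: "permutation \<sigma>" and m: "least_power \<sigma> a \<ge> 4"
  obtains y where "y permutes set (support \<sigma> a)" "evenperm y" "moves_to_commuting y \<sigma>"
proof (cases "odd (least_power \<sigma> a)")
  let ?m = "least_power \<sigma> a" and ?O = "set (support \<sigma> a)"
  case True
  obtain f where f: "f permutes ?O" "\<And>i. f ((\<sigma> ^^ i) a) = (\<sigma> ^^ (2 * i)) a"
    using orbit_power_map[OF perm, of 2 a] True by (metis coprime_left_2_iff_odd)
  have pf: "permutation f" using f(1) by (auto simp: permutation_permutes)
  have "\<not> [4 = 1] (mod ?m)"
    using m True cong_altdef_nat[of 1 4 ?m] dvd_imp_le[of ?m 3] by auto
  then have "moves_to_commuting (f \<circ> f) \<sigma>"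
    using f by (intro moves_to_commuting_orbit_map[OF perm, of _ a 4 0]) (auto intro: permutes_compose)
  moreover have "evenperm (f \<circ> f)" using evenperm_comp[OF pf pf] by simp
  ultimately show thesis using that permutes_compose[OF f(1) f(1)] by blast
next
  let ?m = "least_power \<sigma> a" and ?O = "set (support \<sigma> a)"
  case False
  have "coprime (?m - 1) ?m" using m coprime_diff_one_left_nat[of ?m] by simp
  then obtain f where f: "f permutes ?O" "\<And>i. f ((\<sigma> ^^ i) a) = (\<sigma> ^^ ((?m - 1) * i)) a"
    using orbit_power_map[OF perm] by metis
  have pf: "permutation f" using f(1) by (auto simp: permutation_permutes)
  define c where "c = cycle_of_list (support \<sigma> a)"
  have c: "c permutes ?O" unfolding c_def by (rule cycle_permutes)
  have pc: "permutation c" unfolding c_def by (rule permutation_of_cycle)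
  have c\<sigma>: "c ((\<sigma> ^^ i) a) = (\<sigma> ^^ (i + 1)) a" for i
  proof -
    have "(\<sigma> ^^ i) a \<in> ?O" unfolding support_set[OF perm] by blast
    then show ?thesis using cycle_restrict[OF perm] by (simp add: c_def)
  qed
  have "support \<sigma> a \<noteq> []" using m by auto
  then have "\<not> evenperm c"
    unfolding c_def using evenperm_cycle_of_list[OF cycle_of_permutation[OF perm, of a]] False by simp
  then have ev: "evenperm f \<or> evenperm (c \<circ> f)" using evenperm_comp[OF pc pf] by simp
  have r: "\<not> [?m - 1 = 1] (mod ?m)"
    using m cong_less_modulus_unique_nat[of "?m - 1" 1 ?m] by auto
  have "moves_to_commuting f \<sigma>"
    using f r by (intro moves_to_commuting_orbit_map[OF perm, of _ a "?m - 1" 0]) auto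
  moreover have "moves_to_commuting (c \<circ> f) \<sigma>"
    using f r c c\<sigma> permutes_compose
    by (intro moves_to_commuting_orbit_map[OF perm, of _ a "?m - 1" 1]) auto
  ultimately show thesis using that ev f(1) permutes_compose[OF f(1) c] by blast
qed

lemma exists_notin_list: "length xs < card S \<Longrightarrow> \<exists>x\<in>S. x \<notin> set xs"
  using card_mono[of "set xs" S] card_length[of xs] by fastforce

lemma evenperm_transpose_transpose:
  assumes "a \<noteq> b" "c \<noteq> d"
  shows "evenperm (transpose a b \<circ> transpose c d)"
  using assms by (simp add: evenperm_comp permutation_swap_id evenperm_swap)

lemma transpose_image_comp:
  "inj \<sigma> \<Longrightarrow> transpose (\<sigma> a) (\<sigma> b) \<circ> \<sigma> = \<sigma> \<circ> transpose a b"
  by (auto simp: fun_eq_iff transpose_def inj_eq)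

lemma transpose_inverts_three_cycle:
  assumes "\<sigma> a = b" "\<sigma> b = c" "\<sigma> c = a" "distinct [a, b, c]" "x \<in> {a, b, c}"
  shows "transpose a b (\<sigma> x) = \<sigma> (\<sigma> (transpose a b x))" "transpose a b x \<in> {a, b, c}"
  using assms by (auto simp: transpose_def)

lemma three_cycle_outside:
  assumes "inj \<sigma>" "\<sigma> a = b" "\<sigma> b = c" "\<sigma> c = a" "x \<notin> {a, b, c}"
  shows "\<sigma> x \<notin> {a, b, c}"
  using assms by (metis injD insert_iff empty_iff)

lemma transpose_moves_three_cycle:
  assumes inj: "inj \<sigma>" and c3: "\<sigma> a = b" "\<sigma> b = c" "\<sigma> c = a" "distinct [a, b, c]"
  obtains \<rho> where "transpose a b \<circ> \<sigma> = \<rho> \<circ> transpose a b" "\<rho> \<circ> \<sigma> = \<sigma> \<circ> \<rho>"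
proof -
  define \<rho> where "\<rho> x = (if x \<in> {a, b, c} then \<sigma> (\<sigma> x) else \<sigma> x)" for x
  note out = three_cycle_outside[OF inj c3(1,2,3)]
  have "transpose a b (\<sigma> x) = \<rho> (transpose a b x)" for x
  proof (cases "x \<in> {a, b, c}")
    case True
    then show ?thesis using transpose_inverts_three_cycle[OF c3 True] by (simp add: \<rho>_def)
  next
    case False
    then show ?thesis using out[OF False] by (simp add: \<rho>_def)
  qed
  moreover have "\<rho> (\<sigma> x) = \<sigma> (\<rho> x)" for x
  proof (cases "x \<in> {a, b, c}")
    case True
    then show ?thesis using c3 by (auto simp: \<rho>_def)
  next
    case False
    then show ?thesis using out[OF False] by (simp add: \<rho>_def)
  qed
  ultimately show thesis using that by (metis (no_types) comp_apply ext)
qed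

text \<open>The transposition of \<open>a\<close> and \<open>b\<close> inverts a three-cycle of \<open>\<sigma>\<close>, which already gives a commuting
  conjugate. The second transposition only repairs the parity; it is harmless as long as it moves \<open>\<sigma>\<close> to
  a permutation \<open>\<rho>\<close> that commutes with \<open>\<sigma>\<close>.\<close>
lemma moves_to_commuting_three_cycle:
  assumes inj: "inj \<sigma>" and c3: "\<sigma> a = b" "\<sigma> b = c" "\<sigma> c = a" "distinct [a, b, c]"
    and de: "d \<notin> {a, b, c}" "e \<notin> {a, b, c}"
    and \<rho>: "transpose d e \<circ> \<sigma> = \<rho> \<circ> transpose d e" "\<rho> \<circ> \<sigma> = \<sigma> \<circ> \<rho>"
  shows "moves_to_commuting (transpose a b \<circ> transpose d e) \<sigma>"
proof -
  note out = three_cycle_outside[OF inj c3(1,2,3)]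
  define \<tau> where "\<tau> x = (if x \<in> {a, b, c} then \<sigma> (\<sigma> x) else \<rho> x)" for x
  have \<rho>1: "\<rho> (transpose d e x) = transpose d e (\<sigma> x)" for x using fun_cong[OF \<rho>(1), of x] by simp
  have \<rho>2: "\<rho> (\<sigma> x) = \<sigma> (\<rho> x)" for x using fun_cong[OF \<rho>(2), of x] by simp
  have U: "transpose d e x = x" if "x \<in> {a, b, c}" for x
    using that de by (auto simp: transpose_def)
  have Uo: "transpose d e x \<notin> {a, b, c}" if "x \<notin> {a, b, c}" for x
    using that de by (auto simp: transpose_def)
  have T: "transpose a b x = x" if "x \<notin> {a, b, c}" for x
    using that by (auto simp: transpose_def)
  have \<rho>o: "\<rho> x \<notin> {a, b, c}" if "x \<notin> {a, b, c}" for x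
    using \<rho>1[of "transpose d e x"] Uo[OF that] Uo[OF out[OF Uo[OF that]]] by simp
  have "transpose a b (transpose d e (\<sigma> x)) = \<tau> (transpose a b (transpose d e x))" for x
  proof (cases "x \<in> {a, b, c}")
    case True
    moreover have "\<sigma> x \<in> {a, b, c}" using True c3 by auto
    ultimately show ?thesis
      using transpose_inverts_three_cycle[OF c3 True] U by (simp add: \<tau>_def)
  next
    case False
    have "transpose a b (transpose d e (\<sigma> x)) = \<rho> (transpose d e x)"
      using T[OF Uo[OF out[OF False]]] \<rho>1 by simp
    then show ?thesis using T[OF Uo[OF False]] Uo[OF False] by (simp add: \<tau>_def)
  qed
  moreover have "\<tau> (\<sigma> x) = \<sigma> (\<tau> x)" for x
  proof (cases "x \<in> {a, b, c}")
    case True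
    then show ?thesis using c3 by (auto simp: \<tau>_def)
  next
    case False
    then show ?thesis using out[OF False] \<rho>2 by (simp add: \<tau>_def)
  qed
  moreover have "\<tau> a \<noteq> \<sigma> a" using c3 by (auto simp: \<tau>_def)
  ultimately show ?thesis unfolding moves_to_commuting_def by (metis (no_types) comp_apply ext)
qed

text \<open>At least three points lie outside the three-cycle. The repairing transposition exchanges two fixed
  points, or it is a two-cycle of \<open>\<sigma>\<close>, or it inverts another three-cycle.\<close>
lemma exists_moves_to_commuting_three_cycle:
  assumes perm: "\<sigma> permutes S" and fin: "finite S" and card: "card S \<ge> 6"
    and c3: "\<sigma> a = b" "\<sigma> b = c" "\<sigma> c = a" "distinct [a, b, c]"
    and short: "\<And>x. \<sigma> x = x \<or> \<sigma> (\<sigma> x) = x \<or> \<sigma> (\<sigma> (\<sigma> x)) = x"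
  obtains y where "y permutes S" "evenperm y" "moves_to_commuting y \<sigma>"
proof -
  have inj: "inj \<sigma>" using perm by (rule permutes_inj)
  have "\<sigma> a \<noteq> a" "\<sigma> b \<noteq> b" "\<sigma> c \<noteq> c" using c3 by auto
  then have abc: "{a, b, c} \<subseteq> S" using permutes_not_in[OF perm] by blast
  note out = three_cycle_outside[OF inj c3(1,2,3)]
  have finish: thesis
    if "d \<in> S - {a, b, c}" "e \<in> S - {a, b, c}" "d \<noteq> e"
      "transpose d e \<circ> \<sigma> = \<rho> \<circ> transpose d e" "\<rho> \<circ> \<sigma> = \<sigma> \<circ> \<rho>" for d e \<rho>
  proof (rule \<open>\<And>y. y permutes S \<Longrightarrow> evenperm y \<Longrightarrow> moves_to_commuting y \<sigma> \<Longrightarrow> thesis\<close>)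
    show "transpose a b \<circ> transpose d e permutes S"
      using abc that by (intro permutes_compose permutes_swap_id) auto
    show "evenperm (transpose a b \<circ> transpose d e)"
      using c3 that by (intro evenperm_transpose_transpose) auto
    show "moves_to_commuting (transpose a b \<circ> transpose d e) \<sigma>"
      by (rule moves_to_commuting_three_cycle[OF inj c3 _ _ that(4,5)]) (use that in auto)
  qed
  have nonfixed: thesis if d: "d \<in> S - {a, b, c}" "\<sigma> d \<noteq> d" for d
  proof -
    have e: "\<sigma> d \<in> S - {a, b, c}" using d out[of d] permutes_in_image[OF perm] by auto
    consider "\<sigma> (\<sigma> d) = d" | "\<sigma> (\<sigma> (\<sigma> d)) = d" "\<sigma> (\<sigma> d) \<noteq> d" using short[of d] d by blast
    then show thesis
    proof cases
      case 1
      then have "transpose d (\<sigma> d) \<circ> \<sigma> = \<sigma> \<circ> transpose d (\<sigma> d)"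
        using transpose_image_comp[OF inj, of d "\<sigma> d"] by (simp add: transpose_commute)
      then show thesis using finish[OF d(1) e d(2)[symmetric]] by blast
    next
      case 2
      have "\<sigma> (\<sigma> d) \<noteq> \<sigma> d" using d inj by (metis injD)
      then have "distinct [d, \<sigma> d, \<sigma> (\<sigma> d)]" using 2 d by auto
      then show thesis
        using transpose_moves_three_cycle[OF inj refl refl 2(1)] finish[OF d(1) e d(2)[symmetric]] by metis
    qed
  qed
  obtain d where d: "d \<in> S - {a, b, c}" using exists_notin_list[of "[a, b, c]" S] card by auto
  obtain e where e: "e \<in> S - {a, b, c, d}" using exists_notin_list[of "[a, b, c, d]" S] card by auto
  show thesis
  proof (cases "\<sigma> d = d \<and> \<sigma> e = e")
    case True
    then have "transpose d e \<circ> \<sigma> = \<sigma> \<circ> transpose d e"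
      using transpose_image_comp[OF inj, of d e] by simp
    then show thesis using finish[of d e \<sigma>] d e by blast
  next
    case False
    then show thesis using nonfixed d e by blast
  qed
qed

text \<open>If there are two fixed points \<open>c\<close>, \<open>d\<close>, then a two-cycle \<open>(a b)\<close> is moved onto \<open>(c d)\<close>. Otherwise there are
  three two-cycles, and \<open>(a b) (c d)\<close> is moved to \<open>(a c) (b d)\<close>, where the two-cycle \<open>(e f)\<close> repairs the parity.\<close>
lemma exists_moves_to_commuting_involution:
  assumes perm: "\<sigma> permutes S" and fin: "finite S" and card: "card S \<ge> 6"
    and inv: "\<And>x. \<sigma> (\<sigma> x) = x" and a: "\<sigma> a \<noteq> a"
  obtains y where "y permutes S" "evenperm y" "moves_to_commuting y \<sigma>"
proof -
  have inj: "inj \<sigma>" using perm by (rule permutes_inj)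
  have S: "x \<in> S" if "\<sigma> x \<noteq> x" for x using permutes_not_in[OF perm] that by blast
  have S': "\<sigma> x \<in> S" if "x \<in> S" for x using permutes_in_image[OF perm] that by blast
  define b where "b = \<sigma> a"
  have b: "\<sigma> b = a" "\<sigma> a = b" "a \<noteq> b" using inv a by (auto simp: b_def)
  have ab: "a \<in> S" "b \<in> S" using S S' a by (auto simp: b_def)
  show thesis
  proof (cases "\<exists>c d. c \<noteq> d \<and> c \<in> S \<and> d \<in> S \<and> \<sigma> c = c \<and> \<sigma> d = d")
    case True
    then obtain c d where cd: "c \<noteq> d" "c \<in> S" "d \<in> S" "\<sigma> c = c" "\<sigma> d = d" by blast
    then have ne: "distinct [a, b, c, d]" using b by auto
    define y where "y = transpose a c \<circ> transpose b d"
    define \<tau> where "\<tau> = (\<lambda>x. if x \<in> {a, b} then x else if x = c then d else if x = d then c else \<sigma> x)"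
    have o: "\<sigma> x \<notin> {a, b, c, d}" if "x \<notin> {a, b, c, d}" for x
      using that b cd inv by (metis insert_iff empty_iff)
    have "y (\<sigma> x) = \<tau> (y x)" for x
      using ne b cd o[of x] by (cases "x \<in> {a, b, c, d}") (auto simp: y_def \<tau>_def transpose_def)
    moreover have "\<tau> (\<sigma> x) = \<sigma> (\<tau> x)" for x
      using ne b cd o[of x] by (cases "x \<in> {a, b, c, d}") (auto simp: \<tau>_def)
    moreover have "\<tau> a \<noteq> \<sigma> a" using b by (simp add: \<tau>_def)
    ultimately have "moves_to_commuting y \<sigma>"
      unfolding moves_to_commuting_def by (metis (no_types) comp_apply ext)
    moreover have "y permutes S"
      unfolding y_def using ab cd by (intro permutes_compose permutes_swap_id) auto
    moreover have "evenperm y"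
      unfolding y_def using ne by (intro evenperm_transpose_transpose) auto
    ultimately show thesis using that by blast
  next
    case False
    have ex: "\<exists>c\<in>S. c \<notin> set xs \<and> \<sigma> c \<noteq> c" if "length xs \<le> 4" for xs
    proof -
      have "card (S - set xs) \<ge> 2"
        using that card card_length[of xs] diff_card_le_card_Diff[of "set xs" S] by simp
      then obtain B where "B \<subseteq> S - set xs" "card B = 2" by (meson obtain_subset_with_card_n)
      then obtain c d where "c \<noteq> d" "c \<in> S - set xs" "d \<in> S - set xs" by (auto simp: card_2_iff)
      then show ?thesis using False by blast
    qed
    obtain c where c: "c \<in> S" "c \<notin> {a, b}" "\<sigma> c \<noteq> c" using ex[of "[a, b]"] by auto
    define d where "d = \<sigma> c"
    have d: "\<sigma> d = c" "\<sigma> c = d" "c \<noteq> d" "d \<in> S" using inv c S' by (auto simp: d_def)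
    have "d \<noteq> a" "d \<noteq> b" using b(1,2) c(2) d(1) by auto
    then have abcd: "distinct [a, b, c, d]" using b(3) c(2) d(3) by auto
    obtain e where e: "e \<in> S" "e \<notin> {a, b, c, d}" "\<sigma> e \<noteq> e"
      using ex[of "[a, b, c, d]"] by auto
    define f where "f = \<sigma> e"
    have f: "\<sigma> f = e" "\<sigma> e = f" "e \<noteq> f" "f \<in> S" using inv e S' by (auto simp: f_def)
    have "f \<noteq> a" "f \<noteq> b" "f \<noteq> c" "f \<noteq> d" using b(1,2) d(1,2) e(2) f(1) by auto
    then have ne: "distinct [a, b, c, d, e, f]" using abcd e(2) f(3) by auto
    define y where "y = transpose b c \<circ> transpose e f"
    define \<tau> where "\<tau> = (\<lambda>x. if x = a then c else if x = b then d else if x = c then a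
      else if x = d then b else \<sigma> x)"
    have o: "\<sigma> x \<notin> {a, b, c, d, e, f}" if "x \<notin> {a, b, c, d, e, f}" for x
      using that b d f inv by (metis insert_iff empty_iff)
    have "y (\<sigma> x) = \<tau> (y x)" for x
      using ne b d f o[of x] by (cases "x \<in> {a, b, c, d, e, f}") (auto simp: y_def \<tau>_def transpose_def)
    moreover have "\<tau> (\<sigma> x) = \<sigma> (\<tau> x)" for x
      using ne b d f o[of x] by (cases "x \<in> {a, b, c, d, e, f}") (auto simp: \<tau>_def)
    moreover have "\<tau> a \<noteq> \<sigma> a" using ne b by (auto simp: \<tau>_def)
    ultimately have "moves_to_commuting y \<sigma>"
      unfolding moves_to_commuting_def by (metis (no_types) comp_apply ext)
    moreover have "y permutes S"
      unfolding y_def using ab c f e by (intro permutes_compose permutes_swap_id) auto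
    moreover have "evenperm y"
      unfolding y_def using ne by (intro evenperm_transpose_transpose) auto
    ultimately show thesis using that by blast
  qed
qed

lemma exists_moves_to_commuting:
  assumes perm: "\<sigma> permutes S" and fin: "finite S" and card: "card S \<ge> 6" and ne: "\<sigma> \<noteq> id"
  obtains y where "y permutes S" "evenperm y" "moves_to_commuting y \<sigma>"
proof -
  have p: "permutation \<sigma>" using perm fin by (auto simp: permutation_permutes)
  have inj: "inj \<sigma>" using perm by (rule permutes_inj)
  show thesis
  proof (cases "\<exists>a. least_power \<sigma> a \<ge> 4")
    case True
    then obtain a where a: "least_power \<sigma> a \<ge> 4" by blast
    obtain y where y: "y permutes set (support \<sigma> a)" "evenperm y" "moves_to_commuting y \<sigma>"
      using moves_to_commuting_long_orbit[OF p a] by blast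
    have "\<sigma> a \<noteq> a" using a least_power_le[where f = \<sigma> and n = 1 and x = a] by auto
    then have "a \<in> S" using permutes_not_in[OF perm] by blast
    then have "set (support \<sigma> a) \<subseteq> S"
      using permutes_in_image[OF permutes_funpow[OF perm]] by auto
    then show thesis using that y permutes_subset by blast
  next
    case False
    have short: "\<sigma> x = x \<or> \<sigma> (\<sigma> x) = x \<or> \<sigma> (\<sigma> (\<sigma> x)) = x" for x
    proof -
      have "0 < least_power \<sigma> x" "least_power \<sigma> x < 4"
        using False least_power_of_permutation(2)[OF p, of x] by (auto simp: not_le)
      then consider "least_power \<sigma> x = 1" | "least_power \<sigma> x = 2" | "least_power \<sigma> x = 3"
        by linarith
      then show ?thesis
        using least_power_of_permutation(1)[OF p, of x]
        by cases (simp_all add: numeral_2_eq_2 numeral_3_eq_3)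
    qed
    show thesis
    proof (cases "\<forall>x. \<sigma> (\<sigma> x) = x")
      case True
      moreover obtain a where "\<sigma> a \<noteq> a" using ne by (metis eq_id_iff)
      ultimately show thesis using exists_moves_to_commuting_involution[OF perm fin card] that by metis
    next
      case False
      then obtain a where a: "\<sigma> (\<sigma> a) \<noteq> a" by blast
      then have "\<sigma> a \<noteq> a" by auto
      then have "\<sigma> (\<sigma> (\<sigma> a)) = a" "distinct [a, \<sigma> a, \<sigma> (\<sigma> a)]"
        using a short[of a] inj_eq[OF inj] by auto
      then show thesis
        using exists_moves_to_commuting_three_cycle[OF perm fin card refl refl _ _ short] that by metis
    qed
  qed
qed

section \<open>Three-cycles and automorphisms of alternating groups\<close>

abbreviation cyc3 :: "'a \<Rightarrow> 'a \<Rightarrow> 'a \<Rightarrow> 'a \<Rightarrow> 'a"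
  where "cyc3 a b c \<equiv> cycle_of_list [a, b, c]"

lemma cyc3_apply:
  assumes "distinct [a, b, c]"
  shows "cyc3 a b c x = (if x = a then b else if x = b then c else if x = c then a else x)"
  using assms by (auto simp: transpose_def)

lemma cyc3_rotate:
  assumes "distinct [a, b, c]"
  shows "cyc3 a b c = cyc3 b c a"
proof
  fix x
  have "distinct [b, c, a]" using assms by auto
  then show "cyc3 a b c x = cyc3 b c a x"
    using assms by (auto simp: cyc3_apply simp del: cycle_of_list.simps)
qed

lemma mem_three_cycles_iff:
  "p \<in> three_cycles n \<longleftrightarrow> (\<exists>a b c. distinct [a, b, c] \<and> {a, b, c} \<subseteq> {1..n} \<and> p = cyc3 a b c)"
  (is "?L \<longleftrightarrow> ?R")
proof
  assume ?L
  then obtain cs where cs: "p = cycle_of_list cs" "cycle cs" "length cs = 3" "set cs \<subseteq> {1..n}" by blast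
  obtain a b c where "cs = [a, b, c]" using stupid_lemma[OF cs(3)] by blast
  then show ?R using cs by (intro exI[of _ a] exI[of _ b] exI[of _ c]) simp
next
  assume ?R
  then obtain a b c where "distinct [a, b, c]" "{a, b, c} \<subseteq> {1..n}" "p = cyc3 a b c" by blast
  then show ?L by (intro CollectI exI[of _ "[a, b, c]"]) simp
qed

lemma cyc3_moved:
  assumes "distinct [a, b, c]" "x = cyc3 a b c" "x u \<noteq> u" "x v \<noteq> v"
  shows "v = u \<or> v = x u \<or> v = x (x u)" "x (x (x u)) = u" "x (x u) \<noteq> u"
    "x = cyc3 u (x u) (x (x u))"
proof -
  have u: "u = a \<or> u = b \<or> u = c" and v: "v = a \<or> v = b \<or> v = c"
    using assms by (auto simp: cyc3_apply simp del: cycle_of_list.simps split: if_splits)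
  note s = cyc3_apply[OF assms(1)]
  show "v = u \<or> v = x u \<or> v = x (x u)" "x (x (x u)) = u" "x (x u) \<noteq> u"
    using u v assms(1) unfolding assms(2) s by auto
  have r: "distinct [b, c, a]" "distinct [c, a, b]" using assms(1) by auto
  have xs: "x a = b" "x b = c" "x c = a"
    using assms(1) unfolding assms(2) s by auto
  show "x = cyc3 u (x u) (x (x u))"
    using u cyc3_rotate[OF assms(1)] cyc3_rotate[OF r(1)] xs assms(2) by metis
qed

text \<open>If \<open>(x y)\<^sup>2 = 1\<close>, then \<open>x y x = y\<^sup>-\<^sup>1\<close>. A point \<open>u\<close> moved by \<open>x\<close> for which \<open>y\<close> fixes both \<open>u\<close> and \<open>x(u)\<close> would be
  fixed by \<open>x\<^sup>2\<close>; so \<open>y\<close> moves at least two of the three points of \<open>x\<close>. If \<open>x\<close> and \<open>y\<close> traverse a common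
  pair of points in opposite directions, then either \<open>y = x\<^sup>-\<^sup>1\<close> or \<open>(x y)\<^sup>2 \<noteq> 1\<close>.\<close>
lemma cyc3_common_edge:
  assumes d: "distinct [a, b, c]" "distinct [d, e, f]"
    and x: "x = cyc3 a b c" and y: "y = cyc3 d e f"
    and ne: "x \<noteq> y" "x \<circ> y \<noteq> id" and sq: "(x \<circ> y) \<circ> (x \<circ> y) = id"
  obtains (edge) u where "x u \<noteq> u" "x u = y u"
proof -
  have xy: "x (y (x (y z))) = z" for z using fun_cong[OF sq, of z] by simp
  have xi: "inj x" "inj y" unfolding x y by (auto intro!: permutes_inj cycle_permutes simp del: cycle_of_list.simps)
  have out: "y u \<noteq> u \<or> y (x u) \<noteq> x u" if u: "x u \<noteq> u" for u
  proof (rule ccontr)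
    assume "\<not> ?thesis"
    then have "x (x u) = u" using xy[of u] by simp
    then show False using cyc3_moved(3)[OF d(1) x u u] by blast
  qed
  have main: thesis if u: "x u \<noteq> u" "y u \<noteq> u" "y (x u) \<noteq> x u" for u
  proof (cases "y u = x u")
    case True
    show thesis by (rule edge[OF u(1) True[symmetric]])
  next
    case False
    define v where "v = x u"
    define w where "w = x v"
    note X = cyc3_moved[OF d(1) x u(1) u(1)]
    note Y = cyc3_moved[OF d(2) y u(2) u(3)]
    have xv: "x u = v" "x v = w" "x w = u" "w \<noteq> u" "u \<noteq> v" "x = cyc3 u v w"
      using X u unfolding v_def w_def by metis+
    have wv: "w \<noteq> v" using xv(1,2) xv(5) injD[OF xi(1), of u v] by metis
    have yu: "y (y u) = v" using Y(1) False u by (auto simp: v_def)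
    then have yv: "y v = u" using Y(2) by simp
    have y1: "y u \<noteq> v" "y u \<noteq> u" using False u by (auto simp: v_def)
    show thesis
    proof (cases "y u = w")
      case True
      then have "y = cyc3 u w v" using Y(4) yu by metis
      moreover have "distinct [u, v, w]" "distinct [u, w, v]" using xv wv by auto
      ultimately have "x (y z) = z" for z
        by (subst xv(6)) (auto simp: cyc3_apply simp del: cycle_of_list.simps)
      then show thesis using ne(2) by auto
    next
      case False
      have "x (y u) = y u"
      proof (rule ccontr)
        assume "x (y u) \<noteq> y u"
        then show False using cyc3_moved(1)[OF d(1) x u(1), of "y u"] False y1 by (auto simp: v_def w_def)
      qed
      have "y w = w"
      proof (rule ccontr)
        assume "y w \<noteq> w"
        then have "w = u \<or> w = y u \<or> w = y (y u)" using cyc3_moved(1)[OF d(2) y u(2)] by blast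
        then show False using xv False yu by auto
      qed
      have "x (y (x (y w))) = y u" using \<open>y w = w\<close> xv(3) \<open>x (y u) = y u\<close> by simp
      then have "w = y u" using xy by simp
      then show thesis using False by simp
    qed
  qed
  have mv: "x a \<noteq> a" "x b \<noteq> b" "x c \<noteq> c" "x a = b" "x b = c" "x c = a"
    using d(1) by (auto simp: x cyc3_apply simp del: cycle_of_list.simps)
  show thesis
    using out[OF mv(1)] out[OF mv(2)] out[OF mv(3)] main[OF mv(1)] main[OF mv(2)] main[OF mv(3)] mv(4-)
    by metis
qed

lemma auto_alt_groupD:
  assumes "\<theta> \<in> auto (alt_group n)"
  shows "\<And>x. x \<in> carrier (alt_group n) \<Longrightarrow> \<theta> x \<in> carrier (alt_group n)"
    and "\<And>x y. x \<in> carrier (alt_group n) \<Longrightarrow> y \<in> carrier (alt_group n) \<Longrightarrow> \<theta> (x \<circ> y) = \<theta> x \<circ> \<theta> y"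
    and "inj_on \<theta> (carrier (alt_group n))"
    and "\<theta> ` carrier (alt_group n) = carrier (alt_group n)"
    and "\<theta> id = id"
    and "\<And>x. x \<in> carrier (alt_group n) \<Longrightarrow> \<theta> (inv' x) = inv' (\<theta> x)"
proof -
  interpret group "alt_group n" by (rule alt_group_is_group)
  interpret \<theta>: group_hom "alt_group n" "alt_group n" \<theta>
    using assms by unfold_locales (simp add: auto_def)
  show cl: "\<theta> x \<in> carrier (alt_group n)" if "x \<in> carrier (alt_group n)" for x using that by simp
  show "\<theta> (x \<circ> y) = \<theta> x \<circ> \<theta> y" if "x \<in> carrier (alt_group n)" "y \<in> carrier (alt_group n)" for x y
    using \<theta>.hom_mult[OF that] by (simp add: alt_group_mult)
  show "inj_on \<theta> (carrier (alt_group n))" "\<theta> ` carrier (alt_group n) = carrier (alt_group n)"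
    using assms by (auto simp: auto_def Bij_def bij_betw_def)
  show "\<theta> id = id" using \<theta>.hom_one by (simp add: alt_group_one)
  show "\<theta> (inv' x) = inv' (\<theta> x)" if "x \<in> carrier (alt_group n)" for x
    using \<theta>.hom_inv[OF that] that cl[OF that] by (simp add: alt_group_inv_equality)
qed

lemma alt_group_comp_closed:
  "x \<in> carrier (alt_group n) \<Longrightarrow> y \<in> carrier (alt_group n) \<Longrightarrow> x \<circ> y \<in> carrier (alt_group n)"
  using group.subgroup_self[OF alt_group_is_group[of n]] subgroup.m_closed[of _ "alt_group n" x y]
  by (simp add: alt_group_mult)

lemma finite_alt_group: "finite (carrier (alt_group n))"
  using finite_permutations[of "{1..n}"] by (rule rev_finite_subset) (auto simp: alt_group_carrier)

lemma alt_group_pow: "x [^]\<^bsub>alt_group n\<^esub> (m::nat) = x ^^ m"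
  by (induction m) (simp_all add: alt_group_one alt_group_mult funpow_swap1 fun_eq_iff)

lemma auto_alt_group_funpow:
  assumes \<theta>: "\<theta> \<in> auto (alt_group n)" and x: "x \<in> carrier (alt_group n)"
  shows "\<theta> (x ^^ m) = \<theta> x ^^ m" "x ^^ m \<in> carrier (alt_group n)"
proof -
  have "\<theta> (x ^^ m) = \<theta> x ^^ m \<and> x ^^ m \<in> carrier (alt_group n)"
  proof (induction m)
    case 0
    have "id \<in> carrier (alt_group n)" unfolding alt_group_carrier by simp
    then show ?case using auto_alt_groupD(5)[OF \<theta>] by (simp only: funpow.simps)
  next
    case (Suc m)
    then show ?case
      using x auto_alt_groupD(2)[OF \<theta>] alt_group_comp_closed unfolding funpow.simps(2) by metis
  qed
  then show "\<theta> (x ^^ m) = \<theta> x ^^ m" "x ^^ m \<in> carrier (alt_group n)" by auto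
qed

lemma auto_alt_group_conj:
  assumes \<theta>: "\<theta> \<in> auto (alt_group n)" and "g \<in> carrier (alt_group n)" "x \<in> carrier (alt_group n)"
  shows "\<theta> (g \<circ> x \<circ> inv' g) = \<theta> g \<circ> \<theta> x \<circ> inv' (\<theta> g)"
  using assms auto_alt_groupD(2,6)[OF \<theta>] alt_group_comp_closed alt_group_inv_closed by metis

lemma auto_alt_group_order_3_iff:
  assumes \<theta>: "\<theta> \<in> auto (alt_group n)" and x: "x \<in> carrier (alt_group n)"
  shows "\<theta> x \<circ> \<theta> x \<circ> \<theta> x = id \<longleftrightarrow> x \<circ> x \<circ> x = id" "\<theta> x = id \<longleftrightarrow> x = id"
proof -
  note hom = auto_alt_groupD[OF \<theta>]
  have idA: "id \<in> carrier (alt_group n)" unfolding alt_group_carrier by simp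
  have inj: "\<theta> y = id \<longleftrightarrow> y = id" if "y \<in> carrier (alt_group n)" for y
    using inj_onD[OF hom(3) _ that idA] hom(5) by auto
  then show "\<theta> x = id \<longleftrightarrow> x = id" using x by blast
  have "\<theta> (x \<circ> x \<circ> x) = \<theta> x \<circ> \<theta> x \<circ> \<theta> x" using x alt_group_comp_closed hom(2) by metis
  moreover have "x \<circ> x \<circ> x \<in> carrier (alt_group n)" using x alt_group_comp_closed by metis
  ultimately show "\<theta> x \<circ> \<theta> x \<circ> \<theta> x = id \<longleftrightarrow> x \<circ> x \<circ> x = id" using inj by metis
qed

lemma cyc3_in_alt_group:
  "distinct [a, b, c] \<Longrightarrow> {a, b, c} \<subseteq> {1..n} \<Longrightarrow> cyc3 a b c \<in> carrier (alt_group n)"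
  by (rule subsetD[OF three_cycles_incl], subst mem_three_cycles_iff) blast

lemma conj_cyc3:
  assumes "distinct [a, b, c]" "bij p"
  shows "p \<circ> cyc3 a b c \<circ> inv' p = cyc3 (p a) (p b) (p c)"
  using conjugation_of_cycle[OF assms] by simp

text \<open>Conjugating the cycles \<open>(p q i)\<close> and their inverses by each other replaces \<open>p\<close> and \<open>q\<close> by arbitrary points.\<close>
lemma cyc3_generate_from_pair:
  assumes conj: "\<And>g x. g \<in> E \<Longrightarrow> x \<in> E \<Longrightarrow> g \<circ> x \<circ> inv' g \<in> E"
    and inv: "\<And>g. g \<in> E \<Longrightarrow> inv' g \<in> E"
    and base: "\<And>i. i \<in> S \<Longrightarrow> i \<noteq> p \<Longrightarrow> i \<noteq> q \<Longrightarrow> cyc3 p q i \<in> E" and pq: "p \<noteq> q"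
    and abc: "distinct [a, b, c]" "{a, b, c} \<subseteq> S"
  shows "cyc3 a b c \<in> E"
proof -
  have bij: "bij (cyc3 a b c)" for a b c :: 'a
    by (rule permutes_bij[OF cycle_permutes])
  have inv3: "inv' (cyc3 a b c) = cyc3 b a c" if "distinct [a, b, c]" for a b c :: 'a
  proof (rule inv_unique_comp)
    have "distinct [b, a, c]" using that by auto
    then show "cyc3 a b c \<circ> cyc3 b a c = id" "cyc3 b a c \<circ> cyc3 a b c = id"
      using that by (auto simp: fun_eq_iff cyc3_apply simp del: cycle_of_list.simps)
  qed
  have E_conj: "cyc3 (cyc3 u v w a) (cyc3 u v w b) (cyc3 u v w c) \<in> E"
    if "cyc3 u v w \<in> E" "cyc3 a b c \<in> E" "distinct [a, b, c]" for u v w a b c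
    using conj[OF that(1,2)] conj_cyc3[OF that(3) bij] by simp
  have b2: "cyc3 q p i \<in> E" if "i \<in> S" "i \<noteq> p" "i \<noteq> q" for i
    using inv[OF base[OF that]] inv3[of p q i] that pq by auto
  have q: "cyc3 q j i \<in> E" if "i \<in> S" "j \<in> S" "i \<notin> {p, q}" "j \<notin> {p, q}" "i \<noteq> j" for i j
    using E_conj[OF base[of j] base[of i]] that pq by (simp add: cyc3_apply del: cycle_of_list.simps)
  have p: "cyc3 j p i \<in> E" if "i \<in> S" "j \<in> S" "i \<notin> {p, q}" "j \<notin> {p, q}" "i \<noteq> j" for i j
    using E_conj[OF b2[of j] base[of i]] that pq by (simp add: cyc3_apply del: cycle_of_list.simps)
  have p': "cyc3 p i j \<in> E" if "i \<in> S" "j \<in> S" "i \<notin> {p, q}" "j \<notin> {p, q}" "i \<noteq> j" for i j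
    using p[OF that] cyc3_rotate[of j p i] that by auto
  have none: "cyc3 i j k \<in> E"
    if "i \<in> S" "j \<in> S" "k \<in> S" "i \<notin> {p, q}" "j \<notin> {p, q}" "k \<notin> {p, q}" "distinct [i, j, k]" for i j k
  proof -
    have d: "distinct [q, p, i]" "distinct [p, j, k]" using that pq by auto
    have "cyc3 (cyc3 q p i p) (cyc3 q p i j) (cyc3 q p i k) \<in> E"
      by (rule E_conj[OF b2 p' d(2)]) (use that in auto)
    moreover have "cyc3 q p i p = i" "cyc3 q p i j = j" "cyc3 q p i k = k"
      using that d(1) by (auto simp: cyc3_apply simp del: cycle_of_list.simps)
    ultimately show ?thesis by (simp del: cycle_of_list.simps)
  qed
  have starts: "cyc3 u v w \<in> E" if "distinct [u, v, w]" "{u, v, w} \<subseteq> S" "w \<notin> {p, q}" "u \<in> {p, q}" for u v w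
    using that base[of w] b2[of w] p'[of v w] q[of w v] by auto
  have "distinct [b, c, a]" "distinct [c, a, b]" using abc by auto
  note R = cyc3_rotate[OF abc(1)] cyc3_rotate[OF this(1)]
  have nall: "a \<notin> {p, q} \<or> b \<notin> {p, q} \<or> c \<notin> {p, q}" using abc by auto
  have "cyc3 a b c \<in> E" if "c \<notin> {p, q}" "a \<in> {p, q}" using starts[OF abc that] .
  moreover have "cyc3 b c a \<in> E" if "a \<notin> {p, q}" "b \<in> {p, q}" using starts[of b c a] abc that by auto
  moreover have "cyc3 c a b \<in> E" if "b \<notin> {p, q}" "c \<in> {p, q}" using starts[of c a b] abc that by auto
  moreover have "cyc3 a b c \<in> E" if "a \<notin> {p, q}" "b \<notin> {p, q}" "c \<notin> {p, q}"
    using none abc that by auto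
  ultimately show ?thesis using R nall by metis
qed

text \<open>The cycles \<open>(1 2 i)\<close> are pairwise related by \<open>(x y)\<^sup>2 = 1\<close>, and this relation is preserved by \<open>\<theta>\<close>. So any
  two of their images share an edge, and then all of them share the same edge from \<open>p\<close> to \<open>q\<close>. Thus
  \<open>\<theta>\<close> maps \<open>(1 2 i)\<close> to \<open>(p q s(i))\<close>, and \<open>\<sigma>\<close> is the permutation \<open>1 \<mapsto> p\<close>, \<open>2 \<mapsto> q\<close>, \<open>i \<mapsto> s(i)\<close>: conjugation
  by \<open>\<sigma>\<close> agrees with \<open>\<theta>\<close> on the cycles \<open>(1 2 i)\<close>, which generate the group.\<close>
lemma auto_preserving_three_cycles_is_conj:
  assumes n: "n \<ge> 4" and \<theta>: "\<theta> \<in> auto (alt_group n)"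
    and pres: "\<And>x. x \<in> three_cycles n \<Longrightarrow> \<theta> x \<in> three_cycles n"
  obtains \<sigma> where "\<sigma> permutes {1..n}" "\<And>x. x \<in> carrier (alt_group n) \<Longrightarrow> \<theta> x = \<sigma> \<circ> x \<circ> inv' \<sigma>"
proof -
  let ?A = "carrier (alt_group n)"
  note hom = auto_alt_groupD[OF \<theta>]
  define c where "c i = cyc3 1 2 i" for i :: nat
  define x where "x i = \<theta> (c i)" for i
  have d: "distinct [1, 2, i]" if "i \<in> {3..n}" for i :: nat using that by auto
  have cA: "c i \<in> ?A" and c3: "c i \<in> three_cycles n" if "i \<in> {3..n}" for i
  proof -
    show "c i \<in> three_cycles n"
      unfolding mem_three_cycles_iff c_def using that n by (intro exI[of _ 1] exI[of _ 2] exI[of _ i]) auto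
    then show "c i \<in> ?A" using three_cycles_incl by blast
  qed
  have x3: "\<exists>a b e. distinct [a, b, e] \<and> {a, b, e} \<subseteq> {1..n} \<and> x i = cyc3 a b e" if "i \<in> {3..n}" for i
    using pres[OF c3[OF that]] unfolding x_def mem_three_cycles_iff .
  have x_inj: "x i \<noteq> x j" if "i \<in> {3..n}" "j \<in> {3..n}" "i \<noteq> j" for i j
  proof
    assume "x i = x j"
    then have "c i = c j" using inj_onD[OF hom(3)] cA that unfolding x_def by blast
    then have "c i 2 = c j 2" by simp
    then show False using that d by (simp add: c_def cyc3_apply del: cycle_of_list.simps)
  qed
  have edge: "\<exists>u. x i u \<noteq> u \<and> x i u = x j u" if ij: "i \<in> {3..n}" "j \<in> {3..n}" "i \<noteq> j" for i j
  proof -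
    note dd = d[OF ij(1)] d[OF ij(2)]
    have ne: "c i \<circ> c j \<noteq> id"
    proof
      assume "c i \<circ> c j = id"
      then have "c i (c j i) = i" by (metis comp_apply id_apply)
      then show False using ij dd by (auto simp: c_def cyc3_apply simp del: cycle_of_list.simps)
    qed
    have "(c i \<circ> c j) \<circ> (c i \<circ> c j) = id"
      using ij dd by (auto simp: fun_eq_iff c_def cyc3_apply simp del: cycle_of_list.simps)
    then have sq: "(x i \<circ> x j) \<circ> (x i \<circ> x j) = id"
      using hom(2,5) cA ij alt_group_comp_closed unfolding x_def by metis
    have "x i \<circ> x j \<noteq> id"
    proof
      assume "x i \<circ> x j = id"
      then have "\<theta> (c i \<circ> c j) = \<theta> id" using hom(2,5) cA ij unfolding x_def by metis
      moreover have "id \<in> ?A" using alt_group_carrier by simp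
      ultimately show False
        using ne inj_onD[OF hom(3)] alt_group_comp_closed[OF cA[OF ij(1)] cA[OF ij(2)]] by blast
    qed
    then show ?thesis
      using x3[OF ij(1)] x3[OF ij(2)] x_inj[OF ij] sq cyc3_common_edge by metis
  qed
  have m3: "3 \<in> {3..n}" "4 \<in> {3..n}" using n by auto
  obtain p where p: "x 3 p \<noteq> p" "x 3 p = x 4 p" using edge[OF m3] by auto
  define q where "q = x 3 p"
  note mv = cyc3_moved
  have common: "x i p = q" if i: "i \<in> {3..n}" for i
  proof (cases "i = 3 \<or> i = 4")
    case True then show ?thesis using p by (auto simp: q_def)
  next
    case False
    obtain u where u: "x 3 u \<noteq> u" "x 3 u = x i u" using edge[OF m3(1) i] False by auto
    obtain v where v: "x 4 v \<noteq> v" "x 4 v = x i v" using edge[OF m3(2) i] False by auto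
    obtain a b e where I: "distinct [a, b, e]" "x i = cyc3 a b e" using x3[OF i] by blast
    obtain a' b' e' where I3: "distinct [a', b', e']" "x 3 = cyc3 a' b' e'" using x3[OF m3(1)] by blast
    obtain a'' b'' e'' where I4: "distinct [a'', b'', e'']" "x 4 = cyc3 a'' b'' e''" using x3[OF m3(2)] by blast
    define r where "r = x 3 q"
    define s where "s = x 4 q"
    have qq: "x 3 p = q" "x 4 p = q" "x 3 q = r" "x 4 q = s" using p by (auto simp: q_def r_def s_def)
    have p4: "x 4 p \<noteq> p" using p by metis
    have c1: "x 3 r = p" "x 4 s = p"
      using mv(2)[OF I3 p(1) p(1)] mv(2)[OF I4 p4 p4] qq by auto
    have "x 3 \<noteq> x 4" using x_inj[OF m3] by simp
    then have rs: "r \<noteq> s"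
      using mv(4)[OF I3 p(1) p(1)] mv(4)[OF I4 p4 p4] qq by metis
    have rp: "r \<noteq> p" "s \<noteq> p" using mv(3)[OF I3 p(1) p(1)] mv(3)[OF I4 p4 p4] qq by auto
    have qp: "q \<noteq> p" using p q_def by simp
    have qr: "q \<noteq> r" "q \<noteq> s" using c1 qq qp by auto
    have ui: "x i u \<noteq> u" "x i v \<noteq> v" using u v by metis+
    have uu: "u = p \<or> u = q \<or> u = r" using mv(1)[OF I3 p(1) u(1)] qq by metis
    have vv: "v = p \<or> v = q \<or> v = s" using mv(1)[OF I4 p4 v(1)] qq by metis
    have uv: "v = u \<or> v = x i u \<or> v = x i (x i u)" using mv(1)[OF I(1,2) ui] .
    have i3: "x i (x i (x i u)) = u" using mv(2)[OF I(1,2) ui] .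
    \<comment> \<open>If \<open>x\<^sub>i\<close> does not use the edge from \<open>p\<close> to \<open>q\<close>, it shares another edge with each of \<open>(p q r)\<close> and
    \<open>(p q s)\<close>. These two edges both leave \<open>q\<close>, or both enter \<open>p\<close>, or involve four points.\<close>
    show ?thesis using uu vv uv i3 u(2) v(2) qq c1 rs rp qp qr by metis
  qed
  have qp: "q \<noteq> p" using p q_def by simp
  define s where "s i = x i q" for i
  have xs: "x i = cyc3 p q (s i)" "distinct [p, q, s i]" "{p, q, s i} \<subseteq> {1..n}" if i: "i \<in> {3..n}" for i
  proof -
    obtain a b e where I: "distinct [a, b, e]" "{a, b, e} \<subseteq> {1..n}" "x i = cyc3 a b e" using x3[OF i] by blast
    have m: "x i p \<noteq> p" using common[OF i] qp by simp
    show "x i = cyc3 p q (s i)" using mv(4)[OF I(1,3) m m] unfolding common[OF i] s_def .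
    have "s i \<noteq> p" using mv(3)[OF I(1,3) m m] common[OF i] by (simp add: s_def)
    moreover have "s i \<noteq> q"
      using mv(2)[OF I(1,3) m m] common[OF i] qp by (auto simp: s_def)
    ultimately show "distinct [p, q, s i]" using qp by auto
    have perm: "x i permutes {1..n}"
      unfolding I(3) by (rule permutes_subset[OF cycle_permutes]) (use I(2) in auto)
    then have "p \<in> {1..n}" using m permutes_not_in by metis
    then show "{p, q, s i} \<subseteq> {1..n}"
      using permutes_in_image[OF perm] common[OF i] by (auto simp: s_def simp flip: common[OF i])
  qed
  define \<sigma> where "\<sigma> i = (if i = 1 then p else if i = 2 then q else if i \<in> {3..n} then s i else i)" for i
  have \<sigma>: "\<sigma> permutes {1..n}"
  proof (rule inj_imp_permutes)
    have s_inj: "s i \<noteq> s j" if "i \<in> {3..n}" "j \<in> {3..n}" "i \<noteq> j" for i j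
      using x_inj[OF that] xs(1)[OF that(1)] xs(1)[OF that(2)] by metis
    show "inj_on \<sigma> {1..n}"
    proof (rule inj_onI)
      fix i j assume ij: "i \<in> {1..n}" "j \<in> {1..n}" "\<sigma> i = \<sigma> j"
      have "i = 1 \<or> i = 2 \<or> i \<in> {3..n}" "j = 1 \<or> j = 2 \<or> j \<in> {3..n}" using ij by auto
      then show "i = j"
        using ij(3) s_inj[of i j] xs(2)[of i] xs(2)[of j] qp by (auto simp: \<sigma>_def split: if_splits)
    qed
    show "finite {1..n}" by simp
    show "\<sigma> i \<in> {1..n}" if "i \<in> {1..n}" for i
      using xs(3)[of i] xs(3)[OF m3(1)] that by (auto simp: \<sigma>_def)
    show "\<sigma> i = i" if "i \<notin> {1..n}" for i using that n by (auto simp: \<sigma>_def)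
  qed
  note b\<sigma> = permutes_bij[OF \<sigma>]
  define E where "E = {g \<in> ?A. \<theta> g = \<sigma> \<circ> g \<circ> inv' \<sigma>}"
  have inv\<sigma>: "inv' \<sigma> \<circ> \<sigma> = id" using permutes_inv_o[OF \<sigma>] by simp
  have E_comp: "g \<circ> h \<in> E" if "g \<in> E" "h \<in> E" for g h
  proof -
    have "\<theta> (g \<circ> h) = \<sigma> \<circ> g \<circ> (inv' \<sigma> \<circ> \<sigma>) \<circ> h \<circ> inv' \<sigma>"
      using that hom(2) by (simp add: E_def comp_assoc)
    then show ?thesis using that alt_group_comp_closed inv\<sigma> by (simp add: E_def comp_assoc)
  qed
  have E_inv: "inv' g \<in> E" if "g \<in> E" for g
  proof -
    have g: "g \<in> ?A" "\<theta> g = \<sigma> \<circ> g \<circ> inv' \<sigma>" using that by (auto simp: E_def)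
    have bg: "bij g" using g(1) permutes_bij by (auto simp: alt_group_carrier)
    have "\<theta> (inv' g) = inv' (\<sigma> \<circ> g \<circ> inv' \<sigma>)" using hom(6) g by simp
    also have "\<dots> = \<sigma> \<circ> inv' g \<circ> inv' \<sigma>"
      using b\<sigma> bg by (simp add: o_inv_distrib bij_comp bij_imp_bij_inv inv_inv_eq comp_assoc)
    finally show ?thesis using alt_group_inv_closed[OF g(1)] by (simp add: E_def)
  qed
  have base: "cyc3 1 2 i \<in> E" if "i \<in> {1..n}" "i \<noteq> 1" "i \<noteq> 2" for i
  proof -
    have i: "i \<in> {3..n}" using that by auto
    have "\<sigma> \<circ> c i \<circ> inv' \<sigma> = cyc3 (\<sigma> 1) (\<sigma> 2) (\<sigma> i)"
      unfolding c_def by (rule conj_cyc3[OF d[OF i] b\<sigma>])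
    also have "\<dots> = x i" unfolding xs(1)[OF i] using i by (simp add: \<sigma>_def)
    finally show ?thesis using cA[OF i] by (simp add: E_def x_def c_def)
  qed
  have E3: "three_cycles n \<subseteq> E"
  proof
    fix y assume "y \<in> three_cycles n"
    then obtain a b e where y: "distinct [a, b, e]" "{a, b, e} \<subseteq> {1..n}" "y = cyc3 a b e"
      unfolding mem_three_cycles_iff by blast
    show "y \<in> E"
      unfolding y(3) by (rule cyc3_generate_from_pair[where S = "{1..n}" and p = 1 and q = 2])
        (use y(1,2) base E_comp E_inv in auto)
  qed
  have "g \<in> E" if "g \<in> generate (alt_group n) (three_cycles n)" for g
    using that
  proof (induction rule: generate.induct)
    case one
    have "\<theta> id = \<sigma> \<circ> id \<circ> inv' \<sigma>" using hom(5) permutes_inv_o[OF \<sigma>] by simp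
    moreover have "id \<in> ?A" unfolding alt_group_carrier by simp
    ultimately show ?case unfolding E_def alt_group_one by blast
  next
    case (incl h) then show ?case using E3 by blast
  next
    case (inv h)
    then have "h \<in> E" using E3 by blast
    then show ?case using E_inv by (simp add: E_def alt_group_inv_equality)
  next
    case (eng g h) then show ?case using E_comp unfolding alt_group_mult by blast
  qed
  then have "\<theta> g = \<sigma> \<circ> g \<circ> inv' \<sigma>" if "g \<in> ?A" for g
    using that alt_group_carrier_as_three_cycles[of n] by (auto simp: E_def)
  then show thesis using that \<sigma> by blast
qed

lemma three_cycles_conj_closed:
  assumes "t \<in> three_cycles n" "g permutes {1..n}"
  shows "g \<circ> t \<circ> inv' g \<in> three_cycles n"
proof -
  obtain a b c where t: "distinct [a, b, c]" "{a, b, c} \<subseteq> {1..n}" "t = cyc3 a b c"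
    using assms(1) unfolding mem_three_cycles_iff by blast
  have "distinct [g a, g b, g c]" using t(1) injD[OF permutes_inj[OF assms(2)]] by auto
  moreover have "{g a, g b, g c} \<subseteq> {1..n}" using t(2) permutes_in_image[OF assms(2)] by simp
  ultimately show ?thesis
    unfolding t(3) conj_cyc3[OF t(1) permutes_bij[OF assms(2)]] mem_three_cycles_iff by blast
qed

(* From here on three-cycles are evaluated by cyc3_apply, not as products of transpositions. *)
declare cycle_of_list.simps [simp del]

lemma three_cycle_order_3:
  assumes "t \<in> three_cycles n"
  shows "t \<circ> t \<circ> t = id" "t \<noteq> id"
proof -
  obtain a b c where t: "distinct [a, b, c]" "t = cyc3 a b c"
    using assms unfolding mem_three_cycles_iff by blast
  show "t \<circ> t \<circ> t = id" using t(1) by (auto simp: fun_eq_iff t(2) cyc3_apply)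
  have "t a \<noteq> a" using t(1) by (auto simp: t(2) cyc3_apply)
  then show "t \<noteq> id" by auto
qed

section \<open>Automorphisms preserve three-cycles in degree at least seven\<close>

text \<open>The product of two three-cycles has order \<open>1\<close>, \<open>2\<close>, \<open>3\<close> or \<open>5\<close>, depending on how the two triples of points meet.\<close>
lemma cyc3_comp_funpow_30:
  assumes x: "distinct [a, b, c]" and y: "distinct [d, e, f]"
  shows "(cyc3 a b c \<circ> cyc3 d e f) ^^ 30 = id"
proof -
  have *: "w ^^ 30 = id" if "w ^^ k = id" "k dvd 30" for w :: "'a \<Rightarrow> 'a" and k :: nat
  proof -
    from that(2) obtain l where "30 = k * l" by blast
    then show ?thesis using that(1) by (metis funpow_mult id_funpow)
  qed
  have common: "(cyc3 u b c \<circ> cyc3 u e f) ^^ 30 = id"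
    if d: "distinct [u, b, c]" "distinct [u, e, f]" for u b c e f :: 'a
  proof -
    define w where "w = cyc3 u b c \<circ> cyc3 u e f"
    have w: "w z = cyc3 u b c (cyc3 u e f z)" for z by (simp add: w_def)
    note ev = w cyc3_apply[OF d(1)] cyc3_apply[OF d(2)]
    consider "b \<notin> {e, f}" "c \<notin> {e, f}" | "b = e" "c = f" | "b = e" "c \<noteq> f" | "b = f" "c = e"
      | "b = f" "c \<noteq> e" | "c = e" "b \<noteq> f" | "c = f" "b \<noteq> e" by auto
    then have "w ^^ 5 = id \<or> w ^^ 3 = id \<or> w ^^ 2 = id"
    proof cases
      case 1
      have v: "w u = e" "w e = f" "w f = b" "w b = c" "w c = u"
        unfolding ev using 1 d by auto
      have "(w ^^ 5) z = z" for z
      proof (cases "z \<in> {u, b, c, e, f}")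
        case True then show ?thesis by (elim insertE emptyE; simp add: v eval_nat_numeral)
      next
        case False
        then have "w z = z" by (auto simp: ev)
        then show ?thesis by (simp add: eval_nat_numeral)
      qed
      then show ?thesis by auto
    next
      case 2
      have v: "w u = c" "w c = b" "w b = u"
        unfolding ev using 2 d by auto
      have "(w ^^ 3) z = z" for z
      proof (cases "z \<in> {u, b, c, e, f}")
        case True then show ?thesis by (elim insertE emptyE; simp add: v 2[symmetric] eval_nat_numeral)
      next
        case False
        then have "w z = z" by (auto simp: ev)
        then show ?thesis by (simp add: eval_nat_numeral)
      qed
      then show ?thesis by auto
    next
      case 3
      have v: "w u = c" "w c = u" "w b = f" "w f = b"
        unfolding ev using 3 d by auto
      have "(w ^^ 2) z = z" for z
      proof (cases "z \<in> {u, b, c, e, f}")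
        case True then show ?thesis by (elim insertE emptyE; simp add: v 3(1)[symmetric] eval_nat_numeral)
      next
        case False
        then have "w z = z" by (auto simp: ev)
        then show ?thesis by (simp add: eval_nat_numeral)
      qed
      then show ?thesis by auto
    next
      case 4
      have v: "w u = u" "w b = b" "w c = c"
        unfolding ev using 4 d by auto
      have "(w ^^ 2) z = z" for z
      proof (cases "z \<in> {u, b, c, e, f}")
        case True then show ?thesis by (elim insertE emptyE; simp add: v 4[symmetric] eval_nat_numeral)
      next
        case False
        then have "w z = z" by (auto simp: ev)
        then show ?thesis by (simp add: eval_nat_numeral)
      qed
      then show ?thesis by auto
    next
      case 5
      have v: "w u = e" "w e = c" "w c = u" "w b = b"
        unfolding ev using 5 d by auto
      have "(w ^^ 3) z = z" for z
      proof (cases "z \<in> {u, b, c, e, f}")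
        case True then show ?thesis by (elim insertE emptyE; simp add: v 5(1)[symmetric] eval_nat_numeral)
      next
        case False
        then have "w z = z" by (auto simp: ev)
        then show ?thesis by (simp add: eval_nat_numeral)
      qed
      then show ?thesis by auto
    next
      case 6
      have v: "w u = u" "w c = f" "w f = b" "w b = c"
        unfolding ev using 6 d by auto
      have "(w ^^ 3) z = z" for z
      proof (cases "z \<in> {u, b, c, e, f}")
        case True then show ?thesis by (elim insertE emptyE; simp add: v 6(1)[symmetric] eval_nat_numeral)
      next
        case False
        then have "w z = z" by (auto simp: ev)
        then show ?thesis by (simp add: eval_nat_numeral)
      qed
      then show ?thesis by auto
    next
      case 7
      have v: "w u = e" "w e = u" "w c = b" "w b = c"
        unfolding ev using 7 d by auto
      have "(w ^^ 2) z = z" for z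
      proof (cases "z \<in> {u, b, c, e, f}")
        case True then show ?thesis by (elim insertE emptyE; simp add: v 7(1)[symmetric] eval_nat_numeral)
      next
        case False
        then have "w z = z" by (auto simp: ev)
        then show ?thesis by (simp add: eval_nat_numeral)
      qed
      then show ?thesis by auto
    qed
    then show ?thesis using *[of 5 w] *[of 3 w] *[of 2 w] unfolding w_def by auto
  qed
  have rx: "distinct [b, c, a]" "distinct [c, a, b]" and ry: "distinct [e, f, d]" "distinct [f, d, e]"
    using x y by auto
  note X = cyc3_rotate[OF x] cyc3_rotate[OF rx(1)]
  note Y = cyc3_rotate[OF y] cyc3_rotate[OF ry(1)]
  show ?thesis
  proof (cases "{a, b, c} \<inter> {d, e, f} = {}")
    case True
    define w where "w = cyc3 a b c \<circ> cyc3 d e f"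
    have w: "w z = cyc3 a b c (cyc3 d e f z)" for z by (simp add: w_def)
    note ev = w cyc3_apply[OF x] cyc3_apply[OF y]
    have v: "w a = b" "w b = c" "w c = a" "w d = e" "w e = f" "w f = d"
      unfolding ev using True x y by auto
    have "(w ^^ 3) z = z" for z
    proof (cases "z \<in> {a, b, c, d, e, f}")
      case True then show ?thesis by (elim insertE emptyE; simp add: v eval_nat_numeral)
    next
      case False
      then have "w z = z" by (auto simp: ev)
      then show ?thesis by (simp add: eval_nat_numeral)
    qed
    then have "w ^^ 3 = id" by auto
    then show ?thesis using *[of 3 w] by (simp add: w_def)
  next
    case False
    then obtain u where u: "u = a \<or> u = b \<or> u = c" "u = d \<or> u = e \<or> u = f" by blast
    have "\<exists>b' c'. cyc3 a b c = cyc3 u b' c' \<and> distinct [u, b', c']" using u(1) X x rx by metis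
    moreover have "\<exists>e' f'. cyc3 d e f = cyc3 u e' f' \<and> distinct [u, e', f']" using u(2) Y y ry by metis
    ultimately show ?thesis using common by metis
  qed
qed

lemma order_3_orbit:
  assumes "x \<circ> x \<circ> x = id" "x a \<noteq> a"
  shows "distinct [a, x a, x (x a)]" "x (x (x a)) = a"
proof -
  have x3: "x (x (x z)) = z" for z using fun_cong[OF assms(1), of z] by simp
  show "x (x (x a)) = a" by (rule x3)
  have "x (x a) \<noteq> a" using x3[of a] assms(2) by auto
  moreover have "x (x a) \<noteq> x a" using x3[of a] assms(2) by metis
  ultimately show "distinct [a, x a, x (x a)]" using assms(2) by auto
qed

lemma order_3_cases:
  assumes perm: "x permutes {1..n}" and x3: "x \<circ> x \<circ> x = id" and ne: "x \<noteq> id"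
  obtains (three_cycle) "x \<in> three_cycles n"
  | (two_orbits) a d where "distinct [a, x a, x (x a), d, x d, x (x d)]"
proof -
  obtain a where a: "x a \<noteq> a" using ne by (metis eq_id_iff)
  note A = order_3_orbit[OF x3 a]
  have inj: "inj x" using perm by (rule permutes_inj)
  show thesis
  proof (cases "\<exists>d. x d \<noteq> d \<and> d \<notin> {a, x a, x (x a)}")
    case True
    then obtain d where d: "x d \<noteq> d" "d \<notin> {a, x a, x (x a)}" by blast
    have out: "x z \<notin> {a, x a, x (x a)}" if "z \<notin> {a, x a, x (x a)}" for z
      using three_cycle_outside[OF inj refl refl A(2) that] .
    have "x d \<notin> {a, x a, x (x a)}" "x (x d) \<notin> {a, x a, x (x a)}"
      using out[OF d(2)] out[OF out[OF d(2)]] .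
    then have "distinct [a, x a, x (x a), d, x d, x (x d)]"
      using A(1) order_3_orbit(1)[OF x3 d(1)] d(2) by auto
    then show thesis by (rule two_orbits)
  next
    case False
    have "x = cyc3 a (x a) (x (x a))"
    proof
      fix z
      show "x z = cyc3 a (x a) (x (x a)) z"
        unfolding cyc3_apply[OF A(1)] using False A(2) by (cases "z \<in> {a, x a, x (x a)}") auto
    qed
    moreover have "a \<in> {1..n}" using a permutes_not_in[OF perm] by blast
    then have "{a, x a, x (x a)} \<subseteq> {1..n}" using permutes_in_image[OF perm] by auto
    ultimately have "x \<in> three_cycles n" using A(1) unfolding mem_three_cycles_iff by blast
    then show thesis by (rule three_cycle)
  qed
qed

text \<open>Write \<open>x = (a\<^sub>0 a\<^sub>1 a\<^sub>2) (a\<^sub>3 a\<^sub>4 a\<^sub>5) \<dots>\<close>, choose a further point \<open>a\<^sub>6\<close> and let \<open>g = (a\<^sub>0 a\<^sub>3) (a\<^sub>1 a\<^sub>6)\<close>. If \<open>a\<^sub>6\<close> is fixed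
  by \<open>x\<close>, then the product contains the seven-cycle \<open>(a\<^sub>0 a\<^sub>5 a\<^sub>1 a\<^sub>2 a\<^sub>4 a\<^sub>3 a\<^sub>6)\<close>. If \<open>a\<^sub>6\<close> lies on a third cycle
  \<open>(a\<^sub>6 a\<^sub>7 a\<^sub>8)\<close>, it contains the nine-cycle \<open>(a\<^sub>0 a\<^sub>5 a\<^sub>1 a\<^sub>8 a\<^sub>2 a\<^sub>4 a\<^sub>3 a\<^sub>7 a\<^sub>6)\<close>. Neither length divides \<open>30\<close>.\<close>
lemma order_3_conj_product_not_funpow_30:
  assumes perm: "x permutes {1..n}" and x3: "x \<circ> x \<circ> x = id" and n: "n \<ge> 7"
    and d: "distinct [a, x a, x (x a), d, x d, x (x d)]"
  obtains g where "g \<in> carrier (alt_group n)" "(x \<circ> (g \<circ> x \<circ> inv' g)) ^^ 30 \<noteq> id"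
proof -
  define a0 a1 a2 a3 a4 a5 where "a0 = a" "a1 = x a" "a2 = x (x a)" "a3 = d" "a4 = x d" "a5 = x (x d)"
  note defs = this
  have D: "distinct [a0, a1, a2, a3, a4, a5]" using d by (simp only: defs)
  have xa: "x a0 = a1" "x a1 = a2" "x a2 = a0" "x a3 = a4" "x a4 = a5" "x a5 = a3"
    using fun_cong[OF x3, of a] fun_cong[OF x3, of d] by (simp_all add: defs)
  have inj: "inj x" using perm by (rule permutes_inj)
  have "length [a0, a1, a2, a3, a4, a5] < card {1..n}" using n by simp
  then obtain a6 where a6: "a6 \<in> {1..n}" "a6 \<notin> set [a0, a1, a2, a3, a4, a5]"
    using exists_notin_list by blast
  have out: "x z \<notin> set [a0, a1, a2, a3, a4, a5]" if "z \<notin> set [a0, a1, a2, a3, a4, a5]" for z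
    using that three_cycle_outside[OF inj xa(1-3), of z] three_cycle_outside[OF inj xa(4-6), of z] by auto
  define g where "g = transpose a0 a3 \<circ> transpose a1 a6"
  have "x a0 \<noteq> a0" "x a1 \<noteq> a1" "x a3 \<noteq> a3" using D xa by auto
  then have mem: "a0 \<in> {1..n}" "a1 \<in> {1..n}" "a3 \<in> {1..n}"
    using permutes_not_in[OF perm] by blast+
  have gA: "g \<in> carrier (alt_group n)"
    unfolding alt_group_carrier g_def using D a6 mem
    by (intro conjI permutes_compose permutes_swap_id evenperm_transpose_transpose) auto
  have D6: "distinct [a0, a1, a2, a3, a4, a5, a6]" using D a6 by auto
  have g: "g z = (if z = a0 then a3 else if z = a3 then a0 else if z = a1 then a6 else if z = a6 then a1 else z)" for z
    using D6 by (auto simp: g_def transpose_def)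
  have "inv' g = g" by (rule inv_unique_comp) (use D6 in \<open>auto simp: fun_eq_iff g\<close>)
  define w where "w = x \<circ> (g \<circ> x \<circ> inv' g)"
  have w: "w z = x (g (x (g z)))" for z by (simp add: w_def \<open>inv' g = g\<close>)
  have gv: "g a0 = a3" "g a1 = a6" "g a2 = a2" "g a3 = a0" "g a4 = a4" "g a5 = a5" "g a6 = a1"
    unfolding g using D6 by auto
  have w1: "w a0 = a5" "w a5 = a1" by (simp_all only: w gv xa)
  have "(w ^^ 30) a0 \<noteq> a0"
  proof (cases "x a6 = a6")
    case True
    have "w a1 = a2" "w a2 = a4" "w a4 = a3" "w a3 = a6" "w a6 = a0"
      by (simp_all only: w gv xa True)
    then have "(w ^^ 30) a0 = a1" using w1 by (simp add: eval_nat_numeral)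
    then show ?thesis using D6 by auto
  next
    case False
    define a7 a8 where "a7 = x a6" "a8 = x (x a6)"
    have x6: "x a6 = a7" "x a7 = a8" "x a8 = a6" and D': "distinct [a6, a7, a8]"
      using order_3_orbit[OF x3 False] by (auto simp: a7_a8_def)
    have "a7 \<notin> set [a0, a1, a2, a3, a4, a5]" "a8 \<notin> set [a0, a1, a2, a3, a4, a5]"
      using out[OF a6(2)] out[OF out[OF a6(2)]] by (simp_all add: a7_a8_def)
    then have D8: "distinct [a0, a1, a2, a3, a4, a5, a6, a7, a8]" using D D' a6 by auto
    have "g a7 = a7" "g a8 = a8" unfolding g using D8 by auto
    then have "w a1 = a8" "w a8 = a2" "w a2 = a4" "w a4 = a3" "w a3 = a7" "w a7 = a6" "w a6 = a0"
      by (simp_all only: w gv xa x6)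
    then have "(w ^^ 30) a0 = a8" using w1 by (simp add: eval_nat_numeral)
    then show ?thesis using D8 by auto
  qed
  then have "w ^^ 30 \<noteq> id" by auto
  then show thesis using that gA unfolding w_def by blast
qed

lemma auto_alt_group_conj_product_funpow:
  assumes \<theta>: "\<theta> \<in> auto (alt_group n)" and x: "x \<in> carrier (alt_group n)"
    and pow: "\<And>g. g \<in> carrier (alt_group n) \<Longrightarrow> (x \<circ> (g \<circ> x \<circ> inv' g)) ^^ k = id"
    and g: "g \<in> carrier (alt_group n)"
  shows "(\<theta> x \<circ> (g \<circ> \<theta> x \<circ> inv' g)) ^^ k = id"
proof -
  note hom = auto_alt_groupD[OF \<theta>]
  obtain h where h: "h \<in> carrier (alt_group n)" "g = \<theta> h" using g hom(4) by blast
  define w where "w = x \<circ> (h \<circ> x \<circ> inv' h)"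
  have wA: "w \<in> carrier (alt_group n)"
    unfolding w_def using h x alt_group_comp_closed alt_group_inv_closed by metis
  have "\<theta> w = \<theta> x \<circ> (g \<circ> \<theta> x \<circ> inv' g)"
    unfolding w_def h(2) using h x alt_group_comp_closed alt_group_inv_closed by (simp add: hom)
  then show ?thesis
    using auto_alt_group_funpow(1)[OF \<theta> wA, of k] pow[OF h(1)] hom(5) unfolding w_def[symmetric] by metis
qed

lemma auto_alt_group_three_cycles:
  assumes n: "n \<ge> 7" and \<theta>: "\<theta> \<in> auto (alt_group n)" and x: "x \<in> three_cycles n"
  shows "\<theta> x \<in> three_cycles n"
proof -
  let ?A = "carrier (alt_group n)"
  note hom = auto_alt_groupD[OF \<theta>]
  obtain a b c where abc: "distinct [a, b, c]" "{a, b, c} \<subseteq> {1..n}" "x = cyc3 a b c"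
    using x unfolding mem_three_cycles_iff by blast
  have xA: "x \<in> ?A" using x three_cycles_incl by blast
  have \<theta>3: "\<theta> x \<circ> \<theta> x \<circ> \<theta> x = id" and \<theta>ne: "\<theta> x \<noteq> id"
    using auto_alt_group_order_3_iff[OF \<theta> xA] three_cycle_order_3[OF x] by metis+
  have \<theta>perm: "\<theta> x permutes {1..n}" using hom(1)[OF xA] by (simp add: alt_group_carrier)
  have "(x \<circ> (g \<circ> x \<circ> inv' g)) ^^ 30 = id" if "g \<in> ?A" for g
  proof -
    have bg: "bij g" using that permutes_bij by (auto simp: alt_group_carrier)
    have "distinct [g a, g b, g c]" using abc(1) bij_is_inj[OF bg] by (auto dest: injD)
    then show ?thesis unfolding abc(3) conj_cyc3[OF abc(1) bg] by (rule cyc3_comp_funpow_30[OF abc(1)])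
  qed
  then have "(\<theta> x \<circ> (g \<circ> \<theta> x \<circ> inv' g)) ^^ 30 = id" if "g \<in> ?A" for g
    using auto_alt_group_conj_product_funpow[OF \<theta> xA _ that] by blast
  then show ?thesis
    using order_3_cases[OF \<theta>perm \<theta>3 \<theta>ne] order_3_conj_product_not_funpow_30[OF \<theta>perm \<theta>3 n] by metis
qed

section \<open>The exceptional automorphisms in degree six\<close>

text \<open>A permutation that is correct on \<open>us\<close> is corrected at one more point \<open>u\<close> by composing it with a
  transposition; this does not disturb the values on \<open>us\<close>.\<close>
lemma exists_permutation_map_list:
  assumes "length us = length vs" "distinct us" "distinct vs" "set us \<subseteq> S" "set vs \<subseteq> S"
  shows "\<exists>p. p permutes S \<and> map p us = vs"
  using assms
proof (induction us vs rule: list_induct2)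
  case Nil
  then show ?case using permutes_id[of S] by (metis list.map(1))
next
  case (Cons u us v vs)
  then obtain p where p: "p permutes S" "map p us = vs" by auto
  have "transpose (p u) v \<circ> p permutes S"
    using p(1) Cons.prems permutes_in_image[OF p(1)] by (intro permutes_compose permutes_swap_id) auto
  moreover have "transpose (p u) v (p w) = p w" if "w \<in> set us" for w
  proof -
    have "p w \<in> set vs" using p(2) that by auto
    moreover have "p w \<noteq> p u"
      using injD[OF permutes_inj[OF p(1)], of w u] that Cons.prems by auto
    ultimately show ?thesis using Cons.prems by (auto simp: transpose_def)
  qed
  then have "map (transpose (p u) v \<circ> p) us = map p us" by (intro map_cong) auto
  moreover have "map (transpose (p u) v \<circ> p) (u # us) = v # map (transpose (p u) v \<circ> p) us" by simp
  ultimately show ?case using p(2) by metis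
qed

text \<open>An odd conjugating permutation is made even by a transposition of two points that the target cycle fixes.\<close>
lemma three_cycles_conj_in_alt_group:
  assumes n: "n \<ge> 5" and x: "x \<in> three_cycles n" and y: "y \<in> three_cycles n"
  obtains (conj) g where "g \<in> carrier (alt_group n)" "y = g \<circ> x \<circ> inv' g"
proof -
  obtain a b c where a: "distinct [a, b, c]" "{a, b, c} \<subseteq> {1..n}" "x = cyc3 a b c"
    using x unfolding mem_three_cycles_iff by blast
  obtain a' b' c' where a': "distinct [a', b', c']" "{a', b', c'} \<subseteq> {1..n}" "y = cyc3 a' b' c'"
    using y unfolding mem_three_cycles_iff by blast
  obtain p where p: "p permutes {1..n}" "p a = a'" "p b = b'" "p c = c'"
    using exists_permutation_map_list[of "[a, b, c]" "[a', b', c']" "{1..n}"] a a' by auto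
  have new: "\<exists>d\<in>{1..n}. d \<notin> set xs" if "length xs \<le> 4" for xs
    using that exists_notin_list[of xs "{1..n}"] n by simp
  obtain d where d: "d \<in> {1..n}" "d \<notin> {a', b', c'}" using new[of "[a', b', c']"] by auto
  obtain e where e: "e \<in> {1..n}" "e \<notin> {a', b', c', d}" using new[of "[a', b', c', d]"] by auto
  have go: thesis if g: "g permutes {1..n}" "evenperm g" "g a = a'" "g b = b'" "g c = c'" for g
  proof (rule conj)
    show "g \<in> carrier (alt_group n)" using g by (simp add: alt_group_carrier)
    show "y = g \<circ> x \<circ> inv' g" unfolding a(3) a'(3) conj_cyc3[OF a(1) permutes_bij[OF g(1)]] g(3-5) ..
  qed
  show thesis
  proof (cases "evenperm p")
    case True then show ?thesis using go p by blast
  next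
    case False
    have "permutation p" using p(1) by (auto simp: permutation_permutes)
    then have "evenperm (transpose d e \<circ> p)"
      using False e by (auto simp: evenperm_comp permutation_swap_id evenperm_swap)
    moreover have "transpose d e \<circ> p permutes {1..n}"
      using p(1) d e by (intro permutes_compose permutes_swap_id) auto
    ultimately show ?thesis using p d e by (intro go[of "transpose d e \<circ> p"]) (auto simp: transpose_def)
  qed
qed

lemma six_points:
  assumes "distinct [a, b, c, d, e, f]" "set [a, b, c, d, e, f] \<subseteq> {1..6::nat}"
  shows "{1..6} = {a, b, c, d, e, f}"
proof -
  have "card (set [a, b, c, d, e, f]) = card {1..6::nat}" using distinct_card[OF assms(1)] by simp
  then show ?thesis using card_subset_eq[OF _ assms(2)] by simp
qed

lemma triple_transposition_apply:
  assumes "distinct [a, b, c, d, e, f]" "s = transpose a d \<circ> transpose b e \<circ> transpose c f"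
  shows "s a = d" "s d = a" "s b = e" "s e = b" "s c = f" "s f = c"
    "\<And>z. z \<notin> {a, b, c, d, e, f} \<Longrightarrow> s z = z" "\<not> evenperm s"
  using assms(1) unfolding assms(2)
  by (auto simp: transpose_def evenperm_comp permutation_compose permutation_swap_id evenperm_swap)

text \<open>An odd conjugating permutation is made even by the triple transposition that exchanges the two cycles of
  \<open>y\<close> and commutes with \<open>y\<close>.\<close>
lemma double_three_cycles_conj_in_alt_group_6:
  assumes x: "x permutes {1..6}" "x \<circ> x \<circ> x = id" and y: "y permutes {1..6}" "y \<circ> y \<circ> y = id"
    and dx: "distinct [a, x a, x (x a), d, x d, x (x d)]"
    and dy: "distinct [u, y u, y (y u), v, y v, y (y v)]"
  obtains (conj) g where "g \<in> carrier (alt_group 6)" "y = g \<circ> x \<circ> inv' g"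
proof -
  have mem: "set [a, x a, x (x a), d, x d, x (x d)] \<subseteq> {1..6}"
    if "x permutes {1..6::nat}" "distinct [a, x a, x (x a), d, x d, x (x d)]" for x a d
  proof -
    have "a \<in> {1..6}" "d \<in> {1..6}" using permutes_not_in[OF that(1)] that(2) by fastforce+
    then show ?thesis using permutes_in_image[OF that(1)] by simp
  qed
  note mx = mem[OF x(1) dx] and my = mem[OF y(1) dy]
  obtain p where p: "p permutes {1..6}"
    "map p [a, x a, x (x a), d, x d, x (x d)] = [u, y u, y (y u), v, y v, y (y v)]"
    using exists_permutation_map_list[OF _ dx dy mx my] by auto
  have x3: "x (x (x z)) = z" for z using fun_cong[OF x(2), of z] by simp
  have y3: "y (y (y z)) = z" for z using fun_cong[OF y(2), of z] by simp
  have px: "p (x z) = y (p z)" for z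
  proof (cases "z \<in> {1..6}")
    case True
    then have "z \<in> {a, x a, x (x a), d, x d, x (x d)}" using six_points[OF dx mx] by blast
    then show ?thesis using p(2) by (elim insertE emptyE) (simp_all add: x3 y3)
  next
    case False
    then show ?thesis using permutes_not_in[OF x(1)] permutes_not_in[OF y(1)] permutes_not_in[OF p(1)] by simp
  qed
  define s where "s = transpose u v \<circ> transpose (y u) (y v) \<circ> transpose (y (y u)) (y (y v))"
  note s = triple_transposition_apply[OF dy s_def]
  have sy: "s (y z) = y (s z)" for z
  proof (cases "z \<in> {1..6}")
    case True
    then have "z \<in> {u, y u, y (y u), v, y v, y (y v)}" using six_points[OF dy my] by blast
    then show ?thesis by (elim insertE emptyE; simp only: s(1-6) y3)
  next
    case False
    then have "z \<notin> {u, y u, y (y u), v, y v, y (y v)}" using six_points[OF dy my] by blast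
    then have "s z = z" by (rule s(7))
    then show ?thesis using permutes_not_in[OF y(1) False] by simp
  qed
  have sperm: "s permutes {1..6}"
    unfolding s_def using my by (intro permutes_compose permutes_swap_id) auto
  have go: thesis if g: "g permutes {1..6}" "evenperm g" "\<And>z. g (x z) = y (g z)" for g
  proof (rule conj)
    show "g \<in> carrier (alt_group 6)" using g by (simp add: alt_group_carrier)
    show "y = g \<circ> x \<circ> inv' g" using g(3) permutes_inverses(1)[OF g(1)] by (auto simp: fun_eq_iff)
  qed
  show thesis
  proof (cases "evenperm p")
    case True then show ?thesis using go p(1) px by blast
  next
    case False
    have "permutation p" "permutation s" using p(1) sperm by (auto simp: permutation_permutes)
    then have "evenperm (s \<circ> p)" using False s(8) by (simp add: evenperm_comp)
    then show ?thesis using permutes_compose[OF p(1) sperm] px sy by (intro go[of "s \<circ> p"]) auto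
  qed
qed

lemma alt_group_central_eq_id:
  assumes n: "n \<ge> 4" and c: "c permutes {1..n}"
    and comm: "\<And>y. y \<in> carrier (alt_group n) \<Longrightarrow> c \<circ> y = y \<circ> c"
  shows "c = id"
proof (rule ccontr)
  assume "c \<noteq> id"
  then obtain a where a: "c a \<noteq> a" by (metis eq_id_iff)
  then have mem: "a \<in> {1..n}" "c a \<in> {1..n}" using permutes_not_in[OF c] permutes_in_image[OF c] by blast+
  have new: "\<exists>d\<in>{1..n}. d \<notin> set xs" if "length xs \<le> 3" for xs
    using that exists_notin_list[of xs "{1..n}"] n by simp
  obtain e where e: "e \<in> {1..n}" "e \<notin> {a, c a}" using new[of "[a, c a]"] by auto
  obtain f where f: "f \<in> {1..n}" "f \<notin> {a, c a, e}" using new[of "[a, c a, e]"] by auto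
  have d: "distinct [a, e, f]" using e f by auto
  have "cyc3 a e f \<in> carrier (alt_group n)" using cyc3_in_alt_group[OF d] mem e f by auto
  then have "c (cyc3 a e f a) = cyc3 a e f (c a)" using fun_cong[OF comm, of _ a] by simp
  then have "c e = c a" using a e f by (auto simp: cyc3_apply[OF d] split: if_splits)
  then show False using injD[OF permutes_inj[OF c]] e by blast
qed

lemma order_5_orbit_6:
  assumes x: "x permutes {1..6::nat}" and x5: "x ^^ 5 = id" and ne: "x \<noteq> id"
  obtains a f where "distinct [a, x a, x (x a), x (x (x a)), x (x (x (x a))), f]"
    "{1..6} = {a, x a, x (x a), x (x (x a)), x (x (x (x a))), f}" "x f = f"
    "x (x (x (x (x a)))) = a"
proof -
  obtain a where a: "x a \<noteq> a" using ne by (metis eq_id_iff)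
  have perm: "permutation x" using x by (auto simp: permutation_permutes)
  have dvd: "least_power x a dvd 5" using least_power_minimal[of 5 x a] x5 by simp
  then have "least_power x a \<le> 5" by (simp add: dvd_imp_le)
  then have "least_power x a \<in> {1, 2, 3, 4, 5}"
    using least_power_of_permutation(2)[OF perm, of a] by auto
  then have "least_power x a = 1 \<or> least_power x a = 5" using dvd by auto
  moreover have "least_power x a \<noteq> 1" using least_power_of_permutation(1)[OF perm, of a] a by auto
  ultimately have l: "least_power x a = 5" by simp
  have "support x a = [a, x a, x (x a), x (x (x a)), x (x (x (x a)))]"
    by (simp add: l upt_rec eval_nat_numeral)
  then have d: "distinct [a, x a, x (x a), x (x (x a)), x (x (x (x a)))]"
    using cycle_of_permutation[OF perm, of a] by simp
  have x5a: "x (x (x (x (x a)))) = a" using fun_cong[OF x5, of a] by (simp add: eval_nat_numeral)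
  have "a \<in> {1..6}" using a permutes_not_in[OF x] by blast
  then have m: "set [a, x a, x (x a), x (x (x a)), x (x (x (x a)))] \<subseteq> {1..6}"
    using permutes_in_image[OF x] by simp
  have "length [a, x a, x (x a), x (x (x a)), x (x (x (x a)))] < card {1..6::nat}" by simp
  then obtain f where f: "f \<in> {1..6}" "f \<notin> set [a, x a, x (x a), x (x (x a)), x (x (x (x a)))]"
    using exists_notin_list by blast
  have D: "distinct [a, x a, x (x a), x (x (x a)), x (x (x (x a))), f]" using d f by auto
  have S: "{1..6} = {a, x a, x (x a), x (x (x a)), x (x (x (x a))), f}"
    using six_points[OF D] m f by auto
  have "x f \<in> {1..6}" using f(1) permutes_in_image[OF x] by simp
  moreover have "x f \<noteq> x z" if "z \<in> set [a, x a, x (x a), x (x (x a)), x (x (x (x a)))]" for z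
    using f(2) that injD[OF permutes_inj[OF x], of f z] by auto
  then have "x f \<noteq> x a" "x f \<noteq> x (x a)" "x f \<noteq> x (x (x a))" "x f \<noteq> x (x (x (x a)))"
    "x f \<noteq> x (x (x (x (x a))))" by simp_all
  then have "x f \<notin> {a, x a, x (x a), x (x (x a)), x (x (x (x a)))}" unfolding x5a by simp
  ultimately have "x f = f" unfolding S by blast
  then show thesis using that D S x5a by blast
qed

text \<open>An involution in \<open>A\<^sub>6\<close> has exactly two two-cycles: one or three of them would be an odd permutation.\<close>
lemma even_involution_6:
  assumes z: "z permutes {1..6::nat}" "evenperm z" and z2: "z \<circ> z = id" and ne: "z \<noteq> id"
  obtains a b c d e f where "distinct [a, b, c, d, e, f]" "{1..6} = {a, b, c, d, e, f}"
    "z a = b" "z b = a" "z c = d" "z d = c" "z e = e" "z f = f"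
proof -
  have zz: "z (z w) = w" for w using fun_cong[OF z2, of w] by simp
  have inj: "inj z" using z(1) by (rule permutes_inj)
  have Z: "w \<in> {1..6}" if "z w \<noteq> w" for w using permutes_not_in[OF z(1)] that by blast
  obtain a where a: "z a \<noteq> a" using ne by (metis eq_id_iff)
  define b where "b = z a"
  have b: "z a = b" "z b = a" "a \<noteq> b" using a zz by (auto simp: b_def)
  have "\<exists>c. z c \<noteq> c \<and> c \<notin> {a, b}"
  proof (rule ccontr)
    assume "\<not> ?thesis"
    then have "z = transpose a b" using b by (auto simp: fun_eq_iff transpose_def)
    then show False using z(2) b by (simp add: evenperm_swap)
  qed
  then obtain c where c: "z c \<noteq> c" "c \<notin> {a, b}" by blast
  define d where "d = z c"
  have d: "z c = d" "z d = c" "c \<noteq> d" using c zz by (auto simp: d_def)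
  have "d \<noteq> a" "d \<noteq> b" using b(1,2) c(2) d(2) by auto
  then have D4: "distinct [a, b, c, d]" using b(3) c(2) d(3) by auto
  have z4: "z w = w" if w: "w \<notin> {a, b, c, d}" for w
  proof (rule ccontr)
    assume wn: "z w \<noteq> w"
    define v where "v = z w"
    have v: "z w = v" "z v = w" "v \<noteq> w" using wn zz by (auto simp: v_def)
    have "v \<notin> {a, b, c, d}" using v(2) b(1,2) d(1,2) w by auto
    then have D6: "distinct [a, b, c, d, v, w]" using D4 w v(3) by auto
    have "set [a, b, c, d, v, w] \<subseteq> {1..6}"
      using Z[of a] Z[of b] Z[of c] Z[of d] Z[of v] Z[of w] b d v by auto
    then have S: "{1..6} = {a, b, c, d, v, w}" using six_points[OF D6] by blast
    have "z = transpose a b \<circ> transpose c d \<circ> transpose v w"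
    proof
      fix u
      show "z u = (transpose a b \<circ> transpose c d \<circ> transpose v w) u"
      proof (cases "u \<in> {1..6}")
        case True
        then show ?thesis unfolding S using D6 b d v by (auto simp: transpose_def)
      next
        case False
        then have "u \<notin> {a, b, c, d, v, w}" using S by blast
        then show ?thesis using permutes_not_in[OF z(1) False] by (auto simp: transpose_def)
      qed
    qed
    then show False
      using z(2) D6 by (auto simp: evenperm_comp permutation_compose permutation_swap_id evenperm_swap)
  qed
  have new: "\<exists>d\<in>{1..6::nat}. d \<notin> set xs" if "length xs \<le> 5" for xs
    using that exists_notin_list[of xs "{1..6::nat}"] by simp
  obtain e where e: "e \<in> {1..6}" "e \<notin> {a, b, c, d}" using new[of "[a, b, c, d]"] by auto
  obtain f where f: "f \<in> {1..6}" "f \<notin> {a, b, c, d, e}" using new[of "[a, b, c, d, e]"] by auto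
  have D6: "distinct [a, b, c, d, e, f]" using D4 e f by auto
  have "set [a, b, c, d, e, f] \<subseteq> {1..6}"
    using Z[of a] Z[of b] Z[of c] Z[of d] b d e f by auto
  then have "{1..6} = {a, b, c, d, e, f}" using six_points[OF D6] by blast
  then show thesis using that D6 b d z4 e f by blast
qed

lemma isolated_alt_group_fixes_of_conj_fixed:
  assumes \<theta>: "\<theta> \<in> auto (alt_group n)" and iso: "isolated (alt_group n) \<theta>"
    and z: "z \<in> carrier (alt_group n)" "\<theta> z = z"
    and cent: "\<And>y. y \<in> carrier (alt_group n) \<Longrightarrow> y \<circ> z = z \<circ> y \<Longrightarrow> \<theta> y = y"
    and g: "g \<in> carrier (alt_group n)" and conj: "\<theta> (g \<circ> z \<circ> inv' g) = g \<circ> z \<circ> inv' g"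
  shows "\<theta> g = g"
proof (rule group.isolated_fixes_of_conj_fixed[OF alt_group_is_group \<theta> iso, of z])
  show "z \<in> Fix (alt_group n) \<theta>" using z by (simp add: Fix_def)
  have "g \<circ> z \<circ> inv' g \<in> carrier (alt_group n)"
    using z(1) g alt_group_comp_closed alt_group_inv_closed by metis
  then show "g \<otimes>\<^bsub>alt_group n\<^esub> z \<otimes>\<^bsub>alt_group n\<^esub> inv\<^bsub>alt_group n\<^esub> g \<in> Fix (alt_group n) \<theta>"
    using conj unfolding alt_group_mult alt_group_inv_equality[OF g] Fix_def by blast
qed (use g cent in \<open>simp_all only: alt_group_mult\<close>)

text \<open>Here \<open>r\<close> is a five-cycle, and its centralizer in \<open>A\<^sub>6\<close> consists of its powers, which are fixed by \<open>\<theta>\<close>.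
  The even involution \<open>g\<close> inverts \<open>r\<close>, so it conjugates \<open>r\<close> to a fixed element and is itself fixed. Then \<open>\<rho>\<close>
  commutes with \<open>g\<close>; but \<open>\<rho>\<close> is a power of \<open>r\<close>, and the only power of \<open>r\<close> that commutes with \<open>g\<close> is \<open>1\<close>.\<close>
lemma isolated_alt_group_6_order_5:
  assumes \<theta>: "\<theta> \<in> auto (alt_group 6)" and iso: "isolated (alt_group 6) \<theta>"
    and \<rho>: "\<rho> \<in> carrier (alt_group 6)" and inner: "\<And>x. x \<in> carrier (alt_group 6) \<Longrightarrow> (\<theta> ^^ k) x = \<rho> \<circ> x \<circ> inv' \<rho>"
    and r: "r \<in> carrier (alt_group 6)" "\<theta> r = r" "r ^^ 5 = id" "r \<noteq> id" and comm: "\<rho> \<circ> r = r \<circ> \<rho>"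
  shows "\<rho> = id"
proof -
  let ?A = "carrier (alt_group 6)"
  have rp: "r permutes {1..6}" using r(1) by (simp add: alt_group_carrier)
  obtain a f where D: "distinct [a, r a, r (r a), r (r (r a)), r (r (r (r a))), f]"
    and S: "{1..6} = {a, r a, r (r a), r (r (r a)), r (r (r (r a))), f}" and rf: "r f = f"
    and r5: "r (r (r (r (r a)))) = a"
    using order_5_orbit_6[OF rp r(3,4)] by blast
  have cent: "y f = f" "\<exists>i. y a = (r ^^ i) a" "\<And>i. y a = (r ^^ i) a \<Longrightarrow> y = r ^^ i"
    if y: "y \<in> ?A" and yr: "y \<circ> r = r \<circ> y" for y
  proof -
    have yp: "y permutes {1..6}" using y by (simp add: alt_group_carrier)
    have yrz: "y (r z) = r (y z)" for z using fun_cong[OF yr, of z] by simp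
    have "f \<in> {1..6}" "a \<in> {1..6}" using S by auto
    then have in6: "y f \<in> {1..6}" "y a \<in> {1..6}" using permutes_in_image[OF yp] by auto
    have "r (y f) = y f" using yrz[of f] rf by simp
    moreover have "r w \<noteq> w" if "w \<in> {a, r a, r (r a), r (r (r a)), r (r (r (r a)))}" for w
      using that D r5 by auto
    ultimately show yf: "y f = f" using in6(1) unfolding S by blast
    have "y a \<noteq> f" using injD[OF permutes_inj[OF yp], of a f] yf D by auto
    then have "y a \<in> {(r ^^ 0) a, (r ^^ 1) a, (r ^^ 2) a, (r ^^ 3) a, (r ^^ 4) a}"
      using in6(2) unfolding S by (simp add: eval_nat_numeral)
    then show "\<exists>i. y a = (r ^^ i) a" by blast
    fix i assume i: "y a = (r ^^ i) a"
    have step: "y (r z) = (r ^^ i) (r z)" if "y z = (r ^^ i) z" for z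
      using that yrz[of z] by (simp add: funpow_swap1)
    have fi: "(r ^^ i) f = f" using rf by (induction i) auto
    show "y = r ^^ i"
    proof
      fix z show "y z = (r ^^ i) z"
      proof (cases "z \<in> {1..6}")
        case True
        then show ?thesis
          using i step[OF i] step[OF step[OF i]] step[OF step[OF step[OF i]]]
            step[OF step[OF step[OF step[OF i]]]] yf fi unfolding S by auto
      next
        case False
        then show ?thesis using permutes_not_in[OF yp] permutes_not_in[OF permutes_funpow[OF rp]] by simp
      qed
    qed
  qed
  have fixpow: "\<theta> (r ^^ i) = r ^^ i" for i using auto_alt_group_funpow(1)[OF \<theta> r(1)] r(2) by simp
  have centF: "\<theta> y = y" if "y \<in> ?A" "y \<circ> r = r \<circ> y" for y
    using cent(2,3)[OF that] fixpow by metis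
  define a1 a2 a3 a4 where "a1 = r a" "a2 = r (r a)" "a3 = r (r (r a))" "a4 = r (r (r (r a)))"
  note defs = this
  have D': "distinct [a, a1, a2, a3, a4, f]" and S': "{1..6} = {a, a1, a2, a3, a4, f}"
    using D S by (simp_all only: defs)
  have ra: "r a = a1" "r a1 = a2" "r a2 = a3" "r a3 = a4" "r a4 = a" using r5 by (simp_all add: defs)
  define g where "g = transpose a1 a4 \<circ> transpose a2 a3"
  have mem: "{a, a1, a2, a3, a4, f} \<subseteq> {1..6}" using S' by simp
  have gA: "g \<in> ?A"
    unfolding alt_group_carrier g_def using D' mem
    by (intro conjI permutes_compose permutes_swap_id evenperm_transpose_transpose) auto
  have gp: "g permutes {1..6}" using gA by (simp add: alt_group_carrier)
  have gv: "g a = a" "g a1 = a4" "g a2 = a3" "g a3 = a2" "g a4 = a1" "g f = f"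
    using D' by (auto simp: g_def transpose_def)
  have go: "g z = z" if "z \<notin> {1..6}" for z using permutes_not_in[OF gp that] .
  have gg: "g \<circ> g = id"
  proof
    fix z show "(g \<circ> g) z = id z"
    proof (cases "z \<in> {1..6}")
      case True
      then have "z \<in> {a, a1, a2, a3, a4, f}" using S' by blast
      then show ?thesis by (elim insertE emptyE) (simp_all add: gv)
    qed (simp add: go)
  qed
  then have ginv: "inv' g = g" by (rule inv_unique_comp) (rule gg)
  have "g \<circ> r \<circ> inv' g = r ^^ 4"
  proof
    fix z
    show "(g \<circ> r \<circ> inv' g) z = (r ^^ 4) z"
    proof (cases "z \<in> {1..6}")
      case True
      then have "z \<in> {a, a1, a2, a3, a4, f}" using S' by blast
      then show ?thesis
        unfolding ginv by (elim insertE emptyE) (simp_all add: gv ra rf eval_nat_numeral)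
    next
      case False
      then show ?thesis using go permutes_not_in[OF rp] permutes_not_in[OF permutes_funpow[OF rp]] ginv by simp
    qed
  qed
  then have "\<theta> g = g"
    using isolated_alt_group_fixes_of_conj_fixed[OF \<theta> iso r(1,2) centF gA] fixpow by simp
  then have "(\<theta> ^^ k) g = g" by (induction k) auto
  then have "\<rho> \<circ> g \<circ> inv' \<rho> = g" using inner[OF gA] by simp
  moreover have \<rho>p: "\<rho> permutes {1..6}" using \<rho> by (simp add: alt_group_carrier)
  ultimately have \<rho>g: "\<rho> (g z) = g (\<rho> z)" for z
    using permutes_inverses(2)[OF \<rho>p] by (metis comp_apply)
  have "g (\<rho> a) = \<rho> a" using \<rho>g[of a] gv by simp
  moreover have "\<rho> a \<in> {1..6}" using permutes_in_image[OF \<rho>p] mem by simp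
  moreover have "\<rho> a \<noteq> f"
    using injD[OF permutes_inj[OF \<rho>p], of a f] cent(1)[OF \<rho> comm] D' by auto
  ultimately have "\<rho> a = a" unfolding S' using gv D' by auto
  then show "\<rho> = id" using cent(3)[OF \<rho> comm, of 0] by simp
qed

text \<open>Since \<open>Fix \<theta>\<close> has odd index, it contains an involution \<open>z = (a b) (c d)\<close>. The centralizer \<open>K\<close> of \<open>z\<close> is a
  \<open>2\<close>-group invariant under \<open>\<theta>\<close>, and \<open>K \<inter> Fix \<theta>\<close> has odd index in \<open>K\<close>, so that \<open>\<theta>\<close> fixes all of \<open>K\<close>. The
  three-cycle \<open>g = (b c d)\<close> conjugates \<open>z\<close> to \<open>(a c) (b d)\<close>, which lies in \<open>K\<close>; hence \<open>g\<close> is fixed as well.\<close>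
lemma isolated_alt_group_6_2_power:
  assumes \<theta>: "\<theta> \<in> auto (alt_group 6)" and iso: "isolated (alt_group 6) \<theta>"
    and ord: "\<And>x. x \<in> carrier (alt_group 6) \<Longrightarrow> (\<theta> ^^ (2 ^ k)) x = x"
  obtains g where "g \<in> three_cycles 6" "\<theta> g = g"
proof -
  let ?G = "alt_group 6"
  let ?A = "carrier ?G"
  interpret G: group ?G by (rule alt_group_is_group)
  note hom = auto_alt_groupD[OF \<theta>]
  have \<theta>h: "\<theta> \<in> hom ?G ?G" using \<theta> by (simp add: auto_def)
  have fin: "finite ?A" by (rule finite_alt_group)
  have "2 * order ?G = fact 6" using alt_group_card_carrier[of 6] by (simp add: order_def)
  then have o: "order ?G = 360" by (simp add: fact_numeral)
  let ?F = "Fix ?G \<theta>"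
  have F: "subgroup ?F ?G" by (rule G.subgroup_Fix[OF \<theta>])
  interpret F: group "?G\<lparr>carrier := ?F\<rparr>" by (rule G.subgroup_imp_group[OF F])
  have FA: "?F \<subseteq> ?A" by (auto simp: Fix_def)
  obtain m where m: "odd m" "order ?G = m * card ?F"
    using G.isolated_2_power_index_odd[OF fin \<theta>h iso ord] by blast
  have "even (m * card ?F)" unfolding m(2)[symmetric] o by simp
  then have "2 dvd order (?G\<lparr>carrier := ?F\<rparr>)" using m(1) by (simp add: order_def)
  then obtain z where "z \<in> ?F" "z \<noteq> id" "z \<circ> z = id"
    using F.cauchy_prime_order[OF _ two_is_prime_nat] finite_subset[OF FA fin]
    by (auto simp: numeral_2_eq_2 alt_group_one alt_group_mult)
  then have z: "z \<in> ?A" "\<theta> z = z" "z \<noteq> id" "z \<circ> z = id" by (auto simp: Fix_def)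
  then have zp: "z permutes {1..6}" "evenperm z" by (simp_all add: alt_group_carrier)
  obtain a b c d e f where D: "distinct [a, b, c, d, e, f]" and S: "{1..6} = {a, b, c, d, e, f}"
    and zv: "z a = b" "z b = a" "z c = d" "z d = c" "z e = e" "z f = f"
    using even_involution_6[OF zp z(4,3)] by blast
  define K where "K = {y \<in> ?A. y \<circ> z = z \<circ> y}"
  have K: "subgroup K ?G"
    using G.subgroup_centralizer[OF z(1)] unfolding K_def alt_group_mult .
  let ?K = "?G\<lparr>carrier := K\<rparr>"
  interpret K: group ?K by (rule G.subgroup_imp_group[OF K])
  have finK: "finite K" using fin by (simp add: K_def)
  have \<theta>K: "\<theta> y \<in> K" if "y \<in> K" for y
  proof -
    have y: "y \<in> ?A" "y \<circ> z = z \<circ> y" using that by (auto simp: K_def)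
    then have "\<theta> y \<circ> z = z \<circ> \<theta> y" using hom(2)[OF y(1) z(1)] hom(2)[OF z(1) y(1)] z(2) by simp
    then show ?thesis using y hom(1) by (simp add: K_def)
  qed
  have y4: "y ^^ 4 = id" if y: "y \<in> K" for y
  proof
    have yp: "y permutes {1..6}" and comm: "y \<circ> z = z \<circ> y"
      using y by (auto simp: K_def alt_group_carrier)
    have yz: "y (z w) = z (y w)" for w using fun_cong[OF comm, of w] by simp
    have zz: "z (z w) = w" for w using fun_cong[OF z(4), of w] by simp
    have inj: "inj y" using permutes_inj[OF yp] .
    fix w
    have M: "y w \<in> {a, b, c, d}" if "w \<in> {a, b, c, d}" for w
    proof -
      have "z w \<noteq> w" using that zv D by auto
      then have "z (y w) \<noteq> y w" using yz injD[OF inj] by metis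
      moreover have "y w \<in> {1..6}" using permutes_in_image[OF yp, of w] that unfolding S by auto
      ultimately show ?thesis unfolding S using zv by auto
    qed
    have M': "y w \<in> {e, f}" if "w \<in> {e, f}" for w
    proof -
      have "z w = w" using that zv by auto
      then have "z (y w) = y w" using yz by metis
      moreover have "y w \<in> {1..6}" using permutes_in_image[OF yp, of w] that unfolding S by auto
      ultimately show ?thesis unfolding S using zv D by auto
    qed
    have "y (y (y (y w))) = w"
    proof (cases "w \<in> {1..6}")
      case False then show ?thesis using permutes_not_in[OF yp] by simp
    next
      case True
      then consider "w \<in> {e, f}" | "w \<in> {a, b, c, d}" unfolding S by blast
      then show ?thesis
      proof cases
        case 1
        then have "y (y w) = w" using M'[of e] M'[of f] injD[OF inj, of e f] D by auto
        then show ?thesis by simp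
      next
        case 2
        \<comment> \<open>Three points among the two pairs \<open>{a, b}\<close> and \<open>{c, d}\<close>: two of them lie in the same pair.\<close>
        have pig: "p = q \<or> p = z q \<or> q = s \<or> q = z s \<or> p = s \<or> p = z s"
          if "p \<in> {a, b, c, d}" "q \<in> {a, b, c, d}" "s \<in> {a, b, c, d}" for p q s
          using that zv by auto
        have "y w = w \<or> y w = z w \<or> y (y w) = w \<or> y (y w) = z w"
          using pig[OF 2 M[OF 2] M[OF M[OF 2]]] yz zz injD[OF inj] by metis
        then show ?thesis using yz zz by metis
      qed
    qed
    then show "(y ^^ 4) w = id w" by (simp add: eval_nat_numeral)
  qed
  have isoK: "isolated ?K \<theta>"
    unfolding isolated_def
  proof (intro ballI impI)
    fix y assume y: "y \<in> carrier ?K" and h: "inv\<^bsub>?K\<^esub> y \<otimes>\<^bsub>?K\<^esub> \<theta> y \<in> Fix ?K \<theta>"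
    then have "inv\<^bsub>?G\<^esub> y \<otimes>\<^bsub>?G\<^esub> \<theta> y \<in> ?F"
      using G.m_inv_consistent[OF K, of y] subgroup.subset[OF K] by (auto simp: Fix_def)
    then show "\<theta> y = y" using iso y unfolding isolated_def by (simp add: K_def)
  qed
  have "\<theta> \<in> hom ?K ?K" using \<theta>K hom(2) by (auto simp: hom_def K_def alt_group_mult)
  then obtain l where l: "odd l" "order ?K = l * card (Fix ?K \<theta>)"
    using K.isolated_2_power_index_odd[OF _ _ isoK, of k] finK ord by (auto simp: K_def)
  \<comment> \<open>Every element of \<open>K\<close> has order dividing four, so by Cauchy's theorem no odd prime divides the
    order of \<open>K\<close>.\<close>
  have "l = 1"
  proof (rule ccontr)
    assume "l \<noteq> 1"
    then obtain p where p: "Factorial_Ring.prime p" "p dvd l" using prime_factor_nat by blast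
    then have "p dvd order ?K" using l(2) by simp
    then obtain x where x: "x \<in> K" "x \<noteq> id" "x [^]\<^bsub>?K\<^esub> p = id"
      using K.cauchy_prime_order[OF _ p(1)] finK by (auto simp: alt_group_one)
    have "x ^^ p = id" using x(3) by (simp add: G.nat_pow_consistent[symmetric] alt_group_pow)
    moreover have "coprime 4 p"
    proof -
      have "odd p" using p(2) l(1) by (meson dvd_trans)
      then have "coprime 2 p" by simp
      then have "coprime (2 * 2) p" by (simp only: coprime_mult_left_iff)
      then show ?thesis by simp
    qed
    ultimately have "G.ord x dvd 1"
      using y4[OF x(1)] G.pow_eq_id[of x p] G.pow_eq_id[of x 4] x(1)
      by (metis (no_types, lifting) K_def alt_group_one alt_group_pow coprime_def mem_Collect_eq)
    then show False using G.ord_eq_1[of x] x by (simp add: K_def alt_group_one)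
  qed
  then have "card (Fix ?K \<theta>) = card K" using l(2) by (simp add: order_def)
  moreover have "Fix ?K \<theta> \<subseteq> K" by (auto simp: Fix_def)
  ultimately have "Fix ?K \<theta> = K" using card_subset_eq[OF finK] by blast
  then have cent: "\<theta> y = y" if "y \<in> ?A" "y \<circ> z = z \<circ> y" for y
    using that by (auto simp: Fix_def K_def)
  define g where "g = cyc3 b c d"
  have Dg: "distinct [b, c, d]" using D by auto
  have g3: "g \<in> three_cycles 6"
    unfolding mem_three_cycles_iff g_def using Dg S by (intro exI[of _ b] exI[of _ c] exI[of _ d]) auto
  have gA: "g \<in> ?A" using g3 three_cycles_incl by blast
  have gv: "g a = a" "g b = c" "g c = d" "g d = b" "g e = e" "g f = f"
    unfolding g_def cyc3_apply[OF Dg] using D by auto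
  have gp: "g permutes {1..6}" using gA by (simp add: alt_group_carrier)
  define y where "y = g \<circ> z \<circ> inv' g"
  have yA: "y \<in> ?A" unfolding y_def using gA z(1) alt_group_comp_closed alt_group_inv_closed by metis
  have yg: "y (g w) = g (z w)" for w using permutes_inverses(2)[OF gp] by (simp add: y_def)
  have yv: "y a = c" "y c = a" "y d = b" "y b = d" "y e = e" "y f = f"
    using yg[of a] yg[of b] yg[of c] yg[of d] yg[of e] yg[of f] by (simp_all only: gv zv)
  have "y \<circ> z = z \<circ> y"
  proof
    fix w
    show "(y \<circ> z) w = (z \<circ> y) w"
    proof (cases "w \<in> {1..6}")
      case True
      then have "w \<in> {a, b, c, d, e, f}" using S by blast
      then show ?thesis by (elim insertE emptyE) (simp_all add: yv zv)
    next
      case False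
      have "y permutes {1..6}" using yA by (simp add: alt_group_carrier)
      then show ?thesis using False permutes_not_in[OF zp(1)] permutes_not_in[of y] by simp
    qed
  qed
  then have "\<theta> y = y" using cent yA by blast
  then have "\<theta> g = g"
    using isolated_alt_group_fixes_of_conj_fixed[OF \<theta> iso z(1,2) cent gA] unfolding y_def by blast
  then show thesis using that g3 by blast
qed

text \<open>In \<open>A\<^sub>6\<close> the elements of order three form two conjugacy classes, the three-cycles and the products of two
  disjoint three-cycles, and \<open>\<theta>\<close> permutes the conjugacy classes.\<close>
lemma auto_alt_group_6_swaps_order_3_classes:
  assumes \<theta>: "\<theta> \<in> auto (alt_group 6)" and x: "x \<in> three_cycles 6" "\<theta> x \<notin> three_cycles 6"
    and y: "y \<in> carrier (alt_group 6)" "y \<circ> y \<circ> y = id" "y \<noteq> id"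
  shows "\<theta> y \<in> three_cycles 6 \<longleftrightarrow> y \<notin> three_cycles 6"
proof -
  let ?A = "carrier (alt_group 6)" and ?T = "three_cycles 6"
  note hom = auto_alt_groupD[OF \<theta>]
  have perm: "g permutes {1..6}" if "g \<in> ?A" for g using that by (simp add: alt_group_carrier)
  have xA: "x \<in> ?A" using x(1) three_cycles_incl by blast
  have to_double: "\<theta> t \<notin> ?T" if t: "t \<in> ?T" for t
  proof
    assume \<theta>t: "\<theta> t \<in> ?T"
    have "(5::nat) \<le> 6" by simp
    then obtain g where g: "g \<in> ?A" "x = g \<circ> t \<circ> inv' g"
      by (rule three_cycles_conj_in_alt_group[OF _ t x(1)])
    have "\<theta> x = \<theta> g \<circ> \<theta> t \<circ> inv' (\<theta> g)"
      using auto_alt_group_conj[OF \<theta> g(1)] t three_cycles_incl unfolding g(2) by blast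
    then show False using three_cycles_conj_closed[OF \<theta>t perm[OF hom(1)[OF g(1)]]] x(2) by simp
  qed
  moreover have "\<theta> y \<in> ?T" if yT: "y \<notin> ?T"
  proof -
    have "x \<in> \<theta> ` ?A" using xA hom(4) by (simp only:)
    then obtain u where u: "u \<in> ?A" "\<theta> u = x" by (elim imageE) simp
    have u3: "u \<circ> u \<circ> u = id" "u \<noteq> id"
      using auto_alt_group_order_3_iff[OF \<theta> u(1)] three_cycle_order_3[OF x(1)] unfolding u(2) by metis+
    have "u \<notin> ?T" using to_double u(2) x(1) by blast
    then obtain a d where ad: "distinct [a, u a, u (u a), d, u d, u (u d)]"
      using order_3_cases[OF perm[OF u(1)] u3] by metis
    obtain b e where be: "distinct [b, y b, y (y b), e, y e, y (y e)]"
      using order_3_cases[OF perm[OF y(1)] y(2,3)] yT by metis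
    obtain g where g: "g \<in> ?A" "y = g \<circ> u \<circ> inv' g"
      by (rule double_three_cycles_conj_in_alt_group_6[OF perm[OF u(1)] u3(1) perm[OF y(1)] y(2) ad be])
    have "\<theta> y = \<theta> g \<circ> x \<circ> inv' (\<theta> g)"
      unfolding g(2) using auto_alt_group_conj[OF \<theta> g(1) u(1)] u(2) by simp
    then show ?thesis using three_cycles_conj_closed[OF x(1) perm[OF hom(1)[OF g(1)]]] by simp
  qed
  ultimately show ?thesis by blast
qed

text \<open>An automorphism that does not preserve the three-cycles interchanges the two classes of elements of order
  three. The lemma excludes this by an analysis of the element \<open>\<rho>\<close> that induces \<open>\<theta>\<^sup>4\<close>.\<close>
lemma isolated_alt_group_6_three_cycles:
  assumes \<theta>: "\<theta> \<in> auto (alt_group 6)" and iso: "isolated (alt_group 6) \<theta>" and x: "x \<in> three_cycles 6"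
  shows "\<theta> x \<in> three_cycles 6"
proof (rule ccontr)
  assume \<theta>x: "\<theta> x \<notin> three_cycles 6"
  let ?A = "carrier (alt_group 6)" and ?T = "three_cycles 6"
  interpret G: group "alt_group 6" by (rule alt_group_is_group)
  note hom = auto_alt_groupD[OF \<theta>]
  note swap = auto_alt_group_6_swaps_order_3_classes[where \<theta> = \<theta> and x = x, OF \<theta> x \<theta>x]
  define \<kappa> where "\<kappa> = compose ?A \<theta> \<theta>"
  have \<kappa>: "\<kappa> \<in> auto (alt_group 6)" unfolding \<kappa>_def by (rule G.compose_auto[OF \<theta>])
  have \<kappa>_apply: "\<kappa> y = \<theta> (\<theta> y)" if "y \<in> ?A" for y using that by (simp add: \<kappa>_def compose_def)
  have "\<kappa> t \<in> ?T" if t: "t \<in> ?T" for t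
  proof -
    have tA: "t \<in> ?A" using t three_cycles_incl by blast
    note t3 = three_cycle_order_3[OF t]
    have "\<theta> t \<notin> ?T" using swap[OF tA t3] t by blast
    then have "\<theta> (\<theta> t) \<in> ?T"
      using swap[OF hom(1)[OF tA]] auto_alt_group_order_3_iff[OF \<theta> tA] t3 by blast
    then show ?thesis using \<kappa>_apply[OF tA] by simp
  qed
  then obtain \<tau> where \<tau>: "\<tau> permutes {1..6}" and \<kappa>\<tau>: "\<And>y. y \<in> ?A \<Longrightarrow> \<kappa> y = \<tau> \<circ> y \<circ> inv' \<tau>"
    using auto_preserving_three_cycles_is_conj[OF _ \<kappa>] by auto
  define \<rho> where "\<rho> = \<tau> \<circ> \<tau>"
  have b\<tau>: "bij \<tau>" using permutes_bij[OF \<tau>] .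
  have p\<tau>: "permutation \<tau>" using \<tau> by (auto simp: permutation_permutes)
  have \<rho>A: "\<rho> \<in> ?A"
    unfolding alt_group_carrier \<rho>_def using permutes_compose[OF \<tau> \<tau>] evenperm_comp[OF p\<tau> p\<tau>] by simp
  have \<rho>p: "\<rho> permutes {1..6}" using \<rho>A by (simp add: alt_group_carrier)
  have \<theta>4: "(\<theta> ^^ 4) y = \<rho> \<circ> y \<circ> inv' \<rho>" if y: "y \<in> ?A" for y
  proof -
    have "(\<theta> ^^ 4) y = \<kappa> (\<kappa> y)" using y hom(1) by (simp add: \<kappa>_apply eval_nat_numeral)
    moreover have "\<kappa> y \<in> ?A" using auto_alt_groupD(1)[OF \<kappa> y] .
    ultimately have "(\<theta> ^^ 4) y = \<tau> \<circ> (\<tau> \<circ> y \<circ> inv' \<tau>) \<circ> inv' \<tau>" using \<kappa>\<tau> y by metis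
    then show ?thesis unfolding \<rho>_def o_inv_distrib[OF b\<tau> b\<tau>] by (simp only: comp_assoc)
  qed
  have \<theta>\<rho>: "\<theta> \<rho> = \<rho>"
  proof -
    define c where "c = inv' \<rho> \<circ> \<theta> \<rho>"
    have \<theta>\<rho>p: "\<theta> \<rho> permutes {1..6}" using hom(1)[OF \<rho>A] by (simp add: alt_group_carrier)
    \<comment> \<open>Since \<open>\<theta>\<close> commutes with \<open>\<theta>\<^sup>4\<close>, conjugation by \<open>\<theta>(\<rho>)\<close> and by \<open>\<rho>\<close> agree on \<open>A\<^sub>6\<close>, whose center is
      trivial.\<close>
    have "c = id"
    proof (rule alt_group_central_eq_id)
      show "c permutes {1..6}" unfolding c_def using permutes_inv[OF \<rho>p] \<theta>\<rho>p permutes_compose by blast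
      fix y assume "y \<in> ?A"
      then have "y \<in> \<theta> ` ?A" using hom(4) by (simp only:)
      then obtain u where u: "u \<in> ?A" "y = \<theta> u" by (elim imageE)
      have "\<theta> ((\<theta> ^^ 4) u) = (\<theta> ^^ 4) (\<theta> u)" by (simp add: funpow_swap1)
      then have "\<theta> \<rho> \<circ> y \<circ> inv' (\<theta> \<rho>) = \<rho> \<circ> y \<circ> inv' \<rho>"
        using \<theta>4[OF u(1)] \<theta>4[OF hom(1)[OF u(1)]] auto_alt_group_conj[OF \<theta> \<rho>A u(1)] u(2) by simp
      then have eq: "\<theta> \<rho> (y (inv' (\<theta> \<rho>) z)) = \<rho> (y (inv' \<rho> z))" for z by (metis comp_apply)
      show "c \<circ> y = y \<circ> c"
      proof
        fix z
        show "(c \<circ> y) z = (y \<circ> c) z"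
          using eq[of "\<theta> \<rho> z"] permutes_inverses[OF \<rho>p] permutes_inverses[OF \<theta>\<rho>p] by (simp add: c_def)
      qed
    qed simp
    then have "inv' \<rho> (\<theta> \<rho> z) = z" for z unfolding c_def by (metis comp_apply id_apply)
    then have "\<theta> \<rho> z = \<rho> z" for z using permutes_inverses(1)[OF \<rho>p] by metis
    then show ?thesis by auto
  qed
  have fin: "finite ?A" by (rule finite_alt_group)
  have "2 * order (alt_group 6) = fact 6" using alt_group_card_carrier[of 6] by (simp add: order_def)
  then have "order (alt_group 6) = 360" by (simp add: fact_numeral)
  then have ord_dvd: "G.ord \<rho> dvd 360" using G.ord_dvd_group_order[OF \<rho>A] by simp
  \<comment> \<open>Powers of \<open>\<rho>\<close> are fixed by \<open>\<theta>\<close>; this provides fixed elements of every prime order dividing that of \<open>\<rho>\<close>.\<close>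
  have root: "\<exists>r. r \<in> ?A \<and> \<theta> r = r \<and> r ^^ p = id \<and> r \<noteq> id \<and> \<rho> \<circ> r = r \<circ> \<rho>"
    if p: "p dvd G.ord \<rho>" "p > 1" for p
  proof -
    define r where "r = \<rho> ^^ (G.ord \<rho> div p)"
    have o0: "G.ord \<rho> > 0" using G.ord_ge_1[OF fin \<rho>A] by simp
    have "r ^^ p = \<rho> ^^ G.ord \<rho>" unfolding r_def funpow_mult using p(1) by simp
    also have "\<dots> = id" using G.pow_ord_eq_1[OF \<rho>A] by (simp add: alt_group_pow alt_group_one)
    finally have "r ^^ p = id" .
    moreover have "r \<noteq> id"
    proof
      assume "r = id"
      then have "G.ord \<rho> dvd G.ord \<rho> div p"
        unfolding r_def using G.pow_eq_id[OF \<rho>A] by (simp add: alt_group_pow alt_group_one)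
      moreover have "G.ord \<rho> div p < G.ord \<rho>" "G.ord \<rho> div p > 0"
        using p o0 by (auto simp: div_greater_zero_iff dvd_imp_le)
      ultimately show False using nat_dvd_not_less by blast
    qed
    moreover have "\<theta> r = r" "r \<in> ?A"
      using auto_alt_group_funpow[OF \<theta> \<rho>A] \<theta>\<rho> by (auto simp: r_def)
    moreover have "\<rho> \<circ> r = r \<circ> \<rho>" unfolding r_def by (simp add: funpow_swap1 fun_eq_iff)
    ultimately show ?thesis by blast
  qed
  have no3: False if "\<theta> r = r" "r \<in> ?A" "r \<circ> r \<circ> r = id" "r \<noteq> id" for r
    using swap[OF that(2-4)] unfolding that(1) by blast
  have "\<not> 3 dvd G.ord \<rho>"
  proof
    assume "3 dvd G.ord \<rho>"
    then obtain r where r: "r \<in> ?A" "\<theta> r = r" "r ^^ 3 = id" "r \<noteq> id" using root[of 3] by auto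
    have "r ^^ 3 = r \<circ> r \<circ> r" by (simp add: eval_nat_numeral comp_assoc)
    then show False using no3[OF r(2,1) _ r(4)] r(3) by metis
  qed
  moreover have "\<not> 5 dvd G.ord \<rho>"
  proof
    assume 5: "5 dvd G.ord \<rho>"
    then obtain r where r: "r \<in> ?A" "\<theta> r = r" "r ^^ 5 = id" "r \<noteq> id" "\<rho> \<circ> r = r \<circ> \<rho>"
      using root[of 5] by auto
    have "\<rho> = id" by (rule isolated_alt_group_6_order_5[OF \<theta> iso \<rho>A \<theta>4 r])
    then have "G.ord \<rho> = 1" using G.ord_eq_1[OF \<rho>A] by (simp add: alt_group_one)
    then show False using 5 by simp
  qed
  ultimately have "coprime 3 (G.ord \<rho>)" "coprime 5 (G.ord \<rho>)"
    by (simp_all add: prime_imp_coprime)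
  then have "coprime (3 * 3 * 5) (G.ord \<rho>)" by (simp only: coprime_mult_left_iff)
  then have "coprime (G.ord \<rho>) 45" by (simp add: coprime_commute)
  then have "G.ord \<rho> dvd 8"
    using ord_dvd coprime_dvd_mult_left_iff[of "G.ord \<rho>" 45 8] by simp
  then have \<rho>8: "\<rho> ^^ 8 = id" using G.pow_eq_id[OF \<rho>A] by (simp add: alt_group_pow alt_group_one)
  \<comment> \<open>The order of \<open>\<rho>\<close> divides eight, hence \<open>\<theta>\<close> has order dividing \<open>32\<close>.\<close>
  have pow: "((\<theta> ^^ 4) ^^ m) y = (\<rho> ^^ m) \<circ> y \<circ> inv' (\<rho> ^^ m) \<and> ((\<theta> ^^ 4) ^^ m) y \<in> ?A"
    if y: "y \<in> ?A" for y m
  proof (induction m)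
    case 0 then show ?case using y by simp
  next
    case (Suc m)
    have b: "bij \<rho>" "bij (\<rho> ^^ m)" using permutes_bij[OF \<rho>p] permutes_bij[OF permutes_funpow[OF \<rho>p]] .
    define u where "u = ((\<theta> ^^ 4) ^^ m) y"
    have u: "u = (\<rho> ^^ m) \<circ> y \<circ> inv' (\<rho> ^^ m)" "u \<in> ?A" using Suc by (auto simp: u_def)
    have e: "((\<theta> ^^ 4) ^^ Suc m) y = \<rho> \<circ> u \<circ> inv' \<rho>" using \<theta>4[OF u(2)] by (simp add: u_def)
    have "\<rho> \<circ> u \<circ> inv' \<rho> = (\<rho> ^^ Suc m) \<circ> y \<circ> inv' (\<rho> ^^ Suc m)"
      unfolding funpow.simps(2) o_inv_distrib[OF b] u(1) by (simp only: comp_assoc)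
    moreover have "\<rho> \<circ> u \<circ> inv' \<rho> \<in> ?A" using u(2) \<rho>A alt_group_comp_closed alt_group_inv_closed by metis
    ultimately show ?case unfolding e by blast
  qed
  have "(\<theta> ^^ (2 ^ 5)) y = y" if "y \<in> ?A" for y
    using pow[OF that, of 8] unfolding \<rho>8 funpow_mult by simp
  then obtain g where g: "g \<in> ?T" "\<theta> g = g" using isolated_alt_group_6_2_power[OF \<theta> iso] by blast
  then show False using no3 three_cycles_incl three_cycle_order_3[OF g(1)] by blast
qed

section \<open>Isolated automorphisms of alternating groups are trivial\<close>

text \<open>For \<open>\<theta>\<close> the conjugation by \<open>\<sigma>\<close>, an even \<open>y\<close> that moves \<open>\<sigma>\<close> to a commuting permutation \<open>\<tau> \<noteq> \<sigma>\<close> violates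
  isolation at \<open>g = y\<^sup>-\<^sup>1\<close>, because \<open>g\<^sup>-\<^sup>1 \<theta>(g) = \<tau> \<sigma>\<^sup>-\<^sup>1\<close>.\<close>
lemma isolated_alt_group_eq_identity:
  assumes n: "n > 5" and \<theta>: "\<theta> \<in> auto (alt_group n)" and iso: "isolated (alt_group n) \<theta>"
    and x: "x \<in> carrier (alt_group n)"
  shows "\<theta> x = x"
proof -
  let ?A = "carrier (alt_group n)"
  have "\<theta> t \<in> three_cycles n" if "t \<in> three_cycles n" for t
  proof (cases "n = 6")
    case True
    then show ?thesis using isolated_alt_group_6_three_cycles \<theta> iso that by blast
  next
    case False
    then show ?thesis using auto_alt_group_three_cycles[OF _ \<theta> that] n by simp
  qed
  then obtain \<sigma> where \<sigma>: "\<sigma> permutes {1..n}" and \<theta>\<sigma>: "\<And>x. x \<in> ?A \<Longrightarrow> \<theta> x = \<sigma> \<circ> x \<circ> inv' \<sigma>"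
    using auto_preserving_three_cycles_is_conj[OF _ \<theta>] n by auto
  have "\<sigma> = id"
  proof (rule ccontr)
    assume "\<sigma> \<noteq> id"
    then obtain y where y: "y permutes {1..n}" "evenperm y" "moves_to_commuting y \<sigma>"
      using exists_moves_to_commuting[OF \<sigma>] n by auto
    then obtain \<tau> where \<tau>: "y \<circ> \<sigma> = \<tau> \<circ> y" "\<tau> \<noteq> \<sigma>" "\<tau> \<circ> \<sigma> = \<sigma> \<circ> \<tau>"
      unfolding moves_to_commuting_def by blast
    have yA: "y \<in> ?A" using y by (simp add: alt_group_carrier)
    define g where "g = inv' y"
    have gA: "g \<in> ?A" unfolding g_def by (rule alt_group_inv_closed[OF yA])
    have invg: "inv' g = y" unfolding g_def by (rule permutes_inv_inv[OF y(1)])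
    define h where "h = inv' g \<circ> \<theta> g"
    have hA: "h \<in> ?A"
      unfolding h_def using alt_group_comp_closed alt_group_inv_closed[OF gA] auto_alt_groupD(1)[OF \<theta> gA] by blast
    have "h = (y \<circ> \<sigma>) \<circ> inv' y \<circ> inv' \<sigma>"
      unfolding h_def invg \<theta>\<sigma>[OF gA] unfolding g_def by (simp only: comp_assoc)
    also have "\<dots> = \<tau> \<circ> (y \<circ> inv' y) \<circ> inv' \<sigma>" unfolding \<tau>(1) by (simp only: comp_assoc)
    finally have h: "h = \<tau> \<circ> inv' \<sigma>" using permutes_inv_o(1)[OF y(1)] by simp
    have "\<theta> h = (\<sigma> \<circ> \<tau>) \<circ> inv' \<sigma> \<circ> inv' \<sigma>" unfolding \<theta>\<sigma>[OF hA] unfolding h by (simp only: comp_assoc)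
    also have "\<dots> = \<tau> \<circ> (\<sigma> \<circ> inv' \<sigma>) \<circ> inv' \<sigma>" unfolding \<tau>(3)[symmetric] by (simp only: comp_assoc)
    finally have "\<theta> h = h" unfolding h using permutes_inv_o(1)[OF \<sigma>] by simp
    then have "inv\<^bsub>alt_group n\<^esub> g \<otimes>\<^bsub>alt_group n\<^esub> \<theta> g \<in> Fix (alt_group n) \<theta>"
      using hA unfolding alt_group_inv_equality[OF gA] alt_group_mult Fix_def h_def by blast
    then have "\<theta> g = g" using iso gA unfolding isolated_def by blast
    then have "\<tau> \<circ> inv' \<sigma> = id" using h invg permutes_inv_o(1)[OF y(1)] by (simp add: h_def g_def)
    then have "\<tau> \<circ> (inv' \<sigma> \<circ> \<sigma>) = \<sigma>" by (simp only: comp_assoc[symmetric] id_comp)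
    then show False using \<tau>(2) permutes_inv_o(2)[OF \<sigma>] by simp
  qed
  then show ?thesis using \<theta>\<sigma>[OF x] by simp
qed

text \<open>The order of the group is \<open>n!/2\<close>. It has the same prime divisors as \<open>n!\<close>, since \<open>4\<close> divides \<open>n!\<close>.\<close>
lemma alt_group_torsion_free_iff_coprime:
  fixes n t :: nat
  assumes n: "n \<ge> 4"
  shows "(\<forall>h\<in>carrier (alt_group n). h [^]\<^bsub>alt_group n\<^esub> t = \<one>\<^bsub>alt_group n\<^esub> \<longrightarrow> h = \<one>\<^bsub>alt_group n\<^esub>)
    \<longleftrightarrow> coprime t (fact n)"
proof -
  let ?G = "alt_group n"
  interpret G: group ?G by (rule alt_group_is_group)
  have fin: "finite (carrier ?G)" by (rule finite_alt_group)
  have o: "2 * order ?G = fact n" using alt_group_card_carrier[of n] n by (simp add: order_def)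
  show ?thesis
  proof
    assume T: "\<forall>h\<in>carrier ?G. h [^]\<^bsub>?G\<^esub> t = \<one>\<^bsub>?G\<^esub> \<longrightarrow> h = \<one>\<^bsub>?G\<^esub>"
    show "coprime t (fact n)"
    proof (rule ccontr)
      assume "\<not> coprime t (fact n)"
      then obtain p where p: "Factorial_Ring.prime p" "p dvd t" "p dvd fact n"
        by (metis coprime_iff_gcd_eq_1 gcd_nat.bounded_iff prime_factor_nat)
      have "p dvd order ?G"
      proof (cases "p = 2")
        case True
        have "(fact 4 :: nat) dvd fact n" using n by (rule fact_dvd)
        then have "2 * 2 dvd 2 * order ?G" unfolding o by (simp add: fact_numeral dvd_trans[of 4 24])
        then show ?thesis unfolding True by simp
      next
        case False
        then have "coprime p 2" using p(1) primes_coprime two_is_prime_nat by blast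
        then show ?thesis using p(3) unfolding o[symmetric] by (simp only: coprime_dvd_mult_right_iff)
      qed
      then obtain h where h: "h \<in> carrier ?G" "h \<noteq> \<one>\<^bsub>?G\<^esub>" "h [^]\<^bsub>?G\<^esub> p = \<one>\<^bsub>?G\<^esub>"
        using G.cauchy_prime_order[OF fin p(1)] by blast
      then have "h [^]\<^bsub>?G\<^esub> t = \<one>\<^bsub>?G\<^esub>" using p(2) G.pow_eq_id[OF h(1)] dvd_trans by blast
      then show False using T h by blast
    qed
  next
    assume cop: "coprime t (fact n)"
    show "\<forall>h\<in>carrier ?G. h [^]\<^bsub>?G\<^esub> t = \<one>\<^bsub>?G\<^esub> \<longrightarrow> h = \<one>\<^bsub>?G\<^esub>"
    proof (intro ballI impI)
      fix h assume h: "h \<in> carrier ?G" "h [^]\<^bsub>?G\<^esub> t = \<one>\<^bsub>?G\<^esub>"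
      then have "G.ord h dvd t" using G.pow_eq_id by blast
      moreover have "G.ord h dvd fact n" using G.ord_dvd_group_order[OF h(1)] o by (metis dvd_mult)
      ultimately have "G.ord h dvd 1" using cop by (meson coprime_common_divisor)
      then show "h = \<one>\<^bsub>?G\<^esub>" using G.ord_eq_1[OF h(1)] by simp
    qed
  qed
qed

theorem proposition4p4:
  fixes n t :: nat and \<theta> :: "(nat \<Rightarrow> nat) \<Rightarrow> (nat \<Rightarrow> nat)"
  assumes "n > 5"
    and "\<theta> \<in> carrier (AutoGroup (alt_group n))"
    and "t \<ge> 1"
  shows "superfaithful (power_quandle (alt_group n) t \<theta>) \<longleftrightarrow>
           \<theta> = \<one>\<^bsub>AutoGroup (alt_group n)\<^esub> \<and> coprime t (fact n)"
proof -
  let ?G = "alt_group n"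
  interpret G: group ?G by (rule alt_group_is_group)
  have \<theta>: "\<theta> \<in> auto ?G" using assms(2) by (simp add: AutoGroup_def)
  have fin: "finite (carrier ?G)" by (rule finite_alt_group)
  have one: "\<theta> = \<one>\<^bsub>AutoGroup ?G\<^esub> \<longleftrightarrow> (\<forall>x\<in>carrier ?G. \<theta> x = x)"
  proof
    show "\<theta> = \<one>\<^bsub>AutoGroup ?G\<^esub> \<Longrightarrow> \<forall>x\<in>carrier ?G. \<theta> x = x"
      by (simp add: AutoGroup_def BijGroup_def)
    have "\<theta> \<in> extensional (carrier ?G)" using \<theta> by (simp add: auto_def Bij_def)
    then show "\<forall>x\<in>carrier ?G. \<theta> x = x \<Longrightarrow> \<theta> = \<one>\<^bsub>AutoGroup ?G\<^esub>"
      unfolding AutoGroup_def BijGroup_def by (auto intro: extensionalityI[of _ "carrier ?G"])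
  qed
  have iso: "isolated ?G \<theta> \<longleftrightarrow> \<theta> = \<one>\<^bsub>AutoGroup ?G\<^esub>"
    unfolding one using isolated_alt_group_eq_identity[OF assms(1) \<theta>] by (auto simp: isolated_def)
  have "superfaithful (power_quandle ?G t \<theta>) \<longleftrightarrow>
      isolated ?G \<theta> \<and> (\<forall>h\<in>Fix ?G \<theta>. h [^]\<^bsub>?G\<^esub> t = \<one>\<^bsub>?G\<^esub> \<longrightarrow> h = \<one>\<^bsub>?G\<^esub>)"
    unfolding superfaithful_power_quandle_iff[OF G.is_group \<theta> assms(3)]
    by (rule G.power_condition_iff_isolated[OF fin \<theta>])
  moreover have "Fix ?G \<theta> = carrier ?G" if "\<theta> = \<one>\<^bsub>AutoGroup ?G\<^esub>"
    using that one by (auto simp: Fix_def)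
  ultimately show ?thesis
    using iso alt_group_torsion_free_iff_coprime[of n t] assms(1) by auto
qed

end
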